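(* Let $\gamma>0$. Assume A1, A2 and R1–R5. Assume moreover that either (i) $\alpha\in(\tfrac12,1)$, or (ii) $\alpha=1$ and $\mu\ge 1$, or (iii) $\alpha=1$, $\mu\in(0,1)$ and $\rho(t)=t^a$ for some $a\in[0,1)$. Then the SHUS$^\alpha_\rho$ algorithm started from any $(0,\infty)^d\times\mathsf X$-valued random initial condition $(\tilde\theta_0,X_0)$ satisfies: (i) $\lim_{n\to\infty}\theta_n=\theta_\star$ almost surely. (ii) For any bounded measurable $f:\mathsf X\to\mathbb R$, $\lim_{n\to\infty}\mathbb E[f(X_n)]=\int_{\mathsf X} f\,\pi^\rho_{\theta_\star}\,d\lambda$ and $\lim_{n\to\infty}\frac1n\sum_{k=1}^n f(X_k)=\int_{\mathsf X} f\,\pi^\rho_{\theta_\star}\,d\lambda$ almost surely. (iii) For any bounded measurable $f:\mathsf X\to\mathbb R$, $$\lim_{n\to\infty}\mathbb E\Big[\Big(\sum_{i=1}^d\frac{\theta_{n-1}(i)}{\rho(\theta_{n-1}(i))}\Big)\Big(\sum_{j=1}^d\rho(\theta_{n-1}(j))f(X_n)\mathbf 1_{\mathsf X_j}(X_n)\Big)\Big]=\int_{\mathsf X}f\,\pi\,d\lambda,$$ and almost surely $$\lim_{n\to\infty}\frac1n\sum_{k=1}^n\Big(\sum_{i=1}^d\frac{\theta_{k-1}(i)}{\rho(\theta_{k-1}(i))}\Big)\Big(\sum_{j=1}^d\rho(\theta_{k-1}(j))f(X_k)\mathbf 1_{\mathsf X_j}(X_k)\Big)=\int_{\mathsf X}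f\,\pi\,d\lambda.$$
   Context: Let $\mathsf X\subset\mathbb R^D$ be measurable, $\lambda$ a nonnegative reference measure on $\mathbb R^D$, and $\pi$ a probability density on $\mathsf X$ w.r.t. $\lambda$. Let $\mathsf X=\bigcup_{i=1}^d\mathsf X_i$ be a partition into disjoint measurable sets (strata), and $I(x)=i$ iff $x\in\mathsf X_i$. Set $\theta_\star(i)=\int_{\mathsf X_i}\pi\,d\lambda$ and $\Theta=\{\theta\in(0,1)^d:\sum_{i=1}^d\theta(i)=1\}$. For a measurable $\rho:(0,1)\to(0,\infty)$ and $\theta\in\Theta$, define $\pi^\rho_\theta(x)=(Z^\rho_\theta)^{-1}\sum_{i=1}^d\frac{\pi(x)}{\rho(\theta(i))}\mathbf 1_{\mathsf X_i}(x)$ with $Z^\rho_\theta=\sum_{i=1}^d\frac{\theta_\star(i)}{\rho(\theta(i))}$. A1: $\sup_{\mathsf X}\pi<\infty$ and $\min_{1\le i\le d}\theta_\star(i)>0$. A2: for every $\theta\in\Theta$, $P^\rho_\theta$ is the Metropolis–Hastings kernel with proposal $q(x,y)\,\lambda(dy)$, where $q$ is symmetric with $\inf_{\mathsf X^2}q>0$, and with invariant distribution $\pi^\rho_\theta\,d\lambda$ (acceptance probability $1\wedge\pi^\rho_\theta(y)/\pi^\rho_\theta(x)$). R1: for every compact $\mathcal K\subset(0,1)$ there is $C$ with $|1-\rho(t')/\rho(t)|\le C|t'-t|$ for all $t\in\mathcal K$, $t'\in(0,1)$. R2: $\sup_{(0,1)}\rho<\infty$. R3: $\rho$ is non-decreasing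 on $(0,1)$ and there is $R>1$ with $\inf_{t\in(0,1/R)}\rho(t)/\rho(Rt)>0$. R4: $t\mapsto\rho(t)/t$ is non-increasing on $(0,1)$ and $\lim_{t\to0^+}\rho(t)/t=+\infty$. R5: $\inf_{t\in(0,1)}\rho(t)/t>0$. SHUS$^\alpha_\rho$ algorithm: fix $\alpha\in(\frac12,1]$, $\gamma>0$, $\mu>0$, and let $g_\alpha(s)=(\ln(1+s))^{\alpha/(1-\alpha)}$ if $\alpha\in(\frac12,1)$, $g_1(s)=s^\mu$. Starting from $(\tilde\theta_0,X_0)\in(0,\infty)^d\times\mathsf X$, for $n\ge0$: set $S_n=\sum_{i=1}^d\tilde\theta_n(i)$, $\theta_n=\tilde\theta_n/S_n$; draw $X_{n+1}$, conditionally on $\sigma(\tilde\theta_0,X_0,\dots,X_n)$, from $P^\rho_{\theta_n}(X_n,\cdot)$; set $\tilde\theta_{n+1}(i)=\tilde\theta_n(i)+\frac{\gamma}{g_\alpha(S_n)}S_n\rho(\theta_n(i))\mathbf 1_{\mathsf X_i}(X_{n+1})$ for each $i$. *)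

theory Defs
  imports "HOL-Probability.Probability"
begin

text \<open>Strata are indexed by i < d (i.e. 0,...,d-1 instead of 1,...,d).
  Vectors theta in Theta are represented as functions nat => real; only the
  values at i < d matter.\<close>

definition Theta :: "nat \<Rightarrow> (nat \<Rightarrow> real) set" where
  "Theta d = {\<theta>. (\<forall>i<d. 0 < \<theta> i \<and> \<theta> i < 1) \<and> (\<Sum>i<d. \<theta> i) = 1}"

definition theta_star :: "'x measure \<Rightarrow> ('x \<Rightarrow> real) \<Rightarrow> (nat \<Rightarrow> 'x set) \<Rightarrow> nat \<Rightarrow> real" where
  "theta_star lam dens Xi i = (LINT x:Xi i|lam. dens x)"

definition Z_rho :: "'x measure \<Rightarrow> ('x \<Rightarrow> real) \<Rightarrow> (nat \<Rightarrow> 'x set) \<Rightarrow> nat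
    \<Rightarrow> (real \<Rightarrow> real) \<Rightarrow> (nat \<Rightarrow> real) \<Rightarrow> real" where
  "Z_rho lam dens Xi d rho \<theta> = (\<Sum>i<d. theta_star lam dens Xi i / rho (\<theta> i))"

definition pi_rho :: "'x measure \<Rightarrow> ('x \<Rightarrow> real) \<Rightarrow> (nat \<Rightarrow> 'x set) \<Rightarrow> nat
    \<Rightarrow> (real \<Rightarrow> real) \<Rightarrow> (nat \<Rightarrow> real) \<Rightarrow> 'x \<Rightarrow> real" where
  "pi_rho lam dens Xi d rho \<theta> x =
     (\<Sum>i<d. dens x / rho (\<theta> i) * indicator (Xi i) x) / Z_rho lam dens Xi d rho \<theta>"

text \<open>Metropolis-Hastings acceptance probability 1 min p(y)/p(x), with the usual
  convention that a move away from a point of zero target density is always accepted.\<close>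
definition mh_acc :: "('x \<Rightarrow> real) \<Rightarrow> 'x \<Rightarrow> 'x \<Rightarrow> real" where
  "mh_acc p x y = (if p x = 0 then 1 else min 1 (p y / p x))"

definition mh_kernel :: "'x measure \<Rightarrow> 'x set \<Rightarrow> ('x \<Rightarrow> 'x \<Rightarrow> real) \<Rightarrow> ('x \<Rightarrow> real)
    \<Rightarrow> 'x \<Rightarrow> 'x set \<Rightarrow> real" where
  "mh_kernel lam Xs q p x A =
     (LINT y:(A \<inter> Xs)|lam. q x y * mh_acc p x y)
     + (1 - (LINT y:Xs|lam. q x y * mh_acc p x y)) * indicator A x"

definition P_rho :: "'x measure \<Rightarrow> 'x set \<Rightarrow> ('x \<Rightarrow> 'x \<Rightarrow> real) \<Rightarrow> ('x \<Rightarrow> real)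
    \<Rightarrow> (nat \<Rightarrow> 'x set) \<Rightarrow> nat \<Rightarrow> (real \<Rightarrow> real) \<Rightarrow> (nat \<Rightarrow> real) \<Rightarrow> 'x \<Rightarrow> 'x set \<Rightarrow> real" where
  "P_rho lam Xs q dens Xi d rho \<theta> = mh_kernel lam Xs q (pi_rho lam dens Xi d rho \<theta>)"

definition g_fun :: "real \<Rightarrow> real \<Rightarrow> real \<Rightarrow> real" where
  "g_fun \<alpha> \<mu> s = (if \<alpha> < 1 then (ln (1 + s)) powr (\<alpha> / (1 - \<alpha>)) else s powr \<mu>)"

definition S_of :: "nat \<Rightarrow> (nat \<Rightarrow> real) \<Rightarrow> real" where
  "S_of d \<theta>t = (\<Sum>i<d. \<theta>t i)"

definition normalize_theta :: "nat \<Rightarrow> (nat \<Rightarrow> real) \<Rightarrow> nat \<Rightarrow> real" where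
  "normalize_theta d \<theta>t i = \<theta>t i / S_of d \<theta>t"

definition hist_sigma :: "'w measure \<Rightarrow> nat \<Rightarrow> (nat \<Rightarrow> 'w \<Rightarrow> nat \<Rightarrow> real)
    \<Rightarrow> (nat \<Rightarrow> 'w \<Rightarrow> 'x::topological_space) \<Rightarrow> nat \<Rightarrow> 'w set set" where
  "hist_sigma M d \<theta>t X n = sigma_sets (space M)
     ({{\<omega> \<in> space M. \<theta>t 0 \<omega> i \<in> B} | i B. i < d \<and> B \<in> sets (borel :: real measure)}
      \<union> {{\<omega> \<in> space M. X k \<omega> \<in> A} | k A. k \<le> n \<and> A \<in> sets (borel :: 'x measure)})"

end

theory Submission
  imports Defs
begin

text \<open>Let \<open>stp n = \<gamma> / g_fun \<alpha> \<mu> (S n)\<close> be the step size, which decreases in \<open>n\<close>.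
  Since \<open>rho t \<ge> c t\<close>, every step multiplies one of the weights by at least \<open>1 + c stp n\<close>, so
  \<open>n stp n\<close> is bounded by a multiple of \<open>1 + \<bar>ln (S n)\<bar>\<close> on every path; hence \<open>S n\<close> tends to infinity
  and \<open>stp\<close> is square summable. By the monotonicity of \<open>rho t\<close> and \<open>rho t / t\<close>, a step decreases
  \<open>ln (rho (\<theta> n i))\<close> by at most \<open>O(stp n)\<close>; as this quantity is bounded above, its variation is summable against
  every decreasing square summable sequence. The Metropolis kernels satisfy a Doeblin minorization
  that is uniform in \<open>\<theta>\<close>, so the solutions of their Poisson equations are bounded, and Lipschitz in
  \<open>ln (rho (\<theta> i))\<close>. Martingale convergence then makes
  \<open>\<Sum> stp n (f n (X (n + 1)) - \<pi> n (f n))\<close> converge without any stability assumption on \<open>\<theta> n\<close>.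
  Applied to the strata, this gives a convergent series \<open>\<Sum> stp n \<zeta> n\<close> whose partial sums weighted by \<open>S n\<close>
  are \<open>\<theta>t n i - \<theta>\<^sub>\<star> i S n\<close> up to a constant, and Kronecker's lemma shows that \<open>\<theta> n i\<close> tends to \<open>\<theta>\<^sub>\<star> i\<close>.
  The ergodic averages follow in the same way from the weights \<open>1 / n\<close>.\<close>

section \<open>Real sequences and the paths of the weights\<close>

text \<open>The usual obstacle is stability: the kernels could degenerate when some
  \<open>\<theta> n i\<close> drifts to 0. It is bypassed because the estimates never see
  \<open>\<theta>\<close> directly. The stratum with the least \<open>rho (\<theta> i)\<close>
  already carries enough of the minorizing measure, so the Doeblin constant involves the smallest
  stratum mass and not \<open>\<theta>\<close>; and two kernels are compared through
  \<open>ln (rho (\<theta> i))\<close>, whose variation follows from one-sided bounds. The mean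
  field disappears as well. Under the invariant law of the kernel frozen at \<open>\<theta>\<close>,
  \<open>rho (\<theta> i)\<close> times the indicator of stratum \<open>i\<close> has mean
  \<open>\<theta>\<^sub>\<star> i / Z\<close>, with one \<open>Z\<close> for all strata. The
  combination driving \<open>\<theta>t n i - \<theta>\<^sub>\<star> i * S n\<close> therefore has
  mean exactly 0 for every \<open>\<theta>\<close>, and what is left is pure noise. The condition
  \<alpha> > 1/2 is what makes the steps square summable: \<open>n * stp n\<close> is of the order
  of \<open>ln (S n)\<close>, which is at most a power below 1 of
  \<open>g_fun \<alpha> \<mu> (S n) = \<gamma> / stp n\<close>.\<close>

lemma toeplitz_null:
  fixes b t :: "nat \<Rightarrow> real"
  assumes b: "incseq b" "filterlim b at_top sequentially" and t: "t \<longlonglongrightarrow> 0"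
  shows "(\<lambda>n. (\<Sum>k<n. (b (Suc k) - b k) * t k) / b n) \<longlonglongrightarrow> 0"
proof (rule LIMSEQ_I)
  fix e :: real assume e: "e > 0"
  obtain N where N: "\<And>k. k \<ge> N \<Longrightarrow> \<bar>t k\<bar> < e / 2"
    using LIMSEQ_D[OF t, of "e/2"] e by auto
  \<comment> \<open>\<open>C\<close> absorbs the first \<open>N\<close> terms; the summand with
    \<open>\<bar>b N\<bar>\<close> is there because \<open>b\<close> may start negative.\<close>
  define C where "C = \<bar>\<Sum>k<N. (b (Suc k) - b k) * t k\<bar> + e / 2 * \<bar>b N\<bar>"
  have bound: "\<bar>\<Sum>k<n. (b (Suc k) - b k) * t k\<bar> \<le> C + e / 2 * b n" if "n \<ge> N" for n
    using that
  proof (induction n rule: dec_induct)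
    case base
    then show ?case using e by (auto simp: C_def abs_if algebra_simps mult_nonneg_nonneg)
  next
    case (step n)
    have "\<bar>(b (Suc n) - b n) * t n\<bar> \<le> (b (Suc n) - b n) * (e / 2)"
      using mult_left_mono[of "\<bar>t n\<bar>" "e / 2" "b (Suc n) - b n"] N[OF step(1)] incseq_SucD[OF b(1), of n]
      by (simp add: abs_mult)
    then have "\<bar>(b (Suc n) - b n) * t n\<bar> \<le> e / 2 * b (Suc n) - e / 2 * b n"
      by (simp only: right_diff_distrib mult.commute)
    then show ?case using step(3) unfolding sum.lessThan_Suc by linarith
  qed
  have "eventually (\<lambda>n. b n > max 0 (2 * C / e)) sequentially"
    using b(2) unfolding filterlim_at_top_dense by blast
  moreover have "eventually (\<lambda>n. n \<ge> N) sequentially" by (rule eventually_ge_at_top)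
  ultimately have "eventually (\<lambda>n. norm ((\<Sum>k<n. (b (Suc k) - b k) * t k) / b n - 0) < e) sequentially"
  proof eventually_elim
    case (elim n)
    have bn: "b n > 0" "C < e / 2 * b n" using elim e by (auto simp: field_simps)
    have "\<bar>\<Sum>k<n. (b (Suc k) - b k) * t k\<bar> < e * b n"
      using bound[OF elim(2)] bn(2) by simp
    then show ?case using bn(1) by (simp add: abs_divide divide_less_eq)
  qed
  then show "\<exists>no. \<forall>n\<ge>no. norm ((\<Sum>k<n. (b (Suc k) - b k) * t k) / b n - 0) < e"
    by (simp add: eventually_sequentially)
qed

text \<open>Summation by parts against the tails \<open>T\<close> of the series. The tails tend to
  0, so apart from vanishing boundary terms there remains a Toeplitz mean of \<open>T\<close> with
  weights \<open>b (Suc k) - b k\<close>.\<close>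

lemma kronecker_lemma:
  fixes a b :: "nat \<Rightarrow> real"
  assumes a: "summable a" and b: "incseq b" "filterlim b at_top sequentially"
  shows "(\<lambda>n. (\<Sum>k<n. b k * a k) / b n) \<longlonglongrightarrow> 0"
proof -
  define T where "T n = suminf a - (\<Sum>k<n. a k)" for n
  have T0: "T \<longlonglongrightarrow> 0"
    unfolding T_def using tendsto_diff[OF tendsto_const summable_LIMSEQ[OF a], of "suminf a"] by simp
  have eq: "(\<Sum>k<n. b k * a k) = b 0 * T 0 - b n * T n + (\<Sum>k<n. (b (Suc k) - b k) * T (Suc k))" for n
  proof (induction n)
    case (Suc n)
    have "a n = T n - T (Suc n)" by (simp add: T_def)
    then have "b n * a n = b n * T n - b n * T (Suc n)" by (simp add: right_diff_distrib)
    then show ?case using Suc by (simp add: left_diff_distrib)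
  qed simp
  have lim: "(\<lambda>n. b 0 * T 0 / b n - T n + (\<Sum>k<n. (b (Suc k) - b k) * T (Suc k)) / b n) \<longlonglongrightarrow> 0 - 0 + 0"
    by (intro tendsto_add tendsto_diff T0 toeplitz_null b LIMSEQ_Suc
        real_tendsto_divide_at_top[OF tendsto_const])
  have "eventually (\<lambda>n. b n > 0) sequentially"
    using b(2) by (simp add: filterlim_at_top_dense)
  then have "eventually (\<lambda>n. b 0 * T 0 / b n - T n + (\<Sum>k<n. (b (Suc k) - b k) * T (Suc k)) / b n
      = (\<Sum>k<n. b k * a k) / b n) sequentially"
    by eventually_elim (simp add: eq add_divide_distrib diff_divide_distrib)
  from Lim_transform_eventually[OF lim this] show ?thesis by simp
qed

lemma cesaro_mean:
  fixes p :: "nat \<Rightarrow> real"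
  assumes "p \<longlonglongrightarrow> l"
  shows "(\<lambda>n. (\<Sum>k<n. p k) / real n) \<longlonglongrightarrow> l"
proof -
  have "(\<lambda>n. (\<Sum>k<n. (real (Suc k) - real k) * (p k - l)) / real n) \<longlonglongrightarrow> 0"
    by (intro toeplitz_null filterlim_real_sequentially)
       (use assms in \<open>auto simp: incseq_def LIM_zero_iff\<close>)
  then have lim: "(\<lambda>n. (\<Sum>k<n. p k - l) / real n + l) \<longlonglongrightarrow> l"
    using tendsto_add[of _ 0 sequentially "\<lambda>_. l" l] by simp
  have "eventually (\<lambda>n. (\<Sum>k<n. p k - l) / real n + l = (\<Sum>k<n. p k) / real n) sequentially"
    using eventually_gt_at_top[of 0]
    by eventually_elim (simp add: sum_subtractf field_simps)
  from Lim_transform_eventually[OF lim this] show ?thesis .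
qed

text \<open>Since \<open>v\<close> is bounded above, its total weighted increase is paid for by its decrease.\<close>
lemma summable_weighted_variation:
  fixes \<beta> v \<delta> \<epsilon> :: "nat \<Rightarrow> real"
  assumes \<beta>: "decseq \<beta>" "\<And>n. 0 \<le> \<beta> n" and v: "\<And>n. v n \<le> V"
    and \<delta>: "\<And>n. 0 \<le> \<delta> n" "\<And>n. \<delta> n \<le> v (Suc n) - v n + \<epsilon> n"
    and \<epsilon>: "summable (\<lambda>n. \<beta> n * \<epsilon> n)" "\<And>n. 0 \<le> \<epsilon> n"
  shows "summable (\<lambda>n. \<beta> n * \<delta> n)"
proof (rule summableI_nonneg_bounded)
  show "0 \<le> \<beta> n * \<delta> n" for n using \<beta>(2) \<delta>(1) by simp
  \<comment> \<open>Summation by parts: \<open>V - v\<close> is nonnegative and \<beta> decreases,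
    so replacing \<open>\<beta> n\<close> by \<open>\<beta> (Suc n)\<close> in front of it has the
    right sign.\<close>
  have *: "(\<Sum>k<n. \<beta> k * (v (Suc k) - v k)) \<le> \<beta> 0 * (V - v 0) - \<beta> n * (V - v n)" for n
  proof (induction n)
    case (Suc n)
    have "\<beta> (Suc n) * (V - v (Suc n)) \<le> \<beta> n * (V - v (Suc n))"
      using v[of "Suc n"] decseq_SucD[OF \<beta>(1), of n] by (intro mult_right_mono) auto
    then show ?case using Suc by (simp add: algebra_simps)
  qed simp
  show "(\<Sum>k<n. \<beta> k * \<delta> k) \<le> \<beta> 0 * (V - v 0) + (\<Sum>k. \<beta> k * \<epsilon> k)" for n
  proof -
    have "(\<Sum>k<n. \<beta> k * \<delta> k) \<le> (\<Sum>k<n. \<beta> k * (v (Suc k) - v k) + \<beta> k * \<epsilon> k)"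
      using mult_left_mono[OF \<delta>(2) \<beta>(2)] by (intro sum_mono) (simp add: distrib_left)
    also have "\<dots> \<le> \<beta> 0 * (V - v 0) - \<beta> n * (V - v n) + (\<Sum>k. \<beta> k * \<epsilon> k)"
      unfolding sum.distrib using \<beta>(2) \<epsilon> by (intro add_mono[OF *] sum_le_suminf) auto
    also have "\<dots> \<le> \<beta> 0 * (V - v 0) + (\<Sum>k. \<beta> k * \<epsilon> k)" using \<beta>(2)[of n] v[of n] by simp
    finally show ?thesis .
  qed
qed

lemma summable_mult_of_squares:
  fixes x y :: "nat \<Rightarrow> real"
  assumes "summable (\<lambda>n. (x n)\<^sup>2)" "summable (\<lambda>n. (y n)\<^sup>2)"
  shows "summable (\<lambda>n. x n * y n)"
proof (rule summable_comparison_test[OF _ summable_add[OF assms]], intro exI allI impI)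
  fix n
  have "0 \<le> (\<bar>x n\<bar> - \<bar>y n\<bar>)\<^sup>2" "0 \<le> \<bar>x n\<bar> * \<bar>y n\<bar>" by auto
  then show "norm (x n * y n) \<le> (x n)\<^sup>2 + (y n)\<^sup>2"
    by (simp only: power2_diff power2_abs abs_mult real_norm_def)
qed

section \<open>Growth of the function that controls the step size\<close>

lemma g_fun_pos: "0 < s \<Longrightarrow> 0 < g_fun \<alpha> \<mu> s"
  by (auto simp: g_fun_def)

lemma g_fun_mono:
  assumes "0 < s" "s \<le> t" "0 < \<alpha>" "0 < \<mu>"
  shows "g_fun \<alpha> \<mu> s \<le> g_fun \<alpha> \<mu> t"
  using assms by (auto simp: g_fun_def intro!: powr_mono2)

lemma measurable_g_fun [measurable]: "g_fun \<alpha> \<mu> \<in> borel_measurable borel"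
  unfolding g_fun_def by measurable

text \<open>An exponent below 1 is what the square summability of the steps asks for. When \<alpha>
  < 1, \<open>p\<close> inverts the power of the logarithm in \<open>g_fun\<close>, and
  \<open>p < 1\<close> is equivalent to \<alpha> > 1/2. When \<alpha> = 1, \<open>g_fun\<close> is a
  power of \<open>s\<close>, any positive power of which dominates the logarithm; 1/2 is
  taken.\<close>

lemma ln_le_g_fun_powr:
  assumes "1/2 < \<alpha>" "\<alpha> \<le> 1" "0 < \<mu>"
  obtains p C where "0 < p" "p < 1" "\<And>s. 1 \<le> s \<Longrightarrow> 1 + ln s \<le> C * g_fun \<alpha> \<mu> s powr p"
proof (cases "\<alpha> < 1")
  case True
  define p where "p = (1 - \<alpha>) / \<alpha>"
  have "1 + ln s \<le> (1 / ln 2 + 1) * g_fun \<alpha> \<mu> s powr p" if "1 \<le> s" for s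
  proof -
    have "g_fun \<alpha> \<mu> s powr p = ln (1 + s)"
      using True assms that by (simp add: g_fun_def p_def powr_powr)
    moreover have "ln 2 \<le> ln (1 + s)" "ln s \<le> ln (1 + s)" using that by auto
    moreover have "ln (2::real) > 0" by simp
    ultimately have "1 \<le> ln (1 + s) / ln 2" "ln s \<le> ln (1 + s)"
      by (auto simp: le_divide_eq_1)
    then show ?thesis unfolding \<open>g_fun \<alpha> \<mu> s powr p = ln (1 + s)\<close> distrib_right by (simp add: add_mono)
  qed
  then show ?thesis using that[of p "1 / ln 2 + 1"] assms True by (auto simp: p_def field_simps)
next
  case False
  have "1 + ln s \<le> (1 + 2 / \<mu>) * g_fun \<alpha> \<mu> s powr (1/2)" if "1 \<le> s" for s
  proof -
    have "g_fun \<alpha> \<mu> s powr (1/2) = s powr (\<mu> / 2)"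
      using False by (simp add: g_fun_def powr_powr)
    moreover have "ln s \<le> s powr (\<mu> / 2) / (\<mu> / 2)" using that assms by (intro ln_powr_bound) auto
    moreover have "1 \<le> s powr (\<mu> / 2)" using that assms by (intro ge_one_powr_ge_zero) auto
    ultimately show ?thesis by (simp add: field_simps)
  qed
  then show ?thesis using that[of "1/2" "1 + 2 / \<mu>"] by auto
qed

section \<open>Regularity of rho on the logarithmic scale\<close>

locale rho_function =
  fixes rho :: "real \<Rightarrow> real" and Rb c5 :: real
  assumes rho_pos: "\<And>t. 0 < t \<Longrightarrow> t < 1 \<Longrightarrow> 0 < rho t"
    and rho_le: "\<And>t. 0 < t \<Longrightarrow> t < 1 \<Longrightarrow> rho t \<le> Rb"
    and rho_mono: "\<And>s t. 0 < s \<Longrightarrow> s \<le> t \<Longrightarrow> t < 1 \<Longrightarrow> rho s \<le> rho t"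
    and rho_anti: "\<And>s t. 0 < s \<Longrightarrow> s \<le> t \<Longrightarrow> t < 1 \<Longrightarrow> rho t / t \<le> rho s / s"
    and c5_pos: "0 < c5"
    and rho_ge: "\<And>t. 0 < t \<Longrightarrow> t < 1 \<Longrightarrow> c5 * t \<le> rho t"
begin

lemma Rb_pos: "0 < Rb"
  using rho_pos[of "1/2"] rho_le[of "1/2"] by simp

text \<open>As a function of \<open>ln t\<close>, \<open>ln (rho t)\<close> is non-decreasing and
  1-Lipschitz: the former by monotonicity of \<open>rho\<close>, the latter by that of
  \<open>rho t / t\<close>. The continuity of \<open>rho\<close> at the limiting weights is derived
  from this.\<close>

lemma ln_rho_diff_le:
  assumes "0 < s" "s \<le> t" "t < 1"
  shows "ln (rho s) \<le> ln (rho t)" "ln (rho t) - ln (rho s) \<le> ln t - ln s"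
proof -
  have p: "0 < rho s" "0 < rho t" using assms by (auto intro!: rho_pos)
  show "ln (rho s) \<le> ln (rho t)" using p rho_mono[OF assms] by simp
  have "rho t / rho s \<le> t / s" using rho_anti[OF assms] p assms by (simp add: field_simps)
  then have "ln (rho t / rho s) \<le> ln (t / s)" using p assms by (subst ln_le_cancel_iff) auto
  then show "ln (rho t) - ln (rho s) \<le> ln t - ln s" using p assms by (simp add: ln_div)
qed

lemma ln_rho_lipschitz:
  assumes "0 < s" "s < 1" "0 < t" "t < 1"
  shows "\<bar>ln (rho s) - ln (rho t)\<bar> \<le> \<bar>ln s - ln t\<bar>"
  using ln_rho_diff_le[of s t] ln_rho_diff_le[of t s] assms by (cases "s \<le> t") auto

text \<open>One-sided: \<open>s\<close> may exceed \<open>t\<close> by far, where monotonicity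
  suffices, but is at most a factor \<open>1 + e\<close> smaller. This is the situation of a
  normalized weight after one step.\<close>

lemma ln_rho_ge:
  assumes "0 < s" "s < 1" "0 < t" "t < 1" "0 \<le> e" "t / (1 + e) \<le> s"
  shows "ln (rho t) - e \<le> ln (rho s)"
proof (cases "t \<le> s")
  case True
  then show ?thesis using ln_rho_diff_le(1)[of t s] assms by simp
next
  case False
  have "ln (t / (1 + e)) \<le> ln s" using assms by (subst ln_le_cancel_iff) auto
  moreover have "ln (1 + e) \<le> e" using assms by (intro ln_add_one_self_le_self) auto
  ultimately show ?thesis
    using ln_rho_diff_le(2)[of s t] False assms by (simp add: ln_div)
qed

lemma tendsto_rho:
  assumes "(x \<longlongrightarrow> t) F" "0 < t" "t < 1" "eventually (\<lambda>n. 0 < x n \<and> x n < 1) F"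
  shows "((\<lambda>n. ln (rho (x n))) \<longlongrightarrow> ln (rho t)) F" "((\<lambda>n. rho (x n)) \<longlongrightarrow> rho t) F"
proof -
  have "((\<lambda>n. \<bar>ln (x n) - ln t\<bar>) \<longlongrightarrow> 0) F"
    using tendsto_ln[OF assms(1)] assms(2) by (intro tendsto_rabs_zero LIM_zero) auto
  then have "((\<lambda>n. ln (rho (x n)) - ln (rho t)) \<longlongrightarrow> 0) F"
    by (rule Lim_null_comparison[rotated])
       (use assms(4) ln_rho_lipschitz assms(2,3) in \<open>auto elim!: eventually_mono\<close>)
  then show *: "((\<lambda>n. ln (rho (x n))) \<longlongrightarrow> ln (rho t)) F" by (rule LIM_zero_cancel)
  have "eventually (\<lambda>n. exp (ln (rho (x n))) = rho (x n)) F"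
    using assms(4) by eventually_elim (simp add: rho_pos)
  from Lim_transform_eventually[OF tendsto_exp[OF *] this] show "((\<lambda>n. rho (x n)) \<longlongrightarrow> rho t) F"
    using assms(2,3) rho_pos by simp
qed

end

text \<open>One fixed trajectory, where \<open>J n\<close> is the stratum reached at time
  \<open>n + 1\<close>. The facts proved here hold surely; probability enters through the
  summability hypothesis of \<open>th_tendsto\<close>.\<close>

locale shus_path = rho_function rho Rb c5 for rho :: "real \<Rightarrow> real" and Rb c5 :: real +
  fixes \<alpha> \<gamma> \<mu> :: real and d :: nat and T :: "nat \<Rightarrow> nat \<Rightarrow> real" and J :: "nat \<Rightarrow> nat"
  assumes \<alpha>: "1/2 < \<alpha>" "\<alpha> \<le> 1" and \<gamma>: "0 < \<gamma>" and \<mu>: "0 < \<mu>" and d: "2 \<le> d"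
    and init: "\<And>i. i < d \<Longrightarrow> 0 < T 0 i" and J: "\<And>n. J n < d"
    and step: "\<And>n i. i < d \<Longrightarrow> T (Suc n) i = T n i + \<gamma> / g_fun \<alpha> \<mu> (S_of d (T n)) * S_of d (T n)
              * rho (normalize_theta d (T n) i) * (if i = J n then 1 else 0)"
begin

abbreviation "S n \<equiv> S_of d (T n)"
abbreviation "th n \<equiv> normalize_theta d (T n)"
definition "stp n = \<gamma> / g_fun \<alpha> \<mu> (S n)"

text \<open>Strictness comes from a second positive coordinate, which exists as
  \<open>2 \<le> d\<close>. The vector is arbitrary because the bounds are used within the induction
  for positivity and later for the stratum masses.\<close>

lemma normalize_bounds:
  assumes "\<And>i. i < d \<Longrightarrow> 0 < t i" "i < d"
  shows "0 < S_of d t" "0 < normalize_theta d t i" "normalize_theta d t i < 1" "t i < S_of d t"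
proof -
  show S: "0 < S_of d t"
    unfolding S_of_def using assms by (intro sum_pos) auto
  obtain j where j: "j < d" "j \<noteq> i" using d that[of 0] that[of 1] by (cases "i = 0") auto
  have "t i + t j \<le> S_of d t"
    unfolding S_of_def using j assms sum_mono2[of "{..<d}" "{i, j}" t] by (auto simp: less_imp_le)
  then show "t i < S_of d t" using assms(1)[OF j(1)] by simp
  then show "0 < normalize_theta d t i" "normalize_theta d t i < 1"
    using S assms by (auto simp: normalize_theta_def)
qed

lemma T_pos: "i < d \<Longrightarrow> 0 < T n i"
proof (induction n arbitrary: i)
  case (Suc n)
  have "0 \<le> \<gamma> / g_fun \<alpha> \<mu> (S n) * S n * rho (th n i) * (if i = J n then 1 else 0)"
    using normalize_bounds[of "T n" i, OF Suc.IH] Suc.prems \<gamma> g_fun_pos[of "S n" \<alpha> \<mu>] rho_pos[of "th n i"]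
    by auto
  then show ?case using Suc.IH[OF Suc.prems] step[OF Suc.prems, of n] by linarith
qed (use init in simp)

lemma S_pos: "0 < S n" and th_pos: "i < d \<Longrightarrow> 0 < th n i" and th_less: "i < d \<Longrightarrow> th n i < 1"
  using normalize_bounds(1)[of "T n" 0] normalize_bounds(2,3)[of "T n" i] T_pos d by auto

lemma stp_pos: "0 < stp n"
  using S_pos \<gamma> g_fun_pos by (simp add: stp_def)

lemma step': "i < d \<Longrightarrow> T (Suc n) i = T n i + stp n * S n * rho (th n i) * (if i = J n then 1 else 0)"
  using step by (simp add: stp_def)

lemma S_Suc: "S (Suc n) = S n + stp n * S n * rho (th n (J n))"
proof -
  have "S (Suc n) = (\<Sum>i<d. T n i + stp n * S n * rho (th n i) * (if i = J n then 1 else 0))"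
    unfolding S_of_def[of d "T (Suc n)"] by (intro sum.cong) (auto simp: step')
  also have "\<dots> = S n + stp n * S n * rho (th n (J n))"
  proof -
    have "(\<Sum>i<d. stp n * S n * rho (th n i) * (if i = J n then 1 else 0))
        = (\<Sum>i<d. if i = J n then stp n * S n * rho (th n (J n)) else 0)"
      by (intro sum.cong) auto
    also have "\<dots> = stp n * S n * rho (th n (J n))"
      using J[of n] by simp
    finally show ?thesis by (simp add: sum.distrib S_of_def[of d "T n", symmetric])
  qed
  finally show ?thesis .
qed

lemma rho_th: "i < d \<Longrightarrow> 0 < rho (th n i)" "i < d \<Longrightarrow> rho (th n i) \<le> Rb"
  using th_pos th_less rho_pos rho_le by auto

lemma incseq_S: "incseq S"
  by (intro incseq_SucI) (use S_Suc stp_pos S_pos rho_th(1) J in \<open>simp add: less_imp_le\<close>)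

lemma decseq_stp: "decseq stp"
proof (rule decseq_SucI)
  fix n
  have "g_fun \<alpha> \<mu> (S n) \<le> g_fun \<alpha> \<mu> (S (Suc n))"
    using S_pos incseq_SucD[OF incseq_S] \<alpha> \<mu> by (intro g_fun_mono) auto
  then show "stp (Suc n) \<le> stp n"
    unfolding stp_def using \<gamma> g_fun_pos S_pos by (intro divide_left_mono) auto
qed

text \<open>Summing over all strata removes the question of which one was visited: the visited
  weight grows by \<open>stp n * S n * rho (th n i)\<close>, which is at least
  \<open>c5 * stp n\<close> times itself, and the others stay.\<close>

lemma sum_ln_step: "(\<Sum>i<d. ln (T n i)) + ln (1 + c5 * stp n) \<le> (\<Sum>i<d. ln (T (Suc n) i))"
proof -
  have "(\<Sum>i<d. ln (T n i)) + ln (1 + c5 * stp n)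
      = (\<Sum>i<d. ln (T n i) + (if i = J n then ln (1 + c5 * stp n) else 0))"
    using J[of n] by (simp add: sum.distrib)
  also have "\<dots> \<le> (\<Sum>i<d. ln (T (Suc n) i))"
  proof (rule sum_mono)
    fix i assume "i \<in> {..<d}"
    then have i: "i < d" by simp
    show "ln (T n i) + (if i = J n then ln (1 + c5 * stp n) else 0) \<le> ln (T (Suc n) i)"
    proof (cases "i = J n")
      case True
      have "c5 * T n i \<le> S n * rho (th n i)"
        using rho_ge[OF th_pos[OF i] th_less[OF i], of n] S_pos[of n]
        by (simp add: normalize_theta_def field_simps)
      then have "stp n * (c5 * T n i) \<le> stp n * (S n * rho (th n i))"
        using stp_pos[of n] by (intro mult_left_mono) auto
      then have "T n i * (1 + c5 * stp n) \<le> T (Suc n) i"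
        using True step'[OF i, of n] by (simp add: algebra_simps)
      then have "ln (T n i * (1 + c5 * stp n)) \<le> ln (T (Suc n) i)"
        using T_pos[OF i, of n] mult_pos_pos[OF c5_pos stp_pos[of n]] by (intro ln_mono) auto
      moreover have "0 < 1 + c5 * stp n" using c5_pos stp_pos[of n] by (auto intro!: add_pos_pos)
      ultimately show ?thesis using True T_pos[OF i, of n] by (simp add: ln_mult)
    next
      case False
      then show ?thesis by (simp add: step'[OF i])
    qed
  qed
  finally show ?thesis .
qed

text \<open>The sum of the \<open>ln (T n i)\<close> has collected \<open>n\<close> increments, each
  at least of the order of \<open>stp n\<close> because the steps decrease, yet it is at most
  \<open>real d * ln (S n)\<close>.\<close>

lemma stp_le:
  obtains C where "0 \<le> C" "\<And>n. real n * stp n \<le> C * (1 + \<bar>ln (S n)\<bar>)"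
proof -
  \<comment> \<open>From \<open>x / (1 + x) \<le> ln (1 + x)\<close> with
    \<open>x = c5 * stp k\<close>; the denominator is largest at \<open>k = 0\<close>.\<close>
  define q where "q = c5 / (1 + c5 * stp 0)"
  have q: "0 < q" using c5_pos stp_pos[of 0] by (auto simp: q_def intro!: divide_pos_pos add_pos_pos)
  have ln_ge: "q * stp n \<le> ln (1 + c5 * stp k)" if "k \<le> n" for k n
  proof -
    have p: "0 < c5 * stp k" using c5_pos stp_pos by simp
    have "stp n \<le> stp k" "stp k \<le> stp 0" using decseq_stp that by (auto simp: decseq_def)
    then have "c5 * stp n \<le> c5 * stp k" "c5 * stp k \<le> c5 * stp 0" using c5_pos by auto
    then have "c5 * stp n / (1 + c5 * stp 0) \<le> c5 * stp k / (1 + c5 * stp k)"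
      using p c5_pos stp_pos[of n] by (intro frac_le add_left_mono add_pos_pos) auto
    also have "\<dots> = 1 - inverse (1 + c5 * stp k)" using p by (simp add: field_simps)
    also have "\<dots> \<le> ln (1 + c5 * stp k)"
      using ln_add_one_self_le_self2[of "inverse (1 + c5 * stp k) - 1"] p by (simp add: ln_inverse)
    finally show ?thesis by (simp add: q_def)
  qed
  define A where "A = (\<Sum>i<d. ln (T 0 i))"
  have sum_ge: "A + (\<Sum>k<n. ln (1 + c5 * stp k)) \<le> (\<Sum>i<d. ln (T n i))" for n
  proof (induction n)
    case (Suc n)
    then show ?case using sum_ln_step[of n] by simp
  qed (simp add: A_def)
  have le: "q * (real n * stp n) \<le> \<bar>A\<bar> + real d * \<bar>ln (S n)\<bar>" for n
  proof -
    have "q * (real n * stp n) = (\<Sum>k<n. q * stp n)" by simp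
    also have "\<dots> \<le> (\<Sum>k<n. ln (1 + c5 * stp k))" by (intro sum_mono ln_ge) auto
    also have "\<dots> \<le> (\<Sum>i<d. ln (T n i)) - A" using sum_ge[of n] by simp
    also have "(\<Sum>i<d. ln (T n i)) \<le> (\<Sum>i<d. ln (S n))"
      using T_pos normalize_bounds(4)[of "T n"] S_pos by (intro sum_mono) (auto simp: less_imp_le)
    also have "(\<Sum>i<d. ln (S n)) - A \<le> real d * \<bar>ln (S n)\<bar> + \<bar>A\<bar>"
      using mult_left_mono[OF abs_ge_self[of "ln (S n)"], of "real d"] abs_ge_minus_self[of A] by simp
    finally show ?thesis by simp
  qed
  show ?thesis
  proof (rule that[of "(\<bar>A\<bar> + real d) / q"])
    show "real n * stp n \<le> (\<bar>A\<bar> + real d) / q * (1 + \<bar>ln (S n)\<bar>)" for n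
    proof -
      have "\<bar>A\<bar> + real d * \<bar>ln (S n)\<bar> \<le> (\<bar>A\<bar> + real d) * (1 + \<bar>ln (S n)\<bar>)"
        by (simp add: algebra_simps)
      then have "q * (real n * stp n) \<le> (\<bar>A\<bar> + real d) * (1 + \<bar>ln (S n)\<bar>)"
        using le[of n] by linarith
      then show ?thesis using q by (simp add: pos_le_divide_eq mult.commute)
    qed
  qed (use q in auto)
qed

text \<open>If \<open>S\<close> stayed below \<open>B\<close>, the steps would stay above
  \<open>s\<close>, and \<open>real n * stp n\<close> could not remain bounded as
  \<open>stp_le\<close> then demands.\<close>

lemma S_at_top: "filterlim S at_top sequentially"
proof (rule ccontr)
  assume "\<not> filterlim S at_top sequentially"
  then obtain B where "\<forall>N. \<exists>n\<ge>N. S n < B"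
    by (auto simp: filterlim_at_top eventually_sequentially not_le)
  then have B: "S n \<le> B" for n
    using incseqD[OF incseq_S] by (meson order.strict_implies_order order_trans)
  have B0: "0 < B" using B[of 0] S_pos[of 0] by simp
  obtain C where C: "0 \<le> C" "\<And>n. real n * stp n \<le> C * (1 + \<bar>ln (S n)\<bar>)" using stp_le by blast
  define s where "s = \<gamma> / g_fun \<alpha> \<mu> B"
  have s: "0 < s" using \<gamma> g_fun_pos[OF B0] by (simp add: s_def)
  have "s \<le> stp n" for n
    unfolding s_def stp_def using g_fun_pos S_pos \<gamma> B B0 \<alpha> \<mu>
    by (intro divide_left_mono g_fun_mono mult_pos_pos) auto
  moreover have "\<bar>ln (S n)\<bar> \<le> \<bar>ln (S 0)\<bar> + \<bar>ln B\<bar>" for n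
  proof -
    have "ln (S 0) \<le> ln (S n)" "ln (S n) \<le> ln B"
      using S_pos B B0 incseqD[OF incseq_S, of 0 n] by auto
    then show ?thesis by auto
  qed
  ultimately have *: "real n * s \<le> C * (1 + (\<bar>ln (S 0)\<bar> + \<bar>ln B\<bar>))" for n
    by (intro order_trans[OF order_trans[OF mult_left_mono C(2)[of n]] mult_left_mono]) (use C(1) in auto)
  obtain n where "C * (1 + (\<bar>ln (S 0)\<bar> + \<bar>ln B\<bar>)) / s < real n" using reals_Archimedean2 by blast
  then show False using *[of n] s by (simp add: field_simps)
qed

text \<open>Bootstrap: \<open>stp_le\<close> bounds \<open>n * stp n\<close> by a multiple of
  \<open>1 + ln (S n)\<close>, hence of \<open>g_fun \<alpha> \<mu> (S n) powr p\<close>, and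
  \<open>g_fun \<alpha> \<mu> (S n) = \<gamma> / stp n\<close> turns this into
  \<open>stp n powr (1 + p) \<le> E / n\<close>. Raised to the power \<open>2 / (1 + p) > 1\<close>
  it gives a convergent majorant.\<close>

lemma summable_stp2: "summable (\<lambda>n. (stp n)\<^sup>2)"
proof -
  obtain C where C: "0 \<le> C" "\<And>n. real n * stp n \<le> C * (1 + \<bar>ln (S n)\<bar>)" using stp_le by blast
  obtain p D where p: "0 < p" "p < 1" and D: "\<And>s. 1 \<le> s \<Longrightarrow> 1 + ln s \<le> D * g_fun \<alpha> \<mu> s powr p"
    using ln_le_g_fun_powr[OF \<alpha> \<mu>] by blast
  define E where "E = C * D * \<gamma> powr p"
  have "eventually (\<lambda>n. S n \<ge> 1) sequentially"
    using S_at_top by (simp add: filterlim_at_top)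
  then have ev: "eventually (\<lambda>n. norm ((stp n)\<^sup>2) \<le> E powr (2 / (1 + p)) * real n powr (- 2 / (1 + p))) sequentially"
    using eventually_gt_at_top[of 0]
  proof eventually_elim
    case (elim n)
    have "g_fun \<alpha> \<mu> (S n) = \<gamma> / stp n"
      using \<gamma> g_fun_pos[OF S_pos, of \<alpha> \<mu> n] by (simp add: stp_def)
    then have "1 + \<bar>ln (S n)\<bar> \<le> D * (\<gamma> / stp n) powr p"
      using D[OF elim(1)] elim(1) by simp
    then have "real n * stp n \<le> C * (D * (\<gamma> / stp n) powr p)"
      using C(1) by (intro order_trans[OF C(2)] mult_left_mono)
    also have "\<dots> = E / stp n powr p"
      using \<gamma> stp_pos[of n] by (simp add: E_def powr_divide)
    finally have "stp n powr (1 + p) \<le> E / real n"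
      using stp_pos[of n] elim(2) by (simp add: powr_add field_simps)
    then have "(stp n powr (1 + p)) powr (2 / (1 + p)) \<le> (E / real n) powr (2 / (1 + p))"
      using p by (intro powr_mono2) auto
    moreover have "0 \<le> E"
      using order_trans[OF powr_ge_zero \<open>stp n powr (1 + p) \<le> E / real n\<close>] elim(2)
      by (simp add: zero_le_divide_iff)
    moreover have "(stp n powr (1 + p)) powr (2 / (1 + p)) = (stp n)\<^sup>2"
    proof -
      have "(1 + p) * (2 / (1 + p)) = 2" using p by (simp add: field_simps)
      then show ?thesis using stp_pos[of n] by (simp only: powr_powr powr_numeral)
    qed
    moreover have "real n powr (- 2 / (1 + p)) = 1 / real n powr (2 / (1 + p))"
      by (simp add: powr_minus_divide)
    ultimately show ?case by (simp add: powr_divide)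
  qed
  have "summable (\<lambda>n. E powr (2 / (1 + p)) * real n powr (- 2 / (1 + p)))"
    using p by (intro summable_mult) (simp add: summable_real_powr_iff field_simps)
  from summable_comparison_test_ev[OF ev this] show ?thesis .
qed

definition "lvar n = (\<Sum>i<d. \<bar>ln (rho (th (Suc n) i)) - ln (rho (th n i))\<bar>)"

text \<open>\<open>T n i\<close> never decreases and \<open>S\<close> grows by a factor of at most
  \<open>1 + stp n * Rb\<close>, so \<open>ln (rho (th n i))\<close> drops by at most
  \<open>stp n * Rb\<close>. An increment \<open>x \<ge> - e\<close> with \<open>e \<ge> 0\<close>
  satisfies \<open>\<bar>x\<bar> \<le> x + 2 * e\<close>, whence the error term
  \<open>2 * Rb * stp n\<close>.\<close>

lemma summable_lvar:
  assumes \<beta>: "decseq \<beta>" "\<And>n. 0 \<le> \<beta> n" "summable (\<lambda>n. (\<beta> n)\<^sup>2)"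
  shows "summable (\<lambda>n. \<beta> n * lvar n)"
proof -
  have "summable (\<lambda>n. \<beta> n * \<bar>ln (rho (th (Suc n) i)) - ln (rho (th n i))\<bar>)" if i: "i < d" for i
  proof (rule summable_weighted_variation[where v = "\<lambda>n. ln (rho (th n i))" and V = "ln Rb"
        and \<epsilon> = "\<lambda>n. 2 * Rb * stp n"])
    show "ln (rho (th n i)) \<le> ln Rb" for n using rho_th[OF i] Rb_pos by simp
    show "summable (\<lambda>n. \<beta> n * (2 * Rb * stp n))"
      using summable_mult[OF summable_mult_of_squares[OF \<beta>(3) summable_stp2], of "2 * Rb"] by (simp add: algebra_simps)
    show "0 \<le> 2 * Rb * stp n" for n using Rb_pos stp_pos[of n] by simp
    show "\<bar>ln (rho (th (Suc n) i)) - ln (rho (th n i))\<bar>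
        \<le> ln (rho (th (Suc n) i)) - ln (rho (th n i)) + 2 * Rb * stp n" for n
    proof -
      have "T n i \<le> T (Suc n) i" using step'[OF i, of n] stp_pos[of n] S_pos[of n] rho_th(1)[OF i, of n] by simp
      moreover have "S (Suc n) \<le> S n * (1 + stp n * Rb)"
        unfolding S_Suc using stp_pos[of n] S_pos[of n] rho_th(2)[OF J, of n]
        by (simp add: algebra_simps mult_left_mono)
      ultimately have "T n i / (S n * (1 + stp n * Rb)) \<le> T (Suc n) i / S (Suc n)"
        using S_pos[of "Suc n"] T_pos[OF i, of n] by (intro frac_le) auto
      then have "ln (rho (th n i)) - stp n * Rb \<le> ln (rho (th (Suc n) i))"
        using th_pos[OF i] th_less[OF i] stp_pos[of n] Rb_pos
        by (intro ln_rho_ge) (auto simp: normalize_theta_def)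
      moreover have "0 < stp n * Rb" using stp_pos[of n] Rb_pos by simp
      ultimately show ?thesis by (simp add: abs_if mult.commute)
    qed
  qed (use \<beta> in auto)
  then show ?thesis unfolding lvar_def sum_distrib_left by (intro summable_sum) auto
qed

lemma th_tendsto:
  assumes ts: "\<And>i. i < d \<Longrightarrow> summable (\<lambda>n. stp n *
      (rho (th n i) * (if i = J n then 1 else 0) - ts i * rho (th n (J n))))" and i: "i < d"
  shows "(\<lambda>n. th n i) \<longlonglongrightarrow> ts i"
proof -
  let ?z = "\<lambda>n. stp n * (rho (th n i) * (if i = J n then 1 else 0) - ts i * rho (th n (J n)))"
  have *: "T 0 i - ts i * S 0 + (\<Sum>k<n. S k * ?z k) = T n i - ts i * S n" for n
  proof (induction n)
    case (Suc n)
    have "T (Suc n) i - ts i * S (Suc n) = T n i - ts i * S n + S n * ?z n"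
      unfolding S_Suc step'[OF i] by (simp add: algebra_simps)
    then show ?case using Suc by simp
  qed simp
  have eq: "(T 0 i - ts i * S 0) / S n + (\<Sum>k<n. S k * ?z k) / S n + ts i = th n i" for n
    unfolding add_divide_distrib[symmetric] *
    using S_pos[of n] by (simp add: normalize_theta_def[of d "T n" i] diff_divide_distrib)
  have "(\<lambda>n. (T 0 i - ts i * S 0) / S n + (\<Sum>k<n. S k * ?z k) / S n + ts i) \<longlonglongrightarrow> 0 + 0 + ts i"
    by (intro tendsto_add tendsto_const kronecker_lemma ts i incseq_S S_at_top
        real_tendsto_divide_at_top[OF tendsto_const])
  moreover have "(\<lambda>n. (T 0 i - ts i * S 0) / S n + (\<Sum>k<n. S k * ?z k) / S n + ts i) = (\<lambda>n. th n i)"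
    by (intro ext eq)
  ultimately show ?thesis by simp
qed

end

section \<open>Metropolis-Hastings kernels and their Poisson equation\<close>

text \<open>In terms of \<open>ln s\<close>, \<open>min 1 (a * s)\<close> is 1-Lipschitz: for
  \<open>s \<le> t\<close> it is at least \<open>s / t\<close> times the value \<open>m\<close> at
  \<open>t\<close>, so the gap is at most \<open>1 - s / t\<close>, and this is at most
  \<open>ln t - ln s\<close>.\<close>

lemma abs_min_one_diff_le:
  fixes a s t :: real
  assumes "0 \<le> a" "0 < s" "0 < t"
  shows "\<bar>min 1 (a * s) - min 1 (a * t)\<bar> \<le> \<bar>ln s - ln t\<bar>"
proof -
  have *: "\<bar>min 1 (a * s) - min 1 (a * t)\<bar> \<le> \<bar>ln s - ln t\<bar>" if st: "0 < s" "s \<le> t" for s t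
  proof -
    define m where "m = min 1 (a * t)"
    have m: "0 \<le> m" "m \<le> 1" "m \<le> a * t" using assms(1) st unfolding m_def by simp_all
    have mono: "a * s \<le> a * t" using st assms(1) by (intro mult_left_mono)
    have r: "0 \<le> s / t" "s / t \<le> 1" using st by simp_all
    have "m * (s / t) \<le> a * t * (s / t)" using m(3) r(1) by (rule mult_right_mono)
    then have 1: "m * (s / t) \<le> a * s" using st by simp
    have "m * (1 - s / t) \<le> 1 * (1 - s / t)" using m(2) r(2) by (intro mult_right_mono) simp_all
    then have 2: "m - m * (s / t) \<le> 1 - s / t" by (simp only: right_diff_distrib mult_1_left mult_1_right)
    have "ln (s / t) \<le> s / t - 1" using st by (intro ln_le_minus_one) simp
    then have 3: "1 - s / t \<le> ln t - ln s" using st by (simp add: ln_div)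
    have "m * (s / t) \<le> m" using m(1) r by (intro mult_left_le)
    then have "m * (s / t) \<le> min 1 (a * s)" using 1 m(2) by linarith
    moreover have "min 1 (a * s) \<le> m" using mono unfolding m_def by linarith
    ultimately show ?thesis using 2 3 unfolding m_def by linarith
  qed
  show ?thesis
  proof (cases "s \<le> t")
    case True
    then show ?thesis using * assms(2) by simp
  next
    case False
    then show ?thesis using *[of t s] assms(3)
      by (simp only: abs_minus_commute[of "ln s"] abs_minus_commute[of "min 1 (a * s)"])
  qed
qed

lemma abs_integral_le:
  fixes f g :: "'a \<Rightarrow> real"
  assumes "integrable M f" "integrable M g" "\<And>x. \<bar>f x\<bar> \<le> g x"
  shows "\<bar>\<integral>x. f x \<partial>M\<bar> \<le> (\<integral>x. g x \<partial>M)"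
proof (rule order_trans[OF integral_abs_bound])
  show "(\<integral>x. \<bar>f x\<bar> \<partial>M) \<le> (\<integral>x. g x \<partial>M)"
    using assms by (intro integral_mono integrable_abs)
qed

locale mh_space = finite_measure K for K :: "'x measure" +
  fixes Xs :: "'x set" and dens :: "'x \<Rightarrow> real" and q :: "'x \<Rightarrow> 'x \<Rightarrow> real" and B qmin \<delta> :: real
  assumes space_K: "space K = UNIV"
    and Xs_sets [measurable]: "Xs \<in> sets K"
    and dens_meas [measurable]: "dens \<in> borel_measurable K"
    and dens_nonneg: "\<And>x. 0 \<le> dens x" and dens_le: "\<And>x. dens x \<le> B"
    and dens_out: "\<And>x. x \<notin> Xs \<Longrightarrow> dens x = 0"
    and dens_int: "(\<integral>x. dens x \<partial>K) = 1"
    and q_meas [measurable]: "(\<lambda>(x, y). q x y) \<in> borel_measurable (K \<Otimes>\<^sub>M K)"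
    and q_nonneg: "\<And>x y. 0 \<le> q x y"
    and q_out: "\<And>x y. x \<notin> Xs \<or> y \<notin> Xs \<Longrightarrow> q x y = 0"
    and q_sym: "\<And>x y. q x y = q y x"
    and qmin_pos: "0 < qmin" and q_min: "\<And>x y. x \<in> Xs \<Longrightarrow> y \<in> Xs \<Longrightarrow> qmin \<le> q x y"
    and q_integrable: "\<And>x. x \<in> Xs \<Longrightarrow> integrable K (q x)"
    and q_int: "\<And>x. x \<in> Xs \<Longrightarrow> (\<integral>y. q x y \<partial>K) = 1"
    and \<delta>: "0 < \<delta>" "\<delta> \<le> 1"
begin

text \<open>Acceptance probability for the target proportional to \<open>dens x / w x\<close>; the
  normalizing constant cancels in the ratio.\<close>

definition acc :: "('x \<Rightarrow> real) \<Rightarrow> 'x \<Rightarrow> 'x \<Rightarrow> real" where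
  "acc w x y = (if dens x = 0 then 1 else min 1 (dens y / dens x * (w x / w y)))"

definition jump :: "('x \<Rightarrow> real) \<Rightarrow> 'x \<Rightarrow> 'x \<Rightarrow> real" where
  "jump w x y = q x y * acc w x y"

text \<open>The rejection mass is contained in the term \<open>h x\<close>. In this form constants
  are visibly preserved, and \<open>w\<close> occurs only in an integral against differences of
  \<open>h\<close>.\<close>

definition Pop :: "('x \<Rightarrow> real) \<Rightarrow> ('x \<Rightarrow> real) \<Rightarrow> 'x \<Rightarrow> real" where
  "Pop w h x = h x + (\<integral>y. jump w x y * (h y - h x) \<partial>K)"

text \<open>The last condition yields a Doeblin minorization of mass \<open>\<delta>\<close> for the kernel with weight \<open>w\<close>.\<close>
definition good :: "('x \<Rightarrow> real) \<Rightarrow> bool" where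
  "good w \<longleftrightarrow> w \<in> borel_measurable K \<and> (\<forall>x. 0 < w x) \<and>
     (\<exists>m>0. (\<forall>x\<in>Xs. m \<le> w x) \<and> \<delta> * B \<le> qmin * (\<integral>y. dens y * m / w y \<partial>K))"

lemma B_pos: "0 < B"
proof (rule ccontr)
  assume "\<not> 0 < B"
  then have "dens x = 0" for x using dens_nonneg[of x] dens_le[of x] by linarith
  then have "dens = (\<lambda>x. 0)" by (intro ext)
  then show False using dens_int by simp
qed

lemma good_meas: "good w \<Longrightarrow> w \<in> borel_measurable K"
  and good_pos: "good w \<Longrightarrow> 0 < w x"
  by (auto simp: good_def)

lemma acc_nonneg: "good w \<Longrightarrow> 0 \<le> acc w x y" and acc_le: "acc w x y \<le> 1"
  using good_pos[of w x] good_pos[of w y] dens_nonneg by (auto simp: acc_def)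

lemma jump_nonneg: "good w \<Longrightarrow> 0 \<le> jump w x y" and jump_le: "jump w x y \<le> q x y"
  using acc_nonneg acc_le q_nonneg by (auto simp: jump_def mult_left_le)

lemma jump_out: "x \<notin> Xs \<or> y \<notin> Xs \<Longrightarrow> jump w x y = 0"
  using q_out by (auto simp: jump_def)

text \<open>The weight carries a parameter \<omega> because the kernels of the algorithm depend on
  the random past.\<close>

lemma measurable_jump_param:
  assumes [measurable]: "(\<lambda>(\<omega>, x). W \<omega> x) \<in> borel_measurable (N \<Otimes>\<^sub>M K)"
  shows "(\<lambda>((\<omega>, x), y). jump (W \<omega>) x y) \<in> borel_measurable ((N \<Otimes>\<^sub>M K) \<Otimes>\<^sub>M K)"
  unfolding jump_def acc_def split_beta' by measurable

lemma measurable_Pop_param: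
  assumes [measurable]: "(\<lambda>(\<omega>, x). W \<omega> x) \<in> borel_measurable (N \<Otimes>\<^sub>M K)"
    "(\<lambda>(\<omega>, x). H \<omega> x) \<in> borel_measurable (N \<Otimes>\<^sub>M K)"
  shows "(\<lambda>(\<omega>, x). Pop (W \<omega>) (H \<omega>) x) \<in> borel_measurable (N \<Otimes>\<^sub>M K)"
proof -
  note [measurable] = measurable_jump_param[OF assms(1), unfolded split_beta']
  have "(\<lambda>p. H (fst p) (snd p) + (\<integral>y. jump (W (fst p)) (snd p) y * (H (fst p) y - H (fst p) (snd p)) \<partial>K))
    \<in> borel_measurable (N \<Otimes>\<^sub>M K)"
    by measurable
  then show ?thesis by (simp add: Pop_def split_beta')
qed

lemma measurable_jump:
  assumes "w \<in> borel_measurable K"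
  shows "(\<lambda>(x, y). jump w x y) \<in> borel_measurable (K \<Otimes>\<^sub>M K)"
  using assms unfolding jump_def acc_def split_beta' by measurable

lemma measurable_Pop:
  assumes [measurable]: "w \<in> borel_measurable K" "h \<in> borel_measurable K"
  shows "Pop w h \<in> borel_measurable K"
proof -
  note [measurable] = measurable_jump[OF assms(1)]
  show ?thesis unfolding Pop_def by measurable
qed

lemma jump_measurable1: "w \<in> borel_measurable K \<Longrightarrow> jump w x \<in> borel_measurable K"
  using measurable_Pair2[OF measurable_jump, of w x] by (simp add: space_K)

lemma integrable_jump_mult:
  assumes w: "good w" and h: "h \<in> borel_measurable K" "\<And>y. y \<in> Xs \<Longrightarrow> \<bar>h y\<bar> \<le> C" and x: "x \<in> Xs"
  shows "integrable K (\<lambda>y. jump w x y * h y)"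
proof (rule Bochner_Integration.integrable_bound)
  show "integrable K (\<lambda>y. C * q x y)" using q_integrable[OF x] by simp
  show "(\<lambda>y. jump w x y * h y) \<in> borel_measurable K"
    using jump_measurable1[OF good_meas[OF w]] h(1) by measurable
  have "\<bar>jump w x y * h y\<bar> \<le> \<bar>C * q x y\<bar>" for y
  proof (cases "y \<in> Xs")
    case True
    have "\<bar>jump w x y * h y\<bar> \<le> q x y * C"
      using jump_nonneg[OF w] jump_le q_nonneg h(2)[OF True] unfolding abs_mult by (intro mult_mono) auto
    then show ?thesis by (simp add: mult.commute)
  qed (simp add: jump_out)
  then show "AE y in K. norm (jump w x y * h y) \<le> norm (C * q x y)" by simp
qed

lemma integrable_jump: "good w \<Longrightarrow> x \<in> Xs \<Longrightarrow> integrable K (jump w x)"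
  using integrable_jump_mult[of w "\<lambda>_. 1" 1 x] by simp

lemma integral_jump_le: "good w \<Longrightarrow> x \<in> Xs \<Longrightarrow> (\<integral>y. jump w x y \<partial>K) \<le> 1"
  using integral_mono[OF integrable_jump q_integrable, of w x x] jump_le q_int by simp

lemma Pop_eq:
  assumes w: "good w" and h: "h \<in> borel_measurable K" "\<And>y. y \<in> Xs \<Longrightarrow> \<bar>h y\<bar> \<le> C" and x: "x \<in> Xs"
  shows "Pop w h x = (\<integral>y. jump w x y * h y \<partial>K) + (1 - (\<integral>y. jump w x y \<partial>K)) * h x"
  unfolding Pop_def right_diff_distrib
  using integrable_jump_mult[OF w h x] integrable_jump[OF w x]
  by (simp add: algebra_simps)

text \<open>A part \<open>k\<close> of the jump kernel is split off; on the remaining mass, which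
  includes the rejection at \<open>x\<close>, \<open>h\<close> is replaced by its lower bound
  \<open>l\<close>.\<close>

lemma Pop_lower:
  assumes w: "good w" and h: "h \<in> borel_measurable K" "\<And>y. y \<in> Xs \<Longrightarrow> \<bar>h y\<bar> \<le> C" and x: "x \<in> Xs"
    and k: "k \<in> borel_measurable K" "\<And>y. 0 \<le> k y" "\<And>y. k y \<le> jump w x y"
    and l: "\<And>y. y \<in> Xs \<Longrightarrow> l \<le> h y"
  shows "(\<integral>y. k y * h y \<partial>K) + (1 - (\<integral>y. k y \<partial>K)) * l \<le> Pop w h x"
proof -
  have ik: "integrable K k"
    by (rule Bochner_Integration.integrable_bound[OF integrable_jump[OF w x] k(1)])
       (use k(2,3) in \<open>auto intro!: AE_I2 order_trans[OF _ abs_ge_self]\<close>)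
  have ikh: "integrable K (\<lambda>y. k y * h y)"
  proof (rule Bochner_Integration.integrable_bound[OF integrable_jump_mult[OF w h x]])
    show "(\<lambda>y. k y * h y) \<in> borel_measurable K" using k(1) h(1) by measurable
    show "AE y in K. norm (k y * h y) \<le> norm (jump w x y * h y)"
      using k(2,3) jump_nonneg[OF w] by (intro AE_I2) (auto simp: abs_mult intro!: mult_right_mono)
  qed
  have "(\<integral>y. (jump w x y - k y) * l \<partial>K) \<le> (\<integral>y. (jump w x y - k y) * h y \<partial>K)"
  proof (rule integral_mono)
    show "(jump w x y - k y) * l \<le> (jump w x y - k y) * h y" for y
    proof (cases "y \<in> Xs")
      case False
      then have "jump w x y = 0" "k y = 0" using jump_out[of x y w] k(2,3)[of y] by auto
      then show ?thesis by simp
    qed (use l k(3) in \<open>auto intro!: mult_left_mono\<close>)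
  qed (use integrable_jump_mult[OF w h x] integrable_jump[OF w x] ik ikh in \<open>auto simp: left_diff_distrib\<close>)
  then have "((\<integral>y. jump w x y \<partial>K) - (\<integral>y. k y \<partial>K)) * l \<le> (\<integral>y. jump w x y * h y \<partial>K) - (\<integral>y. k y * h y \<partial>K)"
    using integrable_jump_mult[OF w h x] integrable_jump[OF w x] ik ikh by (simp add: left_diff_distrib)
  moreover have "(1 - (\<integral>y. jump w x y \<partial>K)) * l \<le> (1 - (\<integral>y. jump w x y \<partial>K)) * h x"
    using integral_jump_le[OF w x] l[OF x] by (intro mult_left_mono) auto
  ultimately show ?thesis using Pop_eq[OF w h x] by (simp only: left_diff_distrib)
qed

lemma Pop_diff:
  assumes w: "good w" and h: "h \<in> borel_measurable K" "\<And>y. y \<in> Xs \<Longrightarrow> \<bar>h y\<bar> \<le> C"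
    and g: "g \<in> borel_measurable K" "\<And>y. y \<in> Xs \<Longrightarrow> \<bar>g y\<bar> \<le> C'" and x: "x \<in> Xs"
  shows "Pop w (\<lambda>y. h y - g y) x = Pop w h x - Pop w g x"
proof -
  have hg: "(\<lambda>y. h y - g y) \<in> borel_measurable K" "\<And>y. y \<in> Xs \<Longrightarrow> \<bar>h y - g y\<bar> \<le> C + C'"
    using h g by (auto intro!: order_trans[OF abs_triangle_ineq4] add_mono)
  show ?thesis
    using Pop_eq[OF w hg x] Pop_eq[OF w h x] Pop_eq[OF w g x]
      integrable_jump_mult[OF w h x] integrable_jump_mult[OF w g x]
    by (simp add: right_diff_distrib)
qed

lemma Pop_const [simp]: "Pop w (\<lambda>_. c) x = c"
  by (simp add: Pop_def)

lemma Pop_uminus: "Pop w (\<lambda>y. - h y) x = - Pop w h x"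
proof -
  have "Pop w (\<lambda>y. - h y) x = - h x + (\<integral>y. - (jump w x y * (h y - h x)) \<partial>K)"
    unfolding Pop_def by (intro arg_cong2[where f = "(+)"] Bochner_Integration.integral_cong) (auto simp: algebra_simps)
  then show ?thesis by (simp add: Pop_def)
qed

lemma Pop_mult: "Pop w (\<lambda>y. c * h y) x = c * Pop w h x"
proof -
  have "Pop w (\<lambda>y. c * h y) x = c * h x + (\<integral>y. c * (jump w x y * (h y - h x)) \<partial>K)"
    unfolding Pop_def by (intro arg_cong2[where f = "(+)"] Bochner_Integration.integral_cong) (auto simp: algebra_simps)
  then show ?thesis by (simp add: Pop_def distrib_left)
qed

lemma Pop_ge:
  assumes "good w" "h \<in> borel_measurable K" "\<And>y. y \<in> Xs \<Longrightarrow> \<bar>h y\<bar> \<le> C" "x \<in> Xs"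
    and "\<And>y. y \<in> Xs \<Longrightarrow> l \<le> h y"
  shows "l \<le> Pop w h x"
  using Pop_lower[OF assms(1-4), of "\<lambda>_. 0" l] jump_nonneg[OF assms(1)] assms(5) by simp

lemma Pop_abs_le:
  assumes w: "good w" "h \<in> borel_measurable K" and h: "\<And>y. y \<in> Xs \<Longrightarrow> \<bar>h y\<bar> \<le> C" and x: "x \<in> Xs"
  shows "\<bar>Pop w h x\<bar> \<le> C"
proof -
  have "- C \<le> Pop w h x"
    using h by (intro Pop_ge[OF w h x]) (auto simp: abs_le_iff minus_le_iff)
  moreover have "- C \<le> Pop w (\<lambda>y. - h y) x"
    using h w x by (intro Pop_ge[where C = C]) (auto simp: abs_le_iff)
  ultimately show ?thesis by (simp add: Pop_uminus abs_le_iff)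
qed

text \<open>\<open>dens x \<le> B\<close> and \<open>m \<le> w x\<close> bound the acceptance
  probability below by \<open>dens y / B * (m / w y)\<close>, and \<open>q\<close> is at least
  \<open>qmin\<close>; the product is free of \<open>x\<close>. At zeros of \<open>dens\<close> the
  acceptance probability is 1, and the bound holds as it is at most 1.\<close>

lemma minorization:
  assumes w: "good w"
  obtains k where "k \<in> borel_measurable K" "\<And>y. 0 \<le> k y" "\<And>x y. x \<in> Xs \<Longrightarrow> k y \<le> jump w x y"
    "\<delta> \<le> (\<integral>y. k y \<partial>K)"
proof -
  obtain m where m: "0 < m" "\<And>x. x \<in> Xs \<Longrightarrow> m \<le> w x" "\<delta> * B \<le> qmin * (\<integral>y. dens y * m / w y \<partial>K)"
    using w by (auto simp: good_def)
  note [measurable] = good_meas[OF w]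
  define k where "k y = qmin / B * (dens y * m / w y)" for y
  show ?thesis
  proof (rule that[of k])
    show "k \<in> borel_measurable K" unfolding k_def by measurable
    show "0 \<le> k y" for y
      using dens_nonneg[of y] B_pos qmin_pos m(1) good_pos[OF w, of y] by (simp add: k_def)
    show "\<delta> \<le> (\<integral>y. k y \<partial>K)"
      using m(3) B_pos unfolding k_def integral_mult_right_zero by (simp add: pos_le_divide_eq)
    show "k y \<le> jump w x y" if x: "x \<in> Xs" for x y
    proof (cases "y \<in> Xs")
      case True
      let ?r = "dens y / B * (m / w y)"
      have r1: "?r \<le> 1 * 1"
        using dens_nonneg[of y] dens_le[of y] B_pos m(2)[OF True] m(1)
        by (intro mult_mono) (auto simp: divide_le_eq_1 less_imp_le good_pos[OF w])
      have "?r \<le> acc w x y"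
      proof (cases "dens x = 0")
        case False
        then have "0 < dens x" using dens_nonneg[of x] by simp
        then have "dens y / B \<le> dens y / dens x" "m / w y \<le> w x / w y"
          using dens_nonneg[of y] dens_le[of x] B_pos m(2)[OF x] good_pos[OF w, of y]
          by (auto intro!: divide_left_mono divide_right_mono)
        then have "?r \<le> dens y / dens x * (w x / w y)"
          using dens_nonneg B_pos m(1) good_pos[OF w, of y] by (intro mult_mono) auto
        then show ?thesis using False r1 by (simp add: acc_def)
      qed (use r1 in \<open>simp add: acc_def\<close>)
      moreover have "0 \<le> ?r" using dens_nonneg[of y] B_pos m(1) good_pos[OF w, of y] by simp
      ultimately have "qmin * ?r \<le> q x y * acc w x y"
        using q_min[OF x True] qmin_pos by (intro mult_mono) (auto simp: q_nonneg)
      then show ?thesis by (simp add: k_def jump_def mult.commute)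
    qed (simp add: k_def dens_out jump_out)
  qed
qed

text \<open>The part \<open>k\<close> common to the kernels at \<open>x\<close> and
  \<open>x'\<close> cancels in the difference, and the mass that remains is at most
  \<open>1 - \<delta>\<close>. The lower estimate is used twice: for \<open>h\<close> with its
  infimum \<open>l\<close>, and for \<open>- h\<close> with \<open>- (l + D)\<close>.\<close>

lemma Pop_osc:
  assumes w: "good w" and h: "h \<in> borel_measurable K" "\<And>y. y \<in> Xs \<Longrightarrow> \<bar>h y\<bar> \<le> C"
    and D: "\<And>y z. y \<in> Xs \<Longrightarrow> z \<in> Xs \<Longrightarrow> h y - h z \<le> D" and x: "x \<in> Xs" "x' \<in> Xs"
  shows "Pop w h x - Pop w h x' \<le> (1 - \<delta>) * D"
proof -
  obtain k where k: "k \<in> borel_measurable K" "\<And>y. 0 \<le> k y" "\<And>x y. x \<in> Xs \<Longrightarrow> k y \<le> jump w x y"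
    "\<delta> \<le> (\<integral>y. k y \<partial>K)" using minorization[OF w] by blast
  define l where "l = Inf (h ` Xs)"
  have bdd: "bdd_below (h ` Xs)" using h(2) by (auto intro!: bdd_belowI[of _ "- C"] simp: abs_le_iff minus_le_iff)
  have l: "l \<le> h y" if "y \<in> Xs" for y unfolding l_def using bdd that by (intro cInf_lower) auto
  have u: "h y \<le> l + D" if "y \<in> Xs" for y
  proof -
    have "h y - D \<le> l" unfolding l_def using that D[OF that] by (intro cInf_greatest) (auto simp: algebra_simps)
    then show ?thesis by simp
  qed
  have D0: "0 \<le> D" using D[OF x(1) x(1)] by simp
  have 1: "(\<integral>y. k y * h y \<partial>K) + (1 - (\<integral>y. k y \<partial>K)) * l \<le> Pop w h x'"
    using k(3)[OF x(2)] by (intro Pop_lower[OF w h x(2) k(1,2) _ l] x) auto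
  have "(\<integral>y. k y * - h y \<partial>K) + (1 - (\<integral>y. k y \<partial>K)) * (- (l + D)) \<le> Pop w (\<lambda>y. - h y) x"
    using k(3)[OF x(1)] h u by (intro Pop_lower[OF w _ _ x(1) k(1,2), where C = C]) (auto simp del: minus_add_distrib)
  then have "Pop w h x - Pop w h x' \<le> (1 - (\<integral>y. k y \<partial>K)) * D"
    using 1 by (simp add: Pop_uminus algebra_simps)
  also have "\<dots> \<le> (1 - \<delta>) * D" using k(4) D0 by (intro mult_right_mono) auto
  finally show ?thesis .
qed

lemma acc_lipschitz:
  assumes w: "good w" "good w'" and L: "\<And>x. x \<in> Xs \<Longrightarrow> \<bar>ln (w' x) - ln (w x)\<bar> \<le> L" and x: "x \<in> Xs" "y \<in> Xs"
  shows "\<bar>acc w' x y - acc w x y\<bar> \<le> 2 * L"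
proof (cases "dens x = 0")
  case False
  have p: "0 < w x" "0 < w y" "0 < w' x" "0 < w' y" using w good_pos by auto
  have "\<bar>acc w' x y - acc w x y\<bar> \<le> \<bar>ln (w' x / w' y) - ln (w x / w y)\<bar>"
    using False p dens_nonneg unfolding acc_def if_not_P[OF False]
    by (intro abs_min_one_diff_le) (auto intro!: divide_nonneg_nonneg)
  also have "\<dots> \<le> 2 * L" using L[OF x(1)] L[OF x(2)] p by (simp add: ln_div)
  finally show ?thesis .
qed (use L[OF x(1)] in \<open>simp add: acc_def\<close>)

text \<open>The integrand contains differences of \<open>h\<close>, so the oscillation
  \<open>D\<close> appears in place of \<open>C\<close>. The factor 2 stems from the two weights in
  the acceptance ratio.\<close>

lemma Pop_lipschitz:
  assumes w: "good w" "good w'" and L: "\<And>x. x \<in> Xs \<Longrightarrow> \<bar>ln (w' x) - ln (w x)\<bar> \<le> L"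
    and h: "h \<in> borel_measurable K" "\<And>y. y \<in> Xs \<Longrightarrow> \<bar>h y\<bar> \<le> C"
    and D: "\<And>y z. y \<in> Xs \<Longrightarrow> z \<in> Xs \<Longrightarrow> \<bar>h y - h z\<bar> \<le> D" and x: "x \<in> Xs"
  shows "\<bar>Pop w' h x - Pop w h x\<bar> \<le> 2 * L * D"
proof -
  have i: "integrable K (\<lambda>y. jump v x y * (h y - h x))" if "good v" for v
  proof (rule integrable_jump_mult[where C = "C + C", OF that _ _ x])
    show "\<bar>h y - h x\<bar> \<le> C + C" if "y \<in> Xs" for y
      using h(2)[OF that] h(2)[OF x] by linarith
  qed (use h(1) in measurable)
  have "Pop w' h x - Pop w h x = (\<integral>y. jump w' x y * (h y - h x) - jump w x y * (h y - h x) \<partial>K)"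
    using i w by (simp add: Pop_def)
  also have "\<bar>\<dots>\<bar> \<le> (\<integral>y. 2 * L * D * q x y \<partial>K)"
  proof (rule abs_integral_le)
    show "integrable K (\<lambda>y. 2 * L * D * q x y)" using q_integrable[OF x] by simp
    show "\<bar>jump w' x y * (h y - h x) - jump w x y * (h y - h x)\<bar> \<le> 2 * L * D * q x y" for y
    proof (cases "y \<in> Xs")
      case True
      have "\<bar>jump w' x y * (h y - h x) - jump w x y * (h y - h x)\<bar>
          = q x y * (\<bar>acc w' x y - acc w x y\<bar> * \<bar>h y - h x\<bar>)"
        using q_nonneg by (simp add: jump_def abs_mult flip: left_diff_distrib right_diff_distrib)
      also have "\<dots> \<le> q x y * (2 * L * D)"
        using acc_lipschitz[OF w L x True] D[OF True x] q_nonneg L[OF x] by (intro mult_left_mono mult_mono) auto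
      finally show ?thesis by (simp add: mult.commute)
    qed (simp add: jump_out q_out)
  qed (use i w in auto)
  also have "\<dots> = 2 * L * D" using q_int[OF x] by simp
  finally show ?thesis .
qed

section \<open>The invariant law of a Metropolis kernel\<close>

definition norml :: "('x \<Rightarrow> real) \<Rightarrow> real" where "norml w = (\<integral>y. dens y / w y \<partial>K)"

definition pim :: "('x \<Rightarrow> real) \<Rightarrow> ('x \<Rightarrow> real) \<Rightarrow> real" where
  "pim w h = (\<integral>y. dens y / w y * h y \<partial>K) / norml w"

lemma integrable_dens: "integrable K dens"
  using dens_int not_integrable_integral_eq by fastforce

lemma integrable_dens_div:
  assumes w: "good w" and h: "h \<in> borel_measurable K" "\<And>y. y \<in> Xs \<Longrightarrow> \<bar>h y\<bar> \<le> C"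
  shows "integrable K (\<lambda>y. dens y / w y * h y)"
proof -
  obtain m where m: "0 < m" "\<And>x. x \<in> Xs \<Longrightarrow> m \<le> w x"
    using w by (auto simp: good_def)
  show ?thesis
  proof (rule Bochner_Integration.integrable_bound)
    show "integrable K (\<lambda>y. dens y * (C / m))" using integrable_dens by simp
    show "(\<lambda>y. dens y / w y * h y) \<in> borel_measurable K"
      using good_meas[OF w] h(1) by measurable
    have "\<bar>dens y / w y * h y\<bar> \<le> \<bar>dens y * (C / m)\<bar>" for y
    proof (cases "y \<in> Xs")
      case True
      have "\<bar>dens y / w y * h y\<bar> \<le> dens y / m * C"
        using dens_nonneg[of y] m(1) m(2)[OF True] h(2)[OF True] good_pos[OF w, of y]
        unfolding abs_mult by (intro mult_mono) (auto intro!: divide_left_mono)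
      then show ?thesis by (intro order_trans[OF _ abs_ge_self]) simp
    qed (simp add: dens_out)
    then show "AE y in K. norm (dens y / w y * h y) \<le> norm (dens y * (C / m))" by simp
  qed
qed

lemma norml_pos: assumes w: "good w" shows "0 < norml w"
proof -
  obtain m where m: "0 < m" "\<delta> * B \<le> qmin * (\<integral>y. dens y * m / w y \<partial>K)"
    using w by (auto simp: good_def)
  have "(\<integral>y. dens y * m / w y \<partial>K) = (\<integral>y. m * (dens y / w y) \<partial>K)"
    by (intro Bochner_Integration.integral_cong) auto
  also have "\<dots> = m * norml w" by (simp only: norml_def integral_mult_right_zero)
  finally have "0 < qmin * (m * norml w)"
    using m(2) mult_pos_pos[OF \<delta>(1) B_pos] by simp
  then show ?thesis using qmin_pos m(1) by (simp add: zero_less_mult_iff)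
qed

text \<open>Used with \<open>c = h x\<close>, where it bounds the distance of a value from the mean
  by the oscillation of \<open>h\<close>; this takes the place of total variation estimates.\<close>

lemma pim_mono_abs:
  assumes w: "good w" and h: "h \<in> borel_measurable K" "\<And>y. y \<in> Xs \<Longrightarrow> \<bar>h y\<bar> \<le> C"
    and c: "\<And>y. y \<in> Xs \<Longrightarrow> \<bar>h y - c\<bar> \<le> D"
  shows "\<bar>pim w h - c\<bar> \<le> D"
proof -
  have i1: "integrable K (\<lambda>y. dens y / w y)" using integrable_dens_div[OF w, of "\<lambda>_. 1" 1] by simp
  have ih: "integrable K (\<lambda>y. dens y / w y * h y)" by (rule integrable_dens_div[OF w h])
  have n: "0 < norml w" by (rule norml_pos[OF w])
  have "pim w h - c = (\<integral>y. dens y / w y * h y - dens y / w y * c \<partial>K) / norml w"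
    using i1 ih n by (simp add: pim_def diff_divide_distrib del: times_divide_eq_left times_divide_eq_right)
      (simp add: norml_def)
  also have "\<bar>\<dots>\<bar> \<le> (\<integral>y. dens y / w y * D \<partial>K) / norml w"
    unfolding abs_divide abs_of_pos[OF n]
  proof (intro divide_right_mono abs_integral_le)
    show "\<bar>dens y / w y * h y - dens y / w y * c\<bar> \<le> dens y / w y * D" for y
    proof (cases "y \<in> Xs")
      case True
      have "\<bar>dens y / w y * h y - dens y / w y * c\<bar> = dens y / w y * \<bar>h y - c\<bar>"
        using dens_nonneg[of y] good_pos[OF w, of y] unfolding right_diff_distrib[symmetric] by (simp add: abs_mult)
      then show ?thesis
        using c[OF True] dens_nonneg[of y] good_pos[OF w, of y] by (auto intro!: mult_left_mono divide_right_mono)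
    qed (simp add: dens_out)
  qed (use n in \<open>auto intro!: Bochner_Integration.integrable_diff integrable_mult_left i1 ih
      simp del: times_divide_eq_left times_divide_eq_right\<close>)
  also have "\<dots> = D" using n unfolding integral_mult_left_zero by (simp add: norml_def)
  finally show ?thesis .
qed

text \<open>Detailed balance: the integrand of the double integral below is antisymmetric.\<close>
lemma pim_Pop:
  assumes w: "good w" and h: "h \<in> borel_measurable K" "\<And>y. y \<in> Xs \<Longrightarrow> \<bar>h y\<bar> \<le> C"
  shows "pim w (Pop w h) = pim w h"
proof -
  note [measurable] = good_meas[OF w] h(1) measurable_jump[OF good_meas[OF w]]
  interpret KK: pair_sigma_finite K K ..
  define F where "F x y = dens x / w x * (jump w x y * (h y - h x))" for x y
  have [measurable]: "(\<lambda>(x, y). F x y) \<in> borel_measurable (K \<Otimes>\<^sub>M K)"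
    unfolding F_def split_beta' by measurable
  have anti: "F y x = - F x y" for x y
  proof -
    \<comment> \<open>Both sides equal the minimum of \<open>dens x / w x\<close> and
      \<open>dens y / w y\<close>. At zeros of \<open>dens\<close> they vanish, through the factor
      in front or through the acceptance probability, so the convention made there is
      harmless.\<close>
    have "dens x / w x * acc w x y = dens y / w y * acc w y x" for x y
    proof -
      have p: "0 < w x" "0 < w y" using good_pos[OF w] by auto
      consider "dens x = 0" "dens y = 0" | "dens x = 0" "0 < dens y" | "0 < dens x" "dens y = 0"
        | "0 < dens x" "0 < dens y"
        using dens_nonneg[of x] dens_nonneg[of y] by force
      then show ?thesis
      proof cases
        case 4
        have "dens x / w x * min 1 (dens y / dens x * (w x / w y)) = min (dens x / w x) (dens y / w y)"
          and "dens y / w y * min 1 (dens x / dens y * (w y / w x)) = min (dens x / w x) (dens y / w y)"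
          using 4 p by (auto simp: min_def field_simps)
        then show ?thesis using 4 by (simp add: acc_def)
      qed (use p in \<open>auto simp: acc_def\<close>)
    qed
    then have "dens y / w y * acc w y x * (q y x * (h x - h y)) = dens x / w x * acc w x y * (q x y * (h x - h y))"
      by (simp add: q_sym[of y x])
    then show ?thesis by (simp add: F_def jump_def algebra_simps)
  qed
  obtain m where m: "0 < m" "\<And>x. x \<in> Xs \<Longrightarrow> m \<le> w x"
    using w by (auto simp: good_def)
  \<comment> \<open>The majorant for Fubini: \<open>q\<close> has integral 1 in each row over
    \<open>Xs\<close>, and \<open>K\<close> is finite.\<close>
  have qK: "integrable (K \<Otimes>\<^sub>M K) (\<lambda>(x, y). q x y)"
  proof (rule KK.Fubini_integrable)
    have "integrable K (indicator Xs :: _ \<Rightarrow> real)" by (simp add: emeasure_finite less_top[symmetric])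
    moreover have "(\<lambda>x. \<integral>y. norm (case (x, y) of (x, y) \<Rightarrow> q x y) \<partial>K) = indicator Xs"
      using q_int q_nonneg by (auto simp: q_out indicator_def)
    ultimately show "integrable K (\<lambda>x. \<integral>y. norm (case (x, y) of (x, y) \<Rightarrow> q x y) \<partial>K)" by simp
    show "AE x in K. integrable K (\<lambda>y. case (x, y) of (x, y) \<Rightarrow> q x y)"
    proof (rule AE_I2)
      fix x show "integrable K (\<lambda>y. case (x, y) of (x, y) \<Rightarrow> q x y)"
        using q_integrable[of x] by (cases "x \<in> Xs") (auto simp: q_out)
    qed
  qed measurable
  have iF: "integrable (K \<Otimes>\<^sub>M K) (\<lambda>(x, y). F x y)"
  proof (rule Bochner_Integration.integrable_bound)
    show "integrable (K \<Otimes>\<^sub>M K) (\<lambda>p. (case p of (x, y) \<Rightarrow> q x y) * (B / m * (2 * C)))" using qK by simp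
    have "\<bar>F x y\<bar> \<le> \<bar>q x y * (B / m * (2 * C))\<bar>" for x y
    proof (cases "x \<in> Xs \<and> y \<in> Xs")
      case True
      have C0: "0 \<le> C" using h(2)[of x] True by auto
      have "\<bar>F x y\<bar> = dens x / w x * (jump w x y * \<bar>h y - h x\<bar>)"
        using jump_nonneg[OF w] dens_nonneg[of x] good_pos[OF w, of x] by (simp add: F_def abs_mult)
      also have "\<dots> \<le> B / m * (q x y * (2 * C))"
        using True m h(2)[of x] h(2)[of y] dens_le[of x] dens_nonneg B_pos good_pos[OF w, of x] jump_nonneg[OF w] jump_le q_nonneg
        by (intro mult_mono frac_le) (auto intro!: mult_nonneg_nonneg)
      also have "\<dots> = q x y * (B / m * (2 * C))" by simp
      finally show ?thesis by (rule order_trans[OF _ abs_ge_self])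
    qed (auto simp: F_def jump_out)
    then show "AE p in K \<Otimes>\<^sub>M K. norm (case p of (x, y) \<Rightarrow> F x y) \<le> norm ((case p of (x, y) \<Rightarrow> q x y) * (B / m * (2 * C)))"
      by (intro AE_I2) auto
  qed measurable
  have "(\<integral>x. (\<integral>y. F x y \<partial>K) \<partial>K) = (\<integral>y. (\<integral>x. F x y \<partial>K) \<partial>K)"
    using KK.Fubini_integral[OF iF] by simp
  also have "\<dots> = (\<integral>y. (\<integral>x. - F y x \<partial>K) \<partial>K)"
    by (intro Bochner_Integration.integral_cong refl anti)
  also have "\<dots> = - (\<integral>x. (\<integral>y. F x y \<partial>K) \<partial>K)" by simp
  finally have zero: "(\<integral>x. (\<integral>y. F x y \<partial>K) \<partial>K) = 0" by simp
  have "(\<integral>x. dens x / w x * Pop w h x \<partial>K) = (\<integral>x. dens x / w x * h x + (\<integral>y. F x y \<partial>K) \<partial>K)"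
    by (intro Bochner_Integration.integral_cong) (auto simp: Pop_def F_def distrib_left)
  also have "\<dots> = (\<integral>x. dens x / w x * h x \<partial>K)"
    using KK.integrable_fst'[OF iF] zero integrable_dens_div[OF w h]
    by (subst Bochner_Integration.integral_add) auto
  finally show ?thesis by (simp add: pim_def)
qed

end

section \<open>Iterates of a kernel and the solution of its Poisson equation\<close>

context mh_space
begin

definition iter :: "('x \<Rightarrow> real) \<Rightarrow> ('x \<Rightarrow> real) \<Rightarrow> nat \<Rightarrow> 'x \<Rightarrow> real" where
  "iter w f k = (Pop w ^^ k) f"

lemma iter_0 [simp]: "iter w f 0 = f" and iter_Suc: "iter w f (Suc k) = Pop w (iter w f k)"
  by (simp_all add: iter_def)

lemma measurable_iter:
  assumes "good w" "f \<in> borel_measurable K"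
  shows "iter w f k \<in> borel_measurable K"
  by (induction k) (simp_all add: iter_Suc assms measurable_Pop good_meas)

lemma measurable_iter_param:
  assumes "(\<lambda>(\<omega>, x). W \<omega> x) \<in> borel_measurable (N \<Otimes>\<^sub>M K)" "(\<lambda>(\<omega>, x). F \<omega> x) \<in> borel_measurable (N \<Otimes>\<^sub>M K)"
  shows "(\<lambda>(\<omega>, x). iter (W \<omega>) (F \<omega>) k x) \<in> borel_measurable (N \<Otimes>\<^sub>M K)"
  by (induction k) (simp_all add: iter_Suc assms measurable_Pop_param)

lemma iter_abs_le:
  assumes "good w" "f \<in> borel_measurable K" "\<And>y. y \<in> Xs \<Longrightarrow> \<bar>f y\<bar> \<le> C" "x \<in> Xs"
  shows "\<bar>iter w f k x\<bar> \<le> C"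
  using assms(4)
proof (induction k arbitrary: x)
  case (Suc k)
  show ?case unfolding iter_Suc
    using Suc by (intro Pop_abs_le assms(1) measurable_iter assms(2)) auto
qed (use assms in simp)

lemma iter_osc:
  assumes w: "good w" and f: "f \<in> borel_measurable K" "\<And>y. y \<in> Xs \<Longrightarrow> \<bar>f y\<bar> \<le> C" and x: "x \<in> Xs" "x' \<in> Xs"
  shows "\<bar>iter w f k x - iter w f k x'\<bar> \<le> (1 - \<delta>) ^ k * (2 * C)"
proof -
  have "iter w f k x - iter w f k x' \<le> (1 - \<delta>) ^ k * (2 * C)" if "x \<in> Xs" "x' \<in> Xs" for x x'
    using that
  proof (induction k arbitrary: x x')
    case 0
    then show ?case using f(2)[of x] f(2)[of x'] by simp
  next
    case (Suc k)
    show ?case unfolding iter_Suc power_Suc mult.assoc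
      by (intro Pop_osc[OF w measurable_iter[OF w f(1)] iter_abs_le[OF w f] Suc.IH Suc.prems])
  qed
  from this[OF x] this[OF x(2,1)] show ?thesis by linarith
qed

lemma pim_iter:
  assumes w: "good w" and f: "f \<in> borel_measurable K" "\<And>y. y \<in> Xs \<Longrightarrow> \<bar>f y\<bar> \<le> C"
  shows "pim w (iter w f k) = pim w f"
proof (induction k)
  case (Suc k)
  then show ?case using pim_Pop[OF w measurable_iter[OF w f(1)] iter_abs_le[OF w f]] by (simp add: iter_Suc)
qed simp

text \<open>By invariance the mean of \<open>f\<close> is the mean of its \<open>k\<close>-th
  iterate, which lies within one oscillation of every value of that iterate.\<close>

lemma iter_pim:
  assumes w: "good w" and f: "f \<in> borel_measurable K" "\<And>y. y \<in> Xs \<Longrightarrow> \<bar>f y\<bar> \<le> C" and x: "x \<in> Xs"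
  shows "\<bar>iter w f k x - pim w f\<bar> \<le> (1 - \<delta>) ^ k * (2 * C)"
proof -
  have "\<bar>pim w (iter w f k) - iter w f k x\<bar> \<le> (1 - \<delta>) ^ k * (2 * C)"
    by (rule pim_mono_abs[OF w measurable_iter[OF w f(1)] iter_abs_le[OF w f] iter_osc[OF w f _ x]])
  then show ?thesis by (simp add: pim_iter[OF w f] abs_minus_commute)
qed

text \<open>The Poisson solution normalized to vanish at \<open>x0\<close>; it differs by a constant
  from the series of \<open>iter w f k x - pim w f\<close>. With this choice a bound on the
  oscillation is at once a bound on the function.\<close>

definition pois :: "('x \<Rightarrow> real) \<Rightarrow> ('x \<Rightarrow> real) \<Rightarrow> 'x \<Rightarrow> 'x \<Rightarrow> real" where
  "pois w f x0 x = (\<Sum>k. iter w f k x - iter w f k x0)"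

lemma geom_sums: "(\<lambda>k. (1 - \<delta>) ^ k * c) sums (c / \<delta>)"
  using sums_mult2[OF geometric_sums, of "1 - \<delta>" c] \<delta> by simp

lemma iter_diff_summable:
  assumes w: "good w" and f: "f \<in> borel_measurable K" "\<And>y. y \<in> Xs \<Longrightarrow> \<bar>f y\<bar> \<le> C" and x: "x \<in> Xs" "x' \<in> Xs"
  shows "summable (\<lambda>k. iter w f k x - iter w f k x')"
  using iter_osc[OF w f x] by (intro summable_comparison_test'[OF sums_summable[OF geom_sums]]) auto

lemma pois_diff:
  assumes w: "good w" and f: "f \<in> borel_measurable K" "\<And>y. y \<in> Xs \<Longrightarrow> \<bar>f y\<bar> \<le> C"
    and x: "x \<in> Xs" "x' \<in> Xs" "x0 \<in> Xs"
  shows "\<bar>pois w f x0 x - pois w f x0 x'\<bar> \<le> 2 * C / \<delta>"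
proof -
  have "pois w f x0 x - pois w f x0 x' = (\<Sum>k. iter w f k x - iter w f k x')"
    unfolding pois_def by (subst suminf_diff) (use iter_diff_summable[OF w f] x in auto)
  also have "\<bar>\<dots>\<bar> \<le> (\<Sum>k. (1 - \<delta>) ^ k * (2 * C))"
    using norm_suminf_le[of "\<lambda>k. iter w f k x - iter w f k x'", OF _ sums_summable[OF geom_sums]]
      iter_osc[OF w f x(1,2)] by simp
  finally show ?thesis using sums_unique[OF geom_sums, of "2 * C"] by simp
qed

lemma pois_x0 [simp]: "pois w f x0 x0 = 0"
  by (simp add: pois_def)

lemma pois_abs_le:
  assumes w: "good w" and f: "f \<in> borel_measurable K" "\<And>y. y \<in> Xs \<Longrightarrow> \<bar>f y\<bar> \<le> C"
    and x: "x \<in> Xs" "x0 \<in> Xs"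
  shows "\<bar>pois w f x0 x\<bar> \<le> 2 * C / \<delta>"
  using pois_diff[OF w f x(1,2,2)] by simp

lemma pois_tail:
  assumes w: "good w" and f: "f \<in> borel_measurable K" "\<And>y. y \<in> Xs \<Longrightarrow> \<bar>f y\<bar> \<le> C"
    and x: "x \<in> Xs" "x0 \<in> Xs"
  shows "\<bar>pois w f x0 x - (\<Sum>k<m. iter w f k x - iter w f k x0)\<bar> \<le> (1 - \<delta>) ^ m * (2 * C / \<delta>)"
proof -
  have "pois w f x0 x - (\<Sum>k<m. iter w f k x - iter w f k x0) = (\<Sum>k. iter w f (k + m) x - iter w f (k + m) x0)"
    unfolding pois_def using suminf_minus_initial_segment[OF iter_diff_summable[OF w f x]] by simp
  also have "\<bar>\<dots>\<bar> \<le> (\<Sum>k. (1 - \<delta>) ^ k * ((1 - \<delta>) ^ m * (2 * C)))"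
    using norm_suminf_le[of "\<lambda>k. iter w f (k + m) x - iter w f (k + m) x0", OF _ sums_summable[OF geom_sums]]
      iter_osc[OF w f x, of "_ + m"] by (simp add: power_add mult.assoc)
  finally show ?thesis using sums_unique[OF geom_sums, of "(1 - \<delta>) ^ m * (2 * C)"] by simp
qed

lemma measurable_pois_param:
  assumes W: "(\<lambda>(\<omega>, x). W \<omega> x) \<in> borel_measurable (N \<Otimes>\<^sub>M K)"
    and F: "(\<lambda>(\<omega>, x). F \<omega> x) \<in> borel_measurable (N \<Otimes>\<^sub>M K)"
  shows "(\<lambda>(\<omega>, x). pois (W \<omega>) (F \<omega>) x0 x) \<in> borel_measurable (N \<Otimes>\<^sub>M K)"
proof -
  note [measurable] = measurable_iter_param[OF W F]
  have x0 [measurable]: "x0 \<in> space K" by (simp add: space_K)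
  show ?thesis unfolding pois_def split_beta'
    using measurable_iter_param[OF W F] by measurable
qed

lemma measurable_pois:
  assumes "good w" "f \<in> borel_measurable K"
  shows "pois w f x0 \<in> borel_measurable K"
  unfolding pois_def using measurable_iter[OF assms] by measurable

text \<open>Applied to the partial sum \<open>U m\<close>, the kernel shifts the iterates and the
  sum telescopes. The tails are geometric uniformly on \<open>Xs\<close>, so the limit may be taken
  inside \<open>Pop\<close>, while the last iterate tends to \<open>pim w f\<close>.\<close>

lemma Pop_pois:
  assumes w: "good w" and f: "f \<in> borel_measurable K" "\<And>y. y \<in> Xs \<Longrightarrow> \<bar>f y\<bar> \<le> C"
    and x: "x \<in> Xs" "x0 \<in> Xs"
  shows "Pop w (pois w f x0) x = pois w f x0 x - f x + pim w f"
proof -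
  define U where "U m = (\<lambda>x. \<Sum>k<m. iter w f k x - iter w f k x0)" for m
  define p where "p = pois w f x0"
  have Um: "U m \<in> borel_measurable K" for m
    unfolding U_def using measurable_iter[OF w f(1)] by measurable
  have pm: "p \<in> borel_measurable K" unfolding p_def by (rule measurable_pois[OF w f(1)])
  have pb: "\<bar>p y\<bar> \<le> 2 * C / \<delta>" if "y \<in> Xs" for y
    unfolding p_def using pois_abs_le[OF w f that x(2)] .
  have tail: "\<bar>p y - U m y\<bar> \<le> (1 - \<delta>) ^ m * (2 * C / \<delta>)" if "y \<in> Xs" for y m
    unfolding p_def U_def using pois_tail[OF w f that x(2)] .
  have Ub: "\<bar>U m y\<bar> \<le> 2 * C / \<delta> + (1 - \<delta>) ^ m * (2 * C / \<delta>)" if "y \<in> Xs" for y m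
    using pb[OF that] tail[OF that, of m] by linarith
  have PU: "Pop w (U m) x = U m x + iter w f m x - f x" for m
  proof (induction m)
    case 0
    then show ?case by (simp add: U_def)
  next
    case (Suc m)
    \<comment> \<open>The new summand enters with reversed sign, as something subtracted, to fit
      \<open>Pop_diff\<close>.\<close>
    have "Pop w (\<lambda>y. U m y - (iter w f m x0 - iter w f m y)) x
        = Pop w (U m) x - Pop w (\<lambda>y. iter w f m x0 - iter w f m y) x"
    proof (rule Pop_diff[OF w Um Ub _ _ x(1)])
      show "(\<lambda>y. iter w f m x0 - iter w f m y) \<in> borel_measurable K"
        using measurable_iter[OF w f(1), of m] by measurable
    qed (auto intro!: iter_osc[OF w f x(2)])
    moreover have "Pop w (\<lambda>y. iter w f m x0 - iter w f m y) x = iter w f m x0 - iter w f (Suc m) x"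
      using Pop_diff[OF w _ _ measurable_iter[OF w f(1)] iter_abs_le[OF w f], of "\<lambda>_. iter w f m x0" "\<bar>iter w f m x0\<bar>" x m] x
      by (simp add: iter_Suc)
    moreover have "U (Suc m) = (\<lambda>y. U m y - (iter w f m x0 - iter w f m y))"
      by (simp add: U_def fun_eq_iff)
    ultimately show ?case using Suc by (simp add: U_def)
  qed
  \<comment> \<open>Two tails of the series, one at \<open>x\<close> and one under
    \<open>Pop\<close>, give \<open>4 * C / \<delta>\<close>; the distance of the last iterate from
    the mean gives \<open>2 * C\<close>.\<close>
  have bound: "\<bar>Pop w p x - (p x - f x + pim w f)\<bar> \<le> (1 - \<delta>) ^ m * (4 * C / \<delta> + 2 * C)" for m
  proof -
    have "\<bar>Pop w (\<lambda>y. p y - U m y) x\<bar> \<le> (1 - \<delta>) ^ m * (2 * C / \<delta>)"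
      using pm Um by (intro Pop_abs_le[OF w _ tail x(1)]) measurable
    moreover have "Pop w (\<lambda>y. p y - U m y) x = Pop w p x - Pop w (U m) x"
      by (rule Pop_diff[OF w pm pb Um Ub x(1)])
    ultimately have "\<bar>Pop w p x - Pop w (U m) x\<bar> \<le> (1 - \<delta>) ^ m * (2 * C / \<delta>)" by simp
    moreover have "(1 - \<delta>) ^ m * (4 * C / \<delta> + 2 * C)
        = (1 - \<delta>) ^ m * (2 * C / \<delta>) + (1 - \<delta>) ^ m * (2 * C / \<delta>) + (1 - \<delta>) ^ m * (2 * C)"
      by (simp add: algebra_simps)
    ultimately show ?thesis
      using tail[OF x(1), of m] iter_pim[OF w f x(1), of m] PU[of m] by linarith
  qed
  have "(\<lambda>m. (1 - \<delta>) ^ m * (4 * C / \<delta> + 2 * C)) \<longlonglongrightarrow> 0 * (4 * C / \<delta> + 2 * C)"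
    using \<delta> by (intro tendsto_mult tendsto_const LIMSEQ_power_zero) auto
  then have "\<bar>Pop w p x - (p x - f x + pim w f)\<bar> \<le> 0"
    using bound by (intro LIMSEQ_le_const[of _ 0]) auto
  then show ?thesis by (simp add: p_def)
qed

text \<open>For \<open>D\<close> the supremum of all differences, the hypothesis yields
  \<open>D \<le> (1 - \<delta>) * D + E\<close>. Boundedness of \<open>v\<close> makes this supremum
  finite, so the inequality can be solved for \<open>D\<close>.\<close>

lemma osc_contraction_bound:
  assumes "\<And>y. y \<in> Xs \<Longrightarrow> \<bar>v y\<bar> \<le> M" and ne: "Xs \<noteq> {}"
    and step: "\<And>D. (\<And>y z. y \<in> Xs \<Longrightarrow> z \<in> Xs \<Longrightarrow> v y - v z \<le> D)
      \<Longrightarrow> (\<And>y z. y \<in> Xs \<Longrightarrow> z \<in> Xs \<Longrightarrow> v y - v z \<le> (1 - \<delta>) * D + E)"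
    and "y \<in> Xs" "z \<in> Xs"
  shows "v y - v z \<le> E / \<delta>"
proof -
  define D where "D = Sup ((\<lambda>(y, z). v y - v z) ` (Xs \<times> Xs))"
  have bdd: "bdd_above ((\<lambda>(y, z). v y - v z) ` (Xs \<times> Xs))"
  proof (rule bdd_aboveI[of _ "2 * M"])
    fix t assume "t \<in> (\<lambda>(y, z). v y - v z) ` (Xs \<times> Xs)"
    then obtain y z where yz: "y \<in> Xs" "z \<in> Xs" "t = v y - v z" by auto
    then show "t \<le> 2 * M" using assms(1)[OF yz(1)] assms(1)[OF yz(2)] by linarith
  qed
  have D: "v y - v z \<le> D" if "y \<in> Xs" "z \<in> Xs" for y z
    unfolding D_def using that by (intro cSup_upper[OF _ bdd]) auto
  have "D \<le> (1 - \<delta>) * D + E"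
    unfolding D_def
  proof (rule cSup_least)
    fix t assume "t \<in> (\<lambda>(y, z). v y - v z) ` (Xs \<times> Xs)"
    then obtain y z where yz: "y \<in> Xs" "z \<in> Xs" "t = v y - v z" by auto
    show "t \<le> (1 - \<delta>) * Sup ((\<lambda>(y, z). v y - v z) ` (Xs \<times> Xs)) + E"
      using step[OF D yz(1,2)] yz(3) unfolding D_def by simp
  qed (use ne in auto)
  then have "\<delta> * D \<le> E" by (simp add: left_diff_distrib)
  then have "D \<le> E / \<delta>" using \<delta>(1) by (simp add: pos_le_divide_eq mult.commute)
  then show ?thesis using D[OF assms(4,5)] by linarith
qed

text \<open>The difference \<open>v\<close> of the two solutions equals \<open>Pop w' v\<close> up
  to the errors \<open>f' - f\<close> and \<open>Pop w' u - Pop w u\<close> and the constant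
  \<open>pim w' f' - pim w f\<close>. Oscillations do not see the constant, so the change of the
  invariant law drops out. Contraction bounds the oscillation of \<open>v\<close>, and
  \<open>v x0 = 0\<close> turns this into a bound on \<open>v\<close>.\<close>

lemma pois_lipschitz:
  assumes w: "good w" "good w'" and L: "\<And>x. x \<in> Xs \<Longrightarrow> \<bar>ln (w' x) - ln (w x)\<bar> \<le> L"
    and f: "f \<in> borel_measurable K" "\<And>y. y \<in> Xs \<Longrightarrow> \<bar>f y\<bar> \<le> C"
    and f': "f' \<in> borel_measurable K" "\<And>y. y \<in> Xs \<Longrightarrow> \<bar>f' y\<bar> \<le> C"
    and E: "\<And>y. y \<in> Xs \<Longrightarrow> \<bar>f' y - f y\<bar> \<le> E" and x0: "x0 \<in> Xs" and x: "x \<in> Xs"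
  shows "\<bar>Pop w' (pois w' f' x0) x - Pop w (pois w f x0) x\<bar> \<le> (2 * E + 12 * L * C / \<delta>) / \<delta>"
proof -
  define u where "u = pois w f x0"
  define u' where "u' = pois w' f' x0"
  have um: "u \<in> borel_measurable K" "u' \<in> borel_measurable K"
    unfolding u_def u'_def using measurable_pois w f f' by auto
  have ub: "\<bar>u y\<bar> \<le> 2 * C / \<delta>" "\<bar>u' y\<bar> \<le> 2 * C / \<delta>" if "y \<in> Xs" for y
    unfolding u_def u'_def using pois_abs_le[OF _ _ _ that x0] w f f' by auto
  have L0: "0 \<le> L" using L[OF x0] by linarith
  have C0: "0 \<le> C" using f(2)[OF x0] by linarith
  define v where "v y = u' y - u y" for y
  have vm: "v \<in> borel_measurable K" unfolding v_def using um by measurable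
  have vb: "\<bar>v y\<bar> \<le> 4 * C / \<delta>" if "y \<in> Xs" for y
    using ub[OF that] unfolding v_def by linarith
  have PL: "\<bar>Pop w' u y - Pop w u y\<bar> \<le> 2 * L * (2 * C / \<delta>)" if "y \<in> Xs" for y
    using pois_diff[OF w(1) f _ _ x0] that unfolding u_def
    by (intro Pop_lipschitz[OF w L measurable_pois[OF w(1) f(1)] pois_abs_le[OF w(1) f _ x0]]) auto
  have Pv: "Pop w' v y = Pop w' u' y - Pop w' u y" if "y \<in> Xs" for y
    unfolding v_def by (rule Pop_diff[OF w(2) um(2) ub(2) um(1) ub(1) that])
  have veq: "v y = Pop w' v y + (f' y - f y) + (Pop w' u y - Pop w u y) - (pim w' f' - pim w f)" if "y \<in> Xs" for y
    using Pop_pois[OF w(1) f that x0] Pop_pois[OF w(2) f' that x0] Pv[OF that]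
    unfolding u_def[symmetric] u'_def[symmetric] v_def by linarith
  have osc: "v y - v z \<le> (2 * E + 2 * (2 * L * (2 * C / \<delta>))) / \<delta>" if "y \<in> Xs" "z \<in> Xs" for y z
  proof (rule osc_contraction_bound[OF vb _ _ that])
    fix D y z assume D: "\<And>y z. y \<in> Xs \<Longrightarrow> z \<in> Xs \<Longrightarrow> v y - v z \<le> D" and yz: "y \<in> Xs" "z \<in> Xs"
    have "Pop w' v y - Pop w' v z \<le> (1 - \<delta>) * D" by (rule Pop_osc[OF w(2) vm vb D yz])
    then show "v y - v z \<le> (1 - \<delta>) * D + (2 * E + 2 * (2 * L * (2 * C / \<delta>)))"
      using veq[OF yz(1)] veq[OF yz(2)] PL[OF yz(1)] PL[OF yz(2)] E[OF yz(1)] E[OF yz(2)] by linarith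
  qed (use x0 in auto)
  have vx0: "v x0 = 0" by (simp add: v_def u_def u'_def)
  have "\<bar>v y\<bar> \<le> (2 * E + 2 * (2 * L * (2 * C / \<delta>))) / \<delta>" if "y \<in> Xs" for y
    using osc[OF that x0] osc[OF x0 that] vx0 by linarith
  then have "\<bar>Pop w' v x\<bar> \<le> (2 * E + 2 * (2 * L * (2 * C / \<delta>))) / \<delta>"
    by (rule Pop_abs_le[OF w(2) vm _ x])
  moreover have "\<bar>Pop w' u' x - Pop w u x\<bar> \<le> \<bar>Pop w' v x\<bar> + \<bar>Pop w' u x - Pop w u x\<bar>"
    using Pv[OF x] by linarith
  \<comment> \<open>As \<delta> \<le> 1, the direct difference of the kernels can be put over
    \<delta> too. It contributes 4 to the constant 12, the oscillation of \<open>v\<close>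
    contributes 8.\<close>
  moreover have "2 * L * (2 * C / \<delta>) \<le> 2 * L * (2 * C / \<delta>) / \<delta>"
    using \<delta> L0 C0 by (intro order_trans[OF _ divide_left_mono[of \<delta> 1]]) auto
  ultimately have "\<bar>Pop w' u' x - Pop w u x\<bar>
      \<le> (2 * E + 2 * (2 * L * (2 * C / \<delta>))) / \<delta> + 2 * L * (2 * C / \<delta>) / \<delta>"
    using PL[OF x] by linarith
  also have "\<dots> = (2 * E + 12 * L * C / \<delta>) / \<delta>"
    unfolding add_divide_distrib[symmetric] by simp
  finally show ?thesis unfolding u_def u'_def .
qed

end

section \<open>Convergence of martingales\<close>

locale filtered_space = prob_space M for M :: "'w measure" +
  fixes F :: "nat \<Rightarrow> 'w measure"
  assumes F_sub: "\<And>n. subalgebra M (F n)" and F_Suc: "\<And>n. subalgebra (F (Suc n)) (F n)"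
begin

lemma F_mono: "m \<le> n \<Longrightarrow> subalgebra (F n) (F m)"
proof (induction n rule: dec_induct)
  case (step n)
  then show ?case using F_Suc[of n] by (auto simp: subalgebra_def)
qed (simp add: subalgebra_def)

lemma measurable_F_mono: "f \<in> measurable (F m) N \<Longrightarrow> m \<le> n \<Longrightarrow> f \<in> measurable (F n) N"
  using measurable_from_subalg[OF F_mono] by blast

lemma measurable_F: "f \<in> measurable (F n) N \<Longrightarrow> f \<in> measurable M N"
  using measurable_from_subalg[OF F_sub] by blast

lemma space_F: "space (F n) = space M"
  using F_sub by (simp add: subalgebra_def)

lemma integrable_bounded:
  fixes f :: "'w \<Rightarrow> real"
  assumes "f \<in> borel_measurable M" "\<And>\<omega>. \<omega> \<in> space M \<Longrightarrow> \<bar>f \<omega>\<bar> \<le> C"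
  shows "integrable M f"
  using assms by (intro integrable_const_bound[of _ C]) auto

text \<open>Martingale differences, described by orthogonality to bounded
  \<open>F n\<close>-measurable functions in place of conditional expectations. The bound on each
  term may depend on \<open>n\<close>.\<close>

definition mdiff :: "(nat \<Rightarrow> 'w \<Rightarrow> real) \<Rightarrow> bool" where
  "mdiff \<xi> \<longleftrightarrow> (\<forall>n. \<xi> n \<in> borel_measurable (F (Suc n))) \<and> (\<forall>n. \<exists>C. \<forall>\<omega>\<in>space M. \<bar>\<xi> n \<omega>\<bar> \<le> C) \<and>
     (\<forall>n b C. b \<in> borel_measurable (F n) \<longrightarrow> (\<forall>\<omega>\<in>space M. \<bar>b \<omega>\<bar> \<le> C) \<longrightarrow> (\<integral>\<omega>. b \<omega> * \<xi> n \<omega> \<partial>M) = 0)"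

lemma mdiffD:
  assumes "mdiff \<xi>"
  shows "\<xi> n \<in> borel_measurable (F (Suc n))" "\<exists>C. \<forall>\<omega>\<in>space M. \<bar>\<xi> n \<omega>\<bar> \<le> C"
    "b \<in> borel_measurable (F n) \<Longrightarrow> (\<And>\<omega>. \<omega> \<in> space M \<Longrightarrow> \<bar>b \<omega>\<bar> \<le> C) \<Longrightarrow> (\<integral>\<omega>. b \<omega> * \<xi> n \<omega> \<partial>M) = 0"
  using assms unfolding mdiff_def by blast+

text \<open>A predictable weight is moved into the test function.\<close>

lemma mdiff_scale:
  assumes \<xi>: "mdiff \<xi>" and b: "\<And>n. b n \<in> borel_measurable (F n)" "\<And>n \<omega>. \<omega> \<in> space M \<Longrightarrow> \<bar>b n \<omega>\<bar> \<le> B n"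
  shows "mdiff (\<lambda>n \<omega>. b n \<omega> * \<xi> n \<omega>)"
  unfolding mdiff_def
proof (intro conjI allI impI)
  fix n
  show "(\<lambda>\<omega>. b n \<omega> * \<xi> n \<omega>) \<in> borel_measurable (F (Suc n))"
    using mdiffD(1)[OF \<xi>, of n] measurable_F_mono[OF b(1), of n "Suc n"] by measurable
  obtain C where C: "\<And>\<omega>. \<omega> \<in> space M \<Longrightarrow> \<bar>\<xi> n \<omega>\<bar> \<le> C" using mdiffD(2)[OF \<xi>, of n] by blast
  show "\<exists>C. \<forall>\<omega>\<in>space M. \<bar>b n \<omega> * \<xi> n \<omega>\<bar> \<le> C"
  proof (intro exI ballI)
    fix \<omega> assume \<omega>: "\<omega> \<in> space M"
    show "\<bar>b n \<omega> * \<xi> n \<omega>\<bar> \<le> B n * C"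
      unfolding abs_mult using b(2)[OF \<omega>, of n] C[OF \<omega>] by (intro mult_mono) auto
  qed
next
  fix n and c :: "'w \<Rightarrow> real" and C assume c: "c \<in> borel_measurable (F n)" "\<forall>\<omega>\<in>space M. \<bar>c \<omega>\<bar> \<le> C"
  have "(\<integral>\<omega>. (c \<omega> * b n \<omega>) * \<xi> n \<omega> \<partial>M) = 0"
  proof (rule mdiffD(3)[OF \<xi>])
    show "(\<lambda>\<omega>. c \<omega> * b n \<omega>) \<in> borel_measurable (F n)" using c(1) b(1)[of n] by measurable
    show "\<bar>c \<omega> * b n \<omega>\<bar> \<le> C * B n" if "\<omega> \<in> space M" for \<omega>
      unfolding abs_mult using b(2)[OF that, of n] c(2) that
      by (intro mult_mono) (auto intro: order_trans[OF abs_ge_zero])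
  qed
  then show "(\<integral>\<omega>. c \<omega> * (b n \<omega> * \<xi> n \<omega>) \<partial>M) = 0" by (simp add: mult.assoc)
qed

lemma mdiff_partial_sum:
  assumes \<xi>: "mdiff \<xi>" and N: "N \<le> n"
  shows "(\<lambda>\<omega>. \<Sum>k\<in>{m..<N}. \<xi> k \<omega>) \<in> borel_measurable (F n)"
    and "\<exists>C. \<forall>\<omega>\<in>space M. \<bar>\<Sum>k\<in>{m..<N}. \<xi> k \<omega>\<bar> \<le> C"
proof -
  show "(\<lambda>\<omega>. \<Sum>k\<in>{m..<N}. \<xi> k \<omega>) \<in> borel_measurable (F n)"
    using N by (intro borel_measurable_sum measurable_F_mono[OF mdiffD(1)[OF \<xi>]]) auto
  obtain C where C: "\<And>n \<omega>. \<omega> \<in> space M \<Longrightarrow> \<bar>\<xi> n \<omega>\<bar> \<le> C n"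
    using mdiffD(2)[OF \<xi>] by metis
  show "\<exists>C. \<forall>\<omega>\<in>space M. \<bar>\<Sum>k\<in>{m..<N}. \<xi> k \<omega>\<bar> \<le> C"
    by (intro exI[of _ "\<Sum>k\<in>{m..<N}. C k"] ballI order_trans[OF sum_abs] sum_mono C)
qed

text \<open>The cross term vanishes because the sum of the terms before \<open>N\<close> is a
  bounded \<open>F N\<close>-measurable test function for \<open>\<xi> N\<close>.\<close>

lemma mdiff_L2:
  assumes \<xi>: "mdiff \<xi>" and mN: "m \<le> N"
  shows "(\<integral>\<omega>. (\<Sum>k\<in>{m..<N}. \<xi> k \<omega>)\<^sup>2 \<partial>M) = (\<Sum>k\<in>{m..<N}. \<integral>\<omega>. (\<xi> k \<omega>)\<^sup>2 \<partial>M)"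
  using mN
proof (induction N rule: dec_induct)
  case (step N)
  define Y where "Y \<omega> = (\<Sum>k\<in>{m..<N}. \<xi> k \<omega>)" for \<omega>
  obtain C where C: "\<And>\<omega>. \<omega> \<in> space M \<Longrightarrow> \<bar>Y \<omega>\<bar> \<le> C"
    using mdiff_partial_sum(2)[OF \<xi> order_refl, of m N] unfolding Y_def by blast
  obtain C' where C': "\<And>\<omega>. \<omega> \<in> space M \<Longrightarrow> \<bar>\<xi> N \<omega>\<bar> \<le> C'"
    using mdiffD(2)[OF \<xi>, of N] by blast
  have YF: "Y \<in> borel_measurable (F N)" unfolding Y_def by (rule mdiff_partial_sum(1)[OF \<xi> order_refl])
  note [measurable] = measurable_F[OF YF] measurable_F[OF mdiffD(1)[OF \<xi>, of N]]
  have sq: "\<bar>a * b\<bar> \<le> c * d" if "\<bar>a\<bar> \<le> c" "\<bar>b\<bar> \<le> d" for a b c d :: real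
    unfolding abs_mult using that by (intro mult_mono) auto
  have i: "integrable M (\<lambda>\<omega>. Y \<omega> * Y \<omega>)" "integrable M (\<lambda>\<omega>. Y \<omega> * \<xi> N \<omega>)" "integrable M (\<lambda>\<omega>. \<xi> N \<omega> * \<xi> N \<omega>)"
    by (intro integrable_bounded[OF _ sq[OF C C]] integrable_bounded[OF _ sq[OF C C']]
        integrable_bounded[OF _ sq[OF C' C']]; measurable)+
  have "(\<integral>\<omega>. (\<Sum>k\<in>{m..<Suc N}. \<xi> k \<omega>)\<^sup>2 \<partial>M) = (\<integral>\<omega>. (Y \<omega> * Y \<omega> + 2 * (Y \<omega> * \<xi> N \<omega>)) + \<xi> N \<omega> * \<xi> N \<omega> \<partial>M)"
    using step(1) by (intro Bochner_Integration.integral_cong) (auto simp: Y_def power2_eq_square algebra_simps)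
  also have "\<dots> = (\<integral>\<omega>. Y \<omega> * Y \<omega> \<partial>M) + 2 * (\<integral>\<omega>. Y \<omega> * \<xi> N \<omega> \<partial>M) + (\<integral>\<omega>. \<xi> N \<omega> * \<xi> N \<omega> \<partial>M)"
    using i by simp
  also have "(\<integral>\<omega>. Y \<omega> * \<xi> N \<omega> \<partial>M) = 0" by (rule mdiffD(3)[OF \<xi> YF C])
  finally show ?case using step by (simp add: Y_def power2_eq_square)
qed simp

text \<open>The partial sums are stopped at their first exit from the \<open>e\<close>-ball: the stopped sums
  are again a martingale, and they stay outside of the ball after the exit.\<close>
lemma mdiff_maximal:
  assumes \<xi>: "mdiff \<xi>" and e: "0 < e" and mN: "m \<le> N"
  shows "prob {\<omega>\<in>space M. \<exists>j\<in>{m..N}. e \<le> \<bar>\<Sum>k\<in>{m..<j}. \<xi> k \<omega>\<bar>}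
    \<le> (\<Sum>k\<in>{m..<N}. \<integral>\<omega>. (\<xi> k \<omega>)\<^sup>2 \<partial>M) / e\<^sup>2"
proof -
  \<comment> \<open>The off-by-one matters: sums over \<open>{m..<j}\<close> with
    \<open>j \<le> n\<close> contain \<open>\<xi> k\<close> for \<open>k < n\<close> alone, so the
    switch \<open>\<tau> n\<close> is known at time \<open>n\<close>, before \<open>\<xi> n\<close>
    is added.\<close>
  define \<tau> where "\<tau> n \<omega> = (if \<forall>j\<in>{m..n}. \<bar>\<Sum>k\<in>{m..<j}. \<xi> k \<omega>\<bar> < e then 1 else 0 :: real)" for n \<omega>
  have \<tau>F: "\<tau> n \<in> borel_measurable (F n)" for n
  proof -
    have "{\<omega> \<in> space (F n). \<forall>j\<in>{m..n}. \<bar>\<Sum>k\<in>{m..<j}. \<xi> k \<omega>\<bar> < e} \<in> sets (F n)"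
    proof (rule sets.sets_Collect_finite_All)
      show "{\<omega> \<in> space (F n). \<bar>\<Sum>k\<in>{m..<j}. \<xi> k \<omega>\<bar> < e} \<in> sets (F n)" if "j \<in> {m..n}" for j
      proof -
        have [measurable]: "(\<lambda>\<omega>. \<Sum>k\<in>{m..<j}. \<xi> k \<omega>) \<in> borel_measurable (F n)"
          using that by (intro mdiff_partial_sum(1)[OF \<xi>]) auto
        show ?thesis by (intro borel_measurable_less borel_measurable_abs borel_measurable_const) measurable
      qed
    qed auto
    then show ?thesis unfolding \<tau>_def by (intro measurable_If) auto
  qed
  have \<tau>1: "\<bar>\<tau> n \<omega>\<bar> \<le> 1" for n \<omega> by (simp add: \<tau>_def)
  define \<eta> where "\<eta> n \<omega> = \<tau> n \<omega> * \<xi> n \<omega>" for n \<omega>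
  have \<eta>: "mdiff \<eta>"
    unfolding \<eta>_def by (rule mdiff_scale[OF \<xi> \<tau>F, of "\<lambda>_. 1"]) (rule \<tau>1)
  define Y where "Y \<omega> = (\<Sum>k\<in>{m..<N}. \<eta> k \<omega>)" for \<omega>
  have stop: "e \<le> \<bar>Y \<omega>\<bar>" if ex: "\<exists>j\<in>{m..N}. e \<le> \<bar>\<Sum>k\<in>{m..<j}. \<xi> k \<omega>\<bar>" for \<omega>
  proof -
    define P where "P j \<longleftrightarrow> j \<in> {m..N} \<and> e \<le> \<bar>\<Sum>k\<in>{m..<j}. \<xi> k \<omega>\<bar>" for j
    define j where "j = (LEAST j. P j)"
    have j: "P j" unfolding j_def by (rule LeastI_ex) (use ex in \<open>auto simp: P_def\<close>)
    then have jm: "m \<le> j" "j \<le> N" by (auto simp: P_def)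
    have before: "\<tau> k \<omega> = 1" if "k < j" for k
    proof -
      have "\<bar>\<Sum>k\<in>{m..<i}. \<xi> k \<omega>\<bar> < e" if i: "i \<in> {m..k}" for i
      proof -
        have "\<not> P i" using not_less_Least[of i P] i \<open>k < j\<close> unfolding j_def by simp
        moreover have "i \<in> {m..N}" using i \<open>k < j\<close> jm by simp
        ultimately show ?thesis by (simp add: P_def not_le)
      qed
      then show ?thesis unfolding \<tau>_def by simp
    qed
    have after: "\<tau> k \<omega> = 0" if "j \<le> k" for k
    proof -
      have "j \<in> {m..k}" "\<not> \<bar>\<Sum>k\<in>{m..<j}. \<xi> k \<omega>\<bar> < e" using j that jm unfolding P_def by simp_all
      then show ?thesis unfolding \<tau>_def by auto
    qed
    have "Y \<omega> = (\<Sum>k\<in>{m..<j}. \<eta> k \<omega>) + (\<Sum>k\<in>{j..<N}. \<eta> k \<omega>)"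
      unfolding Y_def using jm by (simp add: sum.atLeastLessThan_concat)
    also have "(\<Sum>k\<in>{j..<N}. \<eta> k \<omega>) = 0" by (intro sum.neutral) (auto simp: \<eta>_def after)
    also have "(\<Sum>k\<in>{m..<j}. \<eta> k \<omega>) = (\<Sum>k\<in>{m..<j}. \<xi> k \<omega>)"
      by (intro sum.cong) (auto simp: \<eta>_def before)
    finally show ?thesis using j by (simp add: P_def)
  qed
  have Ym: "Y \<in> borel_measurable M"
    unfolding Y_def by (rule measurable_F[OF mdiff_partial_sum(1)[OF \<eta> order_refl]])
  obtain C where C: "\<And>\<omega>. \<omega> \<in> space M \<Longrightarrow> \<bar>Y \<omega>\<bar> \<le> C"
    using mdiff_partial_sum(2)[OF \<eta> order_refl, of m N] unfolding Y_def by blast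
  have Yi: "integrable M (\<lambda>\<omega>. (Y \<omega>)\<^sup>2)"
  proof (rule integrable_bounded)
    show "\<bar>(Y \<omega>)\<^sup>2\<bar> \<le> C\<^sup>2" if "\<omega> \<in> space M" for \<omega>
      using power_mono[OF C[OF that] abs_ge_zero, of 2] by simp
  qed (use Ym in measurable)
  have "e\<^sup>2 * prob {\<omega>\<in>space M. \<exists>j\<in>{m..N}. e \<le> \<bar>\<Sum>k\<in>{m..<j}. \<xi> k \<omega>\<bar>} \<le> e\<^sup>2 * prob {\<omega>\<in>space M. e\<^sup>2 \<le> (Y \<omega>)\<^sup>2}"
  proof (intro mult_left_mono finite_measure_mono)
    show "{\<omega>\<in>space M. \<exists>j\<in>{m..N}. e \<le> \<bar>\<Sum>k\<in>{m..<j}. \<xi> k \<omega>\<bar>} \<subseteq> {\<omega>\<in>space M. e\<^sup>2 \<le> (Y \<omega>)\<^sup>2}"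
    proof (intro subsetI CollectI conjI; elim CollectE conjE)
      fix \<omega> assume "\<exists>j\<in>{m..N}. e \<le> \<bar>\<Sum>k\<in>{m..<j}. \<xi> k \<omega>\<bar>"
      from power_mono[OF stop[OF this], of 2] e show "e\<^sup>2 \<le> (Y \<omega>)\<^sup>2" by simp
    qed
    show "{\<omega>\<in>space M. e\<^sup>2 \<le> (Y \<omega>)\<^sup>2} \<in> events" using Ym by measurable
  qed simp
  also have "\<dots> \<le> (\<integral>\<omega>. (Y \<omega>)\<^sup>2 \<partial>M)"
    using integral_Markov_inequality_measure[OF Yi, of "{}" "e\<^sup>2"] e by (simp add: field_simps)
  also have "\<dots> = (\<Sum>k\<in>{m..<N}. \<integral>\<omega>. (\<eta> k \<omega>)\<^sup>2 \<partial>M)"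
    unfolding Y_def by (rule mdiff_L2[OF \<eta> mN])
  also have "\<dots> \<le> (\<Sum>k\<in>{m..<N}. \<integral>\<omega>. (\<xi> k \<omega>)\<^sup>2 \<partial>M)"
  proof (intro sum_mono integral_mono_AE')
    fix k
    obtain C where C: "\<And>\<omega>. \<omega> \<in> space M \<Longrightarrow> \<bar>\<xi> k \<omega>\<bar> \<le> C" using mdiffD(2)[OF \<xi>, of k] by blast
    show "integrable M (\<lambda>\<omega>. (\<xi> k \<omega>)\<^sup>2)"
    proof (rule integrable_bounded)
      show "\<bar>(\<xi> k \<omega>)\<^sup>2\<bar> \<le> C\<^sup>2" if "\<omega> \<in> space M" for \<omega>
        using power_mono[OF C[OF that] abs_ge_zero, of 2] by simp
    qed (use measurable_F[OF mdiffD(1)[OF \<xi>, of k]] in measurable)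
    show "AE \<omega> in M. (\<eta> k \<omega>)\<^sup>2 \<le> (\<xi> k \<omega>)\<^sup>2" by (simp add: \<eta>_def \<tau>_def)
  qed simp
  finally show ?thesis using e by (simp add: field_simps)
qed

text \<open>By the maximal inequality, the sums started at \<open>m\<close> ever leave the
  \<open>e\<close>-ball with probability at most the tail of the second moments from
  \<open>m\<close> on, divided by \<open>e\<^sup>2\<close>. Hence almost surely they stay inside for
  some \<open>m\<close>, which is Cauchy's criterion once \<open>e\<close> runs through a null
  sequence.\<close>

lemma mdiff_convergent:
  assumes \<xi>: "mdiff \<xi>" and s: "summable (\<lambda>n. \<integral>\<omega>. (\<xi> n \<omega>)\<^sup>2 \<partial>M)"
  shows "AE \<omega> in M. summable (\<lambda>n. \<xi> n \<omega>)"
proof -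
  let ?v = "\<lambda>n. \<integral>\<omega>. (\<xi> n \<omega>)\<^sup>2 \<partial>M"
  define A where "A e m N = {\<omega>\<in>space M. \<exists>j\<in>{m..N}. e \<le> \<bar>\<Sum>k\<in>{m..<j}. \<xi> k \<omega>\<bar>}" for e :: real and m N
  have A_meas: "A e m N \<in> events" for e m N
  proof -
    have [measurable]: "\<xi> k \<in> borel_measurable M" for k by (rule measurable_F[OF mdiffD(1)[OF \<xi>]])
    show ?thesis unfolding A_def by measurable
  qed
  have tail: "prob (\<Union>N. A e m N) \<le> (\<Sum>k. ?v (k + m)) / e\<^sup>2" if e: "0 < e" for e m
  proof (rule LIMSEQ_le_const2)
    have "incseq (A e m)" by (auto simp: incseq_def A_def)
    then show "(\<lambda>N. prob (A e m N)) \<longlonglongrightarrow> prob (\<Union>N. A e m N)"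
      using A_meas by (intro finite_Lim_measure_incseq) auto
    show "\<exists>N0. \<forall>N\<ge>N0. prob (A e m N) \<le> (\<Sum>k. ?v (k + m)) / e\<^sup>2"
    proof (intro exI allI impI)
      fix N assume N: "m \<le> N"
      have "(\<Sum>k\<in>{m..<N}. ?v k) = (\<Sum>k<N - m. ?v (k + m))"
        using sum.shift_bounds_nat_ivl[of ?v 0 m "N - m"] N by (simp add: lessThan_atLeast0)
      also have "\<dots> \<le> (\<Sum>k. ?v (k + m))"
        using s by (intro sum_le_suminf) (auto simp: summable_iff_shift[of ?v])
      finally show "prob (A e m N) \<le> (\<Sum>k. ?v (k + m)) / e\<^sup>2"
        using mdiff_maximal[OF \<xi> e N] e unfolding A_def
        by (intro order_trans[OF mdiff_maximal[OF \<xi> e N]] divide_right_mono) auto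
    qed
  qed
  have null: "AE \<omega> in M. \<exists>m. \<omega> \<notin> (\<Union>N. A e m N)" if e: "0 < e" for e
  proof -
    have I: "(\<Inter>m. \<Union>N. A e m N) \<in> events" using A_meas by auto
    have "(\<lambda>m. (\<Sum>k. ?v (k + m)) / e\<^sup>2) \<longlonglongrightarrow> 0 / e\<^sup>2"
      using suminf_exist_split2[OF s] e by (intro tendsto_divide tendsto_const) auto
    then have "prob (\<Inter>m. \<Union>N. A e m N) \<le> 0 / e\<^sup>2"
    proof (rule LIMSEQ_le_const, intro exI allI impI)
      fix m
      have "prob (\<Inter>m. \<Union>N. A e m N) \<le> prob (\<Union>N. A e m N)"
        using A_meas by (intro finite_measure_mono) auto
      then show "prob (\<Inter>m. \<Union>N. A e m N) \<le> (\<Sum>k. ?v (k + m)) / e\<^sup>2" using tail[OF e, of m] by linarith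
    qed
    then have "prob (\<Inter>m. \<Union>N. A e m N) = 0" using measure_nonneg[of M] by (simp add: antisym)
    then have "AE \<omega> in M. \<omega> \<notin> (\<Inter>m. \<Union>N. A e m N)"
      using prob_eq_0[OF I] by simp
    then show ?thesis by simp
  qed
  have "AE \<omega> in M. \<forall>i::nat. \<exists>m. \<omega> \<notin> (\<Union>N. A (1 / real (Suc i)) m N)"
    unfolding AE_all_countable by (intro allI null) auto
  then show ?thesis
  proof (rule AE_mp, intro AE_I2 impI)
    fix \<omega> assume \<omega>: "\<omega> \<in> space M" and *: "\<forall>i::nat. \<exists>m. \<omega> \<notin> (\<Union>N. A (1 / real (Suc i)) m N)"
    show "summable (\<lambda>n. \<xi> n \<omega>)"
      unfolding summable_Cauchy
    proof (intro allI impI)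
      fix e :: real assume e: "0 < e"
      obtain i :: nat where i: "inverse (real (Suc i)) < e / 2" using reals_Archimedean[of "e / 2"] e by auto
      obtain m where m: "\<omega> \<notin> (\<Union>N. A (1 / real (Suc i)) m N)" using * by blast
      have small: "\<bar>\<Sum>k\<in>{m..<j}. \<xi> k \<omega>\<bar> < e / 2" if "m \<le> j" for j
      proof -
        have "\<omega> \<notin> A (1 / real (Suc i)) m j" using m by blast
        then have "\<bar>\<Sum>k\<in>{m..<j}. \<xi> k \<omega>\<bar> < 1 / real (Suc i)" using \<omega> that unfolding A_def by force
        then show ?thesis using i by (simp add: inverse_eq_divide)
      qed
      show "\<exists>N. \<forall>n\<ge>N. \<forall>j. norm (\<Sum>k\<in>{n..<j}. \<xi> k \<omega>) < e"
      proof (intro exI allI impI)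
        fix n j assume n: "m \<le> n"
        show "norm (\<Sum>k\<in>{n..<j}. \<xi> k \<omega>) < e"
        proof (cases "n \<le> j")
          case True
          have "(\<Sum>k\<in>{m..<j}. \<xi> k \<omega>) = (\<Sum>k\<in>{m..<n}. \<xi> k \<omega>) + (\<Sum>k\<in>{n..<j}. \<xi> k \<omega>)"
            using n True by (simp add: sum.atLeastLessThan_concat)
          then show ?thesis using small[OF n] small[of j] n True unfolding real_norm_def by linarith
        qed (use e in simp)
      qed
    qed
  qed
qed

text \<open>Localization: the weights are switched off once the sum of their squares exceeds \<open>L\<close>.\<close>
lemma mdiff_weighted_convergent:
  assumes D: "mdiff D" "\<And>n \<omega>. \<omega> \<in> space M \<Longrightarrow> \<bar>D n \<omega>\<bar> \<le> C"
    and \<beta>: "\<And>n. \<beta> n \<in> borel_measurable (F n)" "\<And>\<omega>. \<omega> \<in> space M \<Longrightarrow> summable (\<lambda>n. (\<beta> n \<omega>)\<^sup>2)"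
  shows "AE \<omega> in M. summable (\<lambda>n. \<beta> n \<omega> * D n \<omega>)"
proof -
  \<comment> \<open>The sum includes the index \<open>n\<close>, so \<open>b L n\<close> is still
    \<open>F n\<close>-measurable. Once the sum exceeds \<open>L\<close> it stays above, and all
    later weights are 0.\<close>
  define b where "b L n \<omega> = (if (\<Sum>k\<le>n. (\<beta> k \<omega>)\<^sup>2) \<le> real L then \<beta> n \<omega> else 0)" for L n \<omega>
  have bF: "b L n \<in> borel_measurable (F n)" for L n
  proof -
    have [measurable]: "(\<lambda>\<omega>. \<Sum>k\<le>n. (\<beta> k \<omega>)\<^sup>2) \<in> borel_measurable (F n)"
      using \<beta>(1) by (intro borel_measurable_sum borel_measurable_power measurable_F_mono[OF \<beta>(1)]) auto
    show ?thesis unfolding b_def using \<beta>(1)[of n] by measurable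
  qed
  have sumb: "(\<Sum>n<N. (b L n \<omega>)\<^sup>2) \<le> real L" for L N \<omega>
  proof (induction N)
    case (Suc N)
    show ?case
    proof (cases "(\<Sum>k\<le>N. (\<beta> k \<omega>)\<^sup>2) \<le> real L")
      case True
      have "(\<Sum>n<Suc N. (b L n \<omega>)\<^sup>2) \<le> (\<Sum>n<Suc N. (\<beta> n \<omega>)\<^sup>2)"
        by (intro sum_mono) (auto simp: b_def)
      then show ?thesis using True by (simp add: lessThan_Suc_atMost)
    next
      case False
      then show ?thesis using Suc by (simp add: b_def)
    qed
  qed simp
  have b_bound: "\<bar>b L n \<omega>\<bar> \<le> real L + 1" for L n \<omega>
  proof -
    have "(b L n \<omega>)\<^sup>2 \<le> (\<Sum>n<Suc n. (b L n \<omega>)\<^sup>2)" by (simp add: sum_nonneg)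
    then have "\<bar>b L n \<omega>\<bar>\<^sup>2 \<le> real L" using sumb[of L \<omega> "Suc n"] by simp
    also have "\<dots> \<le> (real L + 1)\<^sup>2" unfolding power2_eq_square by (simp add: distrib_left)
    finally show ?thesis by (rule power2_le_imp_le) simp
  qed
  have conv: "AE \<omega> in M. summable (\<lambda>n. b L n \<omega> * D n \<omega>)" for L
  proof (rule mdiff_convergent)
    show m: "mdiff (\<lambda>n \<omega>. b L n \<omega> * D n \<omega>)"
      by (rule mdiff_scale[OF D(1) bF, of _ "\<lambda>_. real L + 1"]) (rule b_bound)
    show "summable (\<lambda>n. \<integral>\<omega>. (b L n \<omega> * D n \<omega>)\<^sup>2 \<partial>M)"
    proof (rule summableI_nonneg_bounded)
      fix N
      have i: "integrable M (\<lambda>\<omega>. (b L n \<omega> * D n \<omega>)\<^sup>2)" for n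
      proof (rule integrable_bounded)
        show "\<bar>(b L n \<omega> * D n \<omega>)\<^sup>2\<bar> \<le> ((real L + 1) * C)\<^sup>2" if "\<omega> \<in> space M" for \<omega>
        proof -
          have "\<bar>b L n \<omega> * D n \<omega>\<bar> \<le> (real L + 1) * C"
            unfolding abs_mult by (rule mult_mono[OF b_bound D(2)[OF that]]) simp_all
          from power_mono[OF this abs_ge_zero, of 2] show ?thesis by simp
        qed
      qed (use measurable_F[OF mdiffD(1)[OF m]] in measurable)
      have "(\<Sum>n<N. \<integral>\<omega>. (b L n \<omega> * D n \<omega>)\<^sup>2 \<partial>M) = (\<integral>\<omega>. (\<Sum>n<N. (b L n \<omega> * D n \<omega>)\<^sup>2) \<partial>M)"
        using i by (simp add: Bochner_Integration.integral_sum)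
      also have "\<dots> \<le> (\<integral>\<omega>. real L * C\<^sup>2 \<partial>M)"
      proof (rule integral_mono)
        fix \<omega> assume \<omega>: "\<omega> \<in> space M"
        have "(D n \<omega>)\<^sup>2 \<le> C\<^sup>2" for n
          using power_mono[OF D(2)[OF \<omega>, of n] abs_ge_zero, of 2] by simp
        then have "(\<Sum>n<N. (b L n \<omega> * D n \<omega>)\<^sup>2) \<le> (\<Sum>n<N. (b L n \<omega>)\<^sup>2 * C\<^sup>2)"
          by (intro sum_mono) (auto simp: power_mult_distrib intro!: mult_left_mono)
        also have "\<dots> \<le> real L * C\<^sup>2"
          unfolding sum_distrib_right[symmetric] using sumb by (intro mult_right_mono) auto
        finally show "(\<Sum>n<N. (b L n \<omega> * D n \<omega>)\<^sup>2) \<le> real L * C\<^sup>2" .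
      qed (use i in auto)
      finally show "(\<Sum>n<N. \<integral>\<omega>. (b L n \<omega> * D n \<omega>)\<^sup>2 \<partial>M) \<le> real L * C\<^sup>2"
        by (simp add: prob_space)
    qed simp
  qed
  have "AE \<omega> in M. \<forall>L. summable (\<lambda>n. b L n \<omega> * D n \<omega>)"
    unfolding AE_all_countable using conv by (rule allI)
  then show ?thesis
  proof (rule AE_mp, intro AE_I2 impI)
    fix \<omega> assume \<omega>: "\<omega> \<in> space M" and *: "\<forall>L. summable (\<lambda>n. b L n \<omega> * D n \<omega>)"
    \<comment> \<open>\<open>L\<close> depends on \<omega>, which is why convergence is first
      obtained for all \<open>L\<close> outside a single null set.\<close>
    obtain L :: nat where L: "(\<Sum>n. (\<beta> n \<omega>)\<^sup>2) \<le> real L" using real_arch_simple by blast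
    have "(\<Sum>k\<le>n. (\<beta> k \<omega>)\<^sup>2) \<le> real L" for n
      using sum_le_suminf[OF \<beta>(2)[OF \<omega>], of "{..n}"] L by simp
    then have "b L n \<omega> = \<beta> n \<omega>" for n by (simp add: b_def)
    then show "summable (\<lambda>n. \<beta> n \<omega> * D n \<omega>)" using spec[OF *, of L] by (simp only:)
  qed
qed

end

section \<open>Adaptive Metropolis-Hastings chains\<close>

text \<open>Summation by parts: apart from the telescoping term there remains, up to sign,
  \<open>(\<beta> n - \<beta> (Suc n)) * c (Suc n)\<close>, and its absolute values sum to at most
  \<open>C\<close> times the total decrease of \<beta>.\<close>

lemma summable_abel:
  fixes \<beta> c :: "nat \<Rightarrow> real"
  assumes \<beta>: "decseq \<beta>" "\<And>n. 0 \<le> \<beta> n" "\<beta> \<longlonglongrightarrow> 0" and c: "\<And>n. \<bar>c n\<bar> \<le> C"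
  shows "summable (\<lambda>n. \<beta> n * (c n - c (Suc n)))"
proof -
  have "(\<lambda>n. \<beta> n * c n) \<longlonglongrightarrow> 0"
  proof (rule Lim_null_comparison)
    show "eventually (\<lambda>n. norm (\<beta> n * c n) \<le> \<beta> n * C) sequentially"
      using c \<beta>(2) by (intro always_eventually) (auto simp: abs_mult intro!: mult_left_mono)
    show "(\<lambda>n. \<beta> n * C) \<longlonglongrightarrow> 0" using tendsto_mult[OF \<beta>(3) tendsto_const[of C]] by simp
  qed
  then have 1: "summable (\<lambda>n. \<beta> n * c n - \<beta> (Suc n) * c (Suc n))" by (rule telescope_summable')
  have 2: "summable (\<lambda>n. (\<beta> n - \<beta> (Suc n)) * c (Suc n))"
  proof (rule summable_comparison_test')
    show "summable (\<lambda>n. (\<beta> n - \<beta> (Suc n)) * C)"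
      by (intro summable_mult2 telescope_summable'[OF \<beta>(3)])
    show "norm ((\<beta> n - \<beta> (Suc n)) * c (Suc n)) \<le> (\<beta> n - \<beta> (Suc n)) * C" if "0 \<le> n" for n
      using c[of "Suc n"] decseq_SucD[OF \<beta>(1), of n] by (auto simp: abs_mult intro!: mult_left_mono)
  qed
  have "(\<lambda>n. \<beta> n * (c n - c (Suc n)))
      = (\<lambda>n. (\<beta> n * c n - \<beta> (Suc n) * c (Suc n)) - (\<beta> n - \<beta> (Suc n)) * c (Suc n))"
    by (simp add: fun_eq_iff algebra_simps)
  then show ?thesis using summable_diff[OF 1 2] by simp
qed

context mh_space
begin

lemma Pop_cong:
  assumes "\<And>y. y \<in> Xs \<Longrightarrow> h y = g y" "x \<in> Xs"
  shows "Pop w h x = Pop w g x"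
proof -
  have "jump w x y * (h y - h x) = jump w x y * (g y - g x)" for y
    using assms jump_out[of x y w] by (cases "y \<in> Xs") auto
  then have "(\<lambda>y. jump w x y * (h y - h x)) = (\<lambda>y. jump w x y * (g y - g x))" by (rule ext)
  then show ?thesis unfolding Pop_def using assms by (simp only:)
qed

lemma Pop_dominated:
  assumes w: "good w" and h: "\<And>i. h i \<in> borel_measurable K" "\<And>i y. \<bar>h i y\<bar> \<le> C"
    and lim: "\<And>y. (\<lambda>i. h i y) \<longlonglongrightarrow> g y" and x: "x \<in> Xs"
  shows "(\<lambda>i. Pop w (h i) x) \<longlonglongrightarrow> Pop w g x"
  unfolding Pop_def
proof (intro tendsto_add lim integral_dominated_convergence)
  have [measurable]: "g \<in> borel_measurable K" by (rule borel_measurable_LIMSEQ_real[OF lim h(1)])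
  note [measurable] = jump_measurable1[OF good_meas[OF w]] h(1)
  show "(\<lambda>y. jump w x y * (g y - g x)) \<in> borel_measurable K"
    "(\<lambda>y. jump w x y * (h i y - h i x)) \<in> borel_measurable K" for i
    by measurable
  show "integrable K (\<lambda>y. q x y * (C + C))" using q_integrable[OF x] by simp
  show "AE y in K. (\<lambda>i. jump w x y * (h i y - h i x)) \<longlonglongrightarrow> jump w x y * (g y - g x)"
    by (intro AE_I2 tendsto_intros lim)
  have "\<bar>jump w x y * (h i y - h i x)\<bar> \<le> q x y * (C + C)" for i y
    unfolding abs_mult using jump_nonneg[OF w, of x y] jump_le[of w x y] q_nonneg[of x y]
      h(2)[of i x] h(2)[of i y] by (intro mult_mono) auto
  then show "AE y in K. norm (jump w x y * (h i y - h i x)) \<le> q x y * (C + C)" for i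
    by simp
qed

end

text \<open>The weight \<open>psi n\<close> of the kernel used at time \<open>n\<close> is a
  function of the past. The transition rule \<open>law\<close> is assumed for products of a past
  event with an event for the next state. The point \<open>x0\<close> is where the Poisson solutions
  are normalized.\<close>

locale adaptive_mh = mh_space K Xs dens q B qmin \<delta> + filtered_space M F
  for K :: "'x measure" and Xs dens q B qmin \<delta> and M :: "'w measure" and F +
  fixes X :: "nat \<Rightarrow> 'w \<Rightarrow> 'x" and psi :: "nat \<Rightarrow> 'w \<Rightarrow> 'x \<Rightarrow> real" and x0 :: 'x
  assumes X_meas: "\<And>n. X n \<in> measurable (F n) K"
    and X_in: "\<And>n \<omega>. \<omega> \<in> space M \<Longrightarrow> X n \<omega> \<in> Xs"
    and psi_meas: "\<And>n. (\<lambda>(\<omega>, x). psi n \<omega> x) \<in> borel_measurable (F n \<Otimes>\<^sub>M K)"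
    and psi_good: "\<And>n \<omega>. \<omega> \<in> space M \<Longrightarrow> good (psi n \<omega>)"
    and law: "\<And>n A H. A \<in> sets K \<Longrightarrow> H \<in> sets (F n) \<Longrightarrow>
      measure M ({\<omega>\<in>space M. X (Suc n) \<omega> \<in> A} \<inter> H)
        = (\<integral>\<omega>. indicator H \<omega> * Pop (psi n \<omega>) (indicator A) (X n \<omega>) \<partial>M)"
    and x0: "x0 \<in> Xs"
begin

section \<open>From the transition rule on events to functions of the past and the next
  state\<close>

lemma measurable_X_pair: "k \<le> n \<Longrightarrow> (\<lambda>\<omega>. (\<omega>, X n \<omega>)) \<in> measurable (F n) (F k \<Otimes>\<^sub>M K)"
  using X_meas[of n] measurable_F_mono[OF measurable_ident_sets[OF refl, of "F k"], of n] by (intro measurable_Pair) auto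

lemma measurable_eval:
  assumes "G \<in> borel_measurable (F n \<Otimes>\<^sub>M K)" "n \<le> k"
  shows "(\<lambda>\<omega>. G (\<omega>, X k \<omega>)) \<in> borel_measurable (F k)"
  using measurable_compose[OF measurable_X_pair[OF assms(2)] assms(1)] .

lemma measurable_Pop_eval:
  assumes "G \<in> borel_measurable (F n \<Otimes>\<^sub>M K)"
  shows "(\<lambda>\<omega>. Pop (psi n \<omega>) (\<lambda>y. G (\<omega>, y)) (X n \<omega>)) \<in> borel_measurable (F n)"
  using measurable_eval[OF measurable_Pop_param[OF psi_meas, of "\<lambda>\<omega> y. G (\<omega>, y)" n], of n] assms by simp

lemma measurable_section:
  assumes "G \<in> borel_measurable (F n \<Otimes>\<^sub>M K)" "\<omega> \<in> space M"
  shows "(\<lambda>y. G (\<omega>, y)) \<in> borel_measurable K"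
  using measurable_compose[OF measurable_Pair1'[of \<omega> "F n" K] assms(1)] assms(2) by (simp add: space_F)

text \<open>Induction predicate for extending \<open>law\<close>. The bound is required at all
  \<open>y\<close> and not just on \<open>Xs\<close>, so that it suits dominated limits under
  \<open>Pop\<close> as well as along the chain.\<close>

definition law_ok :: "nat \<Rightarrow> ('w \<times> 'x \<Rightarrow> real) \<Rightarrow> bool" where
  "law_ok n G \<longleftrightarrow> G \<in> borel_measurable (F n \<Otimes>\<^sub>M K) \<and> (\<exists>C. \<forall>\<omega>\<in>space M. \<forall>y. \<bar>G (\<omega>, y)\<bar> \<le> C) \<and>
     (\<integral>\<omega>. G (\<omega>, X (Suc n) \<omega>) \<partial>M) = (\<integral>\<omega>. Pop (psi n \<omega>) (\<lambda>y. G (\<omega>, y)) (X n \<omega>) \<partial>M)"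

lemma law_integrable:
  assumes G: "G \<in> borel_measurable (F n \<Otimes>\<^sub>M K)" "\<And>\<omega> y. \<omega> \<in> space M \<Longrightarrow> \<bar>G (\<omega>, y)\<bar> \<le> C"
  shows "integrable M (\<lambda>\<omega>. G (\<omega>, X (Suc n) \<omega>))"
    and "integrable M (\<lambda>\<omega>. Pop (psi n \<omega>) (\<lambda>y. G (\<omega>, y)) (X n \<omega>))"
    and "\<omega> \<in> space M \<Longrightarrow> \<bar>Pop (psi n \<omega>) (\<lambda>y. G (\<omega>, y)) (X n \<omega>)\<bar> \<le> C"
proof -
  show "integrable M (\<lambda>\<omega>. G (\<omega>, X (Suc n) \<omega>))"
    by (rule integrable_bounded[OF measurable_F[OF measurable_eval[OF G(1), of "Suc n"]] G(2)]) simp_all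
  have *: "\<bar>Pop (psi n \<omega>) (\<lambda>y. G (\<omega>, y)) (X n \<omega>)\<bar> \<le> C" if "\<omega> \<in> space M" for \<omega>
    by (rule Pop_abs_le[OF psi_good[OF that] measurable_section[OF G(1) that] G(2)[OF that] X_in[OF that]])
  show "integrable M (\<lambda>\<omega>. Pop (psi n \<omega>) (\<lambda>y. G (\<omega>, y)) (X n \<omega>))"
    by (rule integrable_bounded[OF measurable_F[OF measurable_Pop_eval[OF G(1)]] *])
  show "\<omega> \<in> space M \<Longrightarrow> \<bar>Pop (psi n \<omega>) (\<lambda>y. G (\<omega>, y)) (X n \<omega>)\<bar> \<le> C" by (rule *)
qed

lemma law_ok_diff:
  assumes "law_ok n G" "law_ok n H"
  shows "law_ok n (\<lambda>p. G p - H p)"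
proof -
  obtain C where G: "G \<in> borel_measurable (F n \<Otimes>\<^sub>M K)" "\<And>\<omega> y. \<omega> \<in> space M \<Longrightarrow> \<bar>G (\<omega>, y)\<bar> \<le> C"
    and eqG: "(\<integral>\<omega>. G (\<omega>, X (Suc n) \<omega>) \<partial>M) = (\<integral>\<omega>. Pop (psi n \<omega>) (\<lambda>y. G (\<omega>, y)) (X n \<omega>) \<partial>M)"
    using assms(1) unfolding law_ok_def by blast
  obtain D where H: "H \<in> borel_measurable (F n \<Otimes>\<^sub>M K)" "\<And>\<omega> y. \<omega> \<in> space M \<Longrightarrow> \<bar>H (\<omega>, y)\<bar> \<le> D"
    and eqH: "(\<integral>\<omega>. H (\<omega>, X (Suc n) \<omega>) \<partial>M) = (\<integral>\<omega>. Pop (psi n \<omega>) (\<lambda>y. H (\<omega>, y)) (X n \<omega>) \<partial>M)"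
    using assms(2) unfolding law_ok_def by blast
  have "Pop (psi n \<omega>) (\<lambda>y. G (\<omega>, y) - H (\<omega>, y)) (X n \<omega>)
      = Pop (psi n \<omega>) (\<lambda>y. G (\<omega>, y)) (X n \<omega>) - Pop (psi n \<omega>) (\<lambda>y. H (\<omega>, y)) (X n \<omega>)"
    if "\<omega> \<in> space M" for \<omega>
    by (rule Pop_diff[OF psi_good[OF that] measurable_section[OF G(1) that] G(2)[OF that]
          measurable_section[OF H(1) that] H(2)[OF that] X_in[OF that]])
  then have "(\<integral>\<omega>. Pop (psi n \<omega>) (\<lambda>y. G (\<omega>, y) - H (\<omega>, y)) (X n \<omega>) \<partial>M)
      = (\<integral>\<omega>. Pop (psi n \<omega>) (\<lambda>y. G (\<omega>, y)) (X n \<omega>) - Pop (psi n \<omega>) (\<lambda>y. H (\<omega>, y)) (X n \<omega>) \<partial>M)"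
    by (rule Bochner_Integration.integral_cong[OF refl])
  also have "\<dots> = (\<integral>\<omega>. G (\<omega>, X (Suc n) \<omega>) - H (\<omega>, X (Suc n) \<omega>) \<partial>M)"
    using law_integrable[OF G] law_integrable[OF H] eqG eqH by simp
  finally have "(\<integral>\<omega>. G (\<omega>, X (Suc n) \<omega>) - H (\<omega>, X (Suc n) \<omega>) \<partial>M)
      = (\<integral>\<omega>. Pop (psi n \<omega>) (\<lambda>y. G (\<omega>, y) - H (\<omega>, y)) (X n \<omega>) \<partial>M)" by simp
  moreover have "(\<lambda>p. G p - H p) \<in> borel_measurable (F n \<Otimes>\<^sub>M K)" using G(1) H(1) by measurable
  moreover have "\<bar>G (\<omega>, y) - H (\<omega>, y)\<bar> \<le> C + D" if "\<omega> \<in> space M" for \<omega> y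
    using G(2)[OF that, of y] H(2)[OF that, of y] by linarith
  ultimately show ?thesis unfolding law_ok_def by blast
qed

lemma law_ok_mult:
  assumes "law_ok n G"
  shows "law_ok n (\<lambda>p. c * G p)"
proof -
  obtain C where G: "G \<in> borel_measurable (F n \<Otimes>\<^sub>M K)" "\<And>\<omega> y. \<omega> \<in> space M \<Longrightarrow> \<bar>G (\<omega>, y)\<bar> \<le> C"
    using assms unfolding law_ok_def by blast
  have "\<bar>c * G (\<omega>, y)\<bar> \<le> \<bar>c\<bar> * C" if "\<omega> \<in> space M" for \<omega> y
    unfolding abs_mult using G(2)[OF that, of y] by (intro mult_left_mono) auto
  then show ?thesis using assms G(1) unfolding law_ok_def Pop_mult by auto
qed

lemma law_ok_const: "law_ok n (\<lambda>p. c)"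
  unfolding law_ok_def by (auto intro: exI[of _ "\<bar>c\<bar>"])

lemma law_ok_add:
  assumes "law_ok n G" "law_ok n H"
  shows "law_ok n (\<lambda>p. G p + H p)"
  using law_ok_diff[OF assms(1) law_ok_mult[OF assms(2), of "-1"]] by simp

lemma law_ok_sum: "(\<And>i. i \<in> I \<Longrightarrow> law_ok n (G i)) \<Longrightarrow> law_ok n (\<lambda>p. \<Sum>i\<in>I. G i p)"
  by (induction I rule: infinite_finite_induct) (auto intro: law_ok_const law_ok_add)

lemma law_ok_lim:
  assumes G: "\<And>i. law_ok n (G i)" "\<And>i \<omega> y. \<omega> \<in> space M \<Longrightarrow> \<bar>G i (\<omega>, y)\<bar> \<le> C"
    and lim: "\<And>\<omega> y. \<omega> \<in> space M \<Longrightarrow> (\<lambda>i. G i (\<omega>, y)) \<longlonglongrightarrow> H (\<omega>, y)"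
  shows "law_ok n H"
proof -
  have Gm: "G i \<in> borel_measurable (F n \<Otimes>\<^sub>M K)" for i using G(1) unfolding law_ok_def by blast
  have eq: "(\<integral>\<omega>. G i (\<omega>, X (Suc n) \<omega>) \<partial>M) = (\<integral>\<omega>. Pop (psi n \<omega>) (\<lambda>y. G i (\<omega>, y)) (X n \<omega>) \<partial>M)" for i
    using G(1) unfolding law_ok_def by blast
  have Hm: "H \<in> borel_measurable (F n \<Otimes>\<^sub>M K)"
    by (rule borel_measurable_LIMSEQ_real[OF _ Gm]) (use lim in \<open>auto simp: space_pair_measure space_F\<close>)
  have Hb: "\<bar>H (\<omega>, y)\<bar> \<le> C" if "\<omega> \<in> space M" for \<omega> y
    using G(2)[OF that] by (intro LIMSEQ_le_const2[OF tendsto_rabs[OF lim[OF that, of y]]]) auto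
  have "(\<lambda>i. \<integral>\<omega>. G i (\<omega>, X (Suc n) \<omega>) \<partial>M) \<longlonglongrightarrow> (\<integral>\<omega>. H (\<omega>, X (Suc n) \<omega>) \<partial>M)"
  proof (rule integral_dominated_convergence[where w = "\<lambda>_. C"])
    show "(\<lambda>\<omega>. H (\<omega>, X (Suc n) \<omega>)) \<in> borel_measurable M" "(\<lambda>\<omega>. G i (\<omega>, X (Suc n) \<omega>)) \<in> borel_measurable M" for i
      using law_integrable(1)[OF Hm Hb] law_integrable(1)[OF Gm G(2)] by auto
  qed (use lim G(2) in auto)
  moreover have "(\<lambda>i. \<integral>\<omega>. Pop (psi n \<omega>) (\<lambda>y. G i (\<omega>, y)) (X n \<omega>) \<partial>M)
      \<longlonglongrightarrow> (\<integral>\<omega>. Pop (psi n \<omega>) (\<lambda>y. H (\<omega>, y)) (X n \<omega>) \<partial>M)"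
  proof (rule integral_dominated_convergence[where w = "\<lambda>_. C"])
    show "(\<lambda>\<omega>. Pop (psi n \<omega>) (\<lambda>y. H (\<omega>, y)) (X n \<omega>)) \<in> borel_measurable M"
      "(\<lambda>\<omega>. Pop (psi n \<omega>) (\<lambda>y. G i (\<omega>, y)) (X n \<omega>)) \<in> borel_measurable M" for i
      using law_integrable(2)[OF Hm Hb] law_integrable(2)[OF Gm G(2)] by auto
    show "AE \<omega> in M. (\<lambda>i. Pop (psi n \<omega>) (\<lambda>y. G i (\<omega>, y)) (X n \<omega>)) \<longlonglongrightarrow> Pop (psi n \<omega>) (\<lambda>y. H (\<omega>, y)) (X n \<omega>)"
      by (intro AE_I2 Pop_dominated[OF psi_good measurable_section[OF Gm] G(2) lim X_in])
    show "AE \<omega> in M. norm (Pop (psi n \<omega>) (\<lambda>y. G i (\<omega>, y)) (X n \<omega>)) \<le> C" for i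
      using law_integrable(3)[OF Gm G(2)] by (intro AE_I2) simp
  qed simp
  ultimately have "(\<integral>\<omega>. H (\<omega>, X (Suc n) \<omega>) \<partial>M) = (\<integral>\<omega>. Pop (psi n \<omega>) (\<lambda>y. H (\<omega>, y)) (X n \<omega>) \<partial>M)"
    unfolding eq by (rule LIMSEQ_unique)
  then show ?thesis unfolding law_ok_def using Hm Hb by blast
qed

text \<open>Measurable rectangles form an intersection-stable generator of the product, and on them
  the claim is \<open>law\<close>, after the indicator of the past is pulled out of
  \<open>Pop\<close>. Complements and disjoint unions are covered by differences and bounded
  limits.\<close>

lemma law_ok_indicator:
  assumes "A \<in> sets (F n \<Otimes>\<^sub>M K)"
  shows "law_ok n (indicator A)"
proof -
  let ?E = "{a \<times> b | a b. a \<in> sets (F n) \<and> b \<in> sets K}"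
  have "A \<in> sigma_sets (space (F n) \<times> space K) ?E" using assms by (simp add: sets_pair_measure)
  from Int_stable_pair_measure_generator pair_measure_closed this
  show ?thesis
  proof (induction A rule: sigma_sets_induct_disjoint)
    case (basic A)
    then obtain a b where ab: "A = a \<times> b" "a \<in> sets (F n)" "b \<in> sets K" by auto
    have am: "a \<in> events" using ab(2) F_sub by (auto simp: subalgebra_def)
    have split: "indicator A (\<omega>, y) = indicator a \<omega> * (indicator b y :: real)" for \<omega> y
      by (auto simp: ab indicator_def)
    have "(\<integral>\<omega>. indicator A (\<omega>, X (Suc n) \<omega>) \<partial>M) = (\<integral>\<omega>. indicator ({\<omega>\<in>space M. X (Suc n) \<omega> \<in> b} \<inter> a) \<omega> \<partial>M :: real)"
      unfolding split by (intro Bochner_Integration.integral_cong) (auto simp: indicator_def)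
    also have "\<dots> = prob ({\<omega>\<in>space M. X (Suc n) \<omega> \<in> b} \<inter> a \<inter> space M)" by simp
    also have "\<dots> = prob ({\<omega>\<in>space M. X (Suc n) \<omega> \<in> b} \<inter> a)" by (intro arg_cong[where f = prob]) auto
    also have "\<dots> = (\<integral>\<omega>. indicator a \<omega> * Pop (psi n \<omega>) (indicator b) (X n \<omega>) \<partial>M)"
      by (rule law[OF ab(3,2)])
    also have "\<dots> = (\<integral>\<omega>. Pop (psi n \<omega>) (\<lambda>y. indicator A (\<omega>, y)) (X n \<omega>) \<partial>M)"
      by (simp only: split Pop_mult)
    finally have "(\<integral>\<omega>. indicator A (\<omega>, X (Suc n) \<omega>) \<partial>M) = (\<integral>\<omega>. Pop (psi n \<omega>) (\<lambda>y. indicator A (\<omega>, y)) (X n \<omega>) \<partial>M)" .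
    moreover have "A \<in> sets (F n \<Otimes>\<^sub>M K)" using ab by auto
    ultimately show ?case unfolding law_ok_def
      by (intro conjI borel_measurable_indicator exI[of _ 1] ballI allI) (simp_all add: indicator_le_1)
  next
    case empty
    show ?case using law_ok_const[of n 0] by (simp add: indicator_def[abs_def])
  next
    case (compl A)
    have "A \<subseteq> space (F n) \<times> space K" using compl(1) by (rule sigma_sets_into_sp[OF pair_measure_closed])
    then have "indicator (space (F n) \<times> space K - A) = (\<lambda>p. indicator (space (F n) \<times> space K) p - indicator A p :: real)"
      by (intro ext) (auto split: split_indicator)
    moreover have "law_ok n (indicator (space (F n) \<times> space K))"
    proof -
      have m: "(indicator (space (F n) \<times> space K) :: _ \<Rightarrow> real) \<in> borel_measurable (F n \<Otimes>\<^sub>M K)"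
        by (intro borel_measurable_indicator) auto
      have 1: "(\<integral>\<omega>. indicator (space (F n) \<times> space K) (\<omega>, X (Suc n) \<omega>) \<partial>M) = (\<integral>\<omega>. 1 \<partial>M :: real)"
        by (intro Bochner_Integration.integral_cong) (auto simp: space_F space_K)
      have 2: "(\<integral>\<omega>. Pop (psi n \<omega>) (\<lambda>y. indicator (space (F n) \<times> space K) (\<omega>, y)) (X n \<omega>) \<partial>M) = (\<integral>\<omega>. 1 \<partial>M)"
        by (intro Bochner_Integration.integral_cong) (auto simp: space_F space_K indicator_def)
      show ?thesis unfolding law_ok_def 1 2
        using m by (intro conjI exI[of _ 1] ballI allI) (simp_all add: indicator_le_1)
    qed
    ultimately show ?case using law_ok_diff[OF _ compl(2)] by simp
  next
    case (union A)
    \<comment> \<open>The sets are disjoint, so at each point at most one indicator is 1 and the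
      partial sums become stationary.\<close>
    have lim: "(\<lambda>i. \<Sum>j<i. indicator (A j) p) \<longlonglongrightarrow> (indicator (\<Union>i. A i) p :: real)" for p :: "'w \<times> 'x"
    proof (cases "\<exists>j. p \<in> A j")
      case True
      then obtain j where j: "p \<in> A j" by blast
      have "p \<notin> A k" if "k \<noteq> j" for k using union(1) j that unfolding disjoint_family_on_def by blast
      then have ind: "indicator (A k) p = (if k = j then 1 else 0 :: real)" for k
        using j by (auto simp: indicator_def)
      have "eventually (\<lambda>i. (\<Sum>k<i. indicator (A k) p) = (indicator (\<Union>i. A i) p :: real)) sequentially"
        using eventually_gt_at_top[of j]
      proof eventually_elim
        case (elim i)
        have "p \<in> (\<Union>i. A i)" using j by blast
        then show ?case using elim unfolding ind by simp
      qed
      then show ?thesis by (rule tendsto_eventually)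
    next
      case False
      then have "(\<lambda>i. \<Sum>j<i. indicator (A j) p) = (\<lambda>_. indicator (\<Union>i. A i) p :: real)"
        by (intro ext) (simp add: indicator_def)
      then show ?thesis by simp
    qed
    show ?case
    proof (rule law_ok_lim[OF _ _ lim])
      show "law_ok n (\<lambda>p. \<Sum>j<i. indicator (A j) p)" for i by (intro law_ok_sum union)
      fix i and \<omega> :: 'w and y :: 'x
      define p where "p = (\<omega>, y)"
      have "(\<Sum>j<i. indicator (A j) p) \<le> (indicator (\<Union>i. A i) p :: real)"
      proof (rule incseq_le[OF _ lim])
        show "incseq (\<lambda>i. \<Sum>j<i. indicator (A j) p :: real)" by (intro incseq_SucI) simp
      qed
      moreover have "(0::real) \<le> (\<Sum>j<i. indicator (A j) p)" by (intro sum_nonneg) simp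
      moreover have "indicator (\<Union>i. A i) p \<le> (1::real)" by (rule indicator_le_1)
      ultimately show "\<bar>\<Sum>j<i. indicator (A j) (\<omega>, y)\<bar> \<le> (1::real)" unfolding p_def by linarith
    qed
  qed
qed

lemma law_ok_nonneg:
  assumes "G \<in> borel_measurable (F n \<Otimes>\<^sub>M K)" "\<And>p. 0 \<le> G p" "\<And>\<omega> y. \<omega> \<in> space M \<Longrightarrow> G (\<omega>, y) \<le> C"
  shows "law_ok n G"
proof -
  \<comment> \<open>The bound is part of the induction statement and is allowed to vary, because
    scaling by \<open>c\<close> divides it.\<close>
  have "(\<forall>\<omega>\<in>space M. \<forall>y. G (\<omega>, y) \<le> C) \<longrightarrow> law_ok n G" for C
    using assms(1,2)
  proof (induction G arbitrary: C rule: borel_measurable_induct_real)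
    case (set A D)
    then show ?case by (intro impI law_ok_indicator)
  next
    case (mult u c D)
    show ?case
    proof (cases "c = 0")
      case False
      show ?thesis
      proof
        assume *: "\<forall>\<omega>\<in>space M. \<forall>y. c * u (\<omega>, y) \<le> D"
        have "\<forall>\<omega>\<in>space M. \<forall>y. u (\<omega>, y) \<le> D / c"
          using * mult.hyps(1) False by (simp add: pos_le_divide_eq mult.commute)
        then show "law_ok n (\<lambda>p. c * u p)" by (rule law_ok_mult[OF mp[OF mult.IH]])
      qed
    qed (simp add: law_ok_const)
  next
    case (add u v D)
    show ?case
    proof
      assume *: "\<forall>\<omega>\<in>space M. \<forall>y. v (\<omega>, y) + u (\<omega>, y) \<le> D"
      have "u (\<omega>, y) \<le> D \<and> v (\<omega>, y) \<le> D" if "\<omega> \<in> space M" for \<omega> y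
        using bspec[OF * that, THEN spec, of y] add.hyps(2)[of "(\<omega>, y)"] add.hyps(4)[of "(\<omega>, y)"] by linarith
      then have "\<forall>\<omega>\<in>space M. \<forall>y. u (\<omega>, y) \<le> D" "\<forall>\<omega>\<in>space M. \<forall>y. v (\<omega>, y) \<le> D" by simp_all
      then show "law_ok n (\<lambda>p. v p + u p)" by (intro law_ok_add mp[OF add.IH(1)] mp[OF add.IH(2)])
    qed
  next
    case (seq U D)
    show ?case
    proof
      assume *: "\<forall>\<omega>\<in>space M. \<forall>y. G (\<omega>, y) \<le> D"
      have lim: "(\<lambda>i. U i (\<omega>, y)) \<longlonglongrightarrow> G (\<omega>, y)" if "\<omega> \<in> space M" for \<omega> y
        using seq.hyps(4)[of "(\<omega>, y)"] that by (simp add: space_pair_measure space_F space_K)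
      have le: "U i (\<omega>, y) \<le> D" if \<omega>: "\<omega> \<in> space M" for i \<omega> y
      proof (rule order_trans[OF incseq_le[OF _ lim[OF \<omega>]]])
        show "incseq (\<lambda>i. U i (\<omega>, y))" using seq.hyps(3) by (auto simp: incseq_def le_fun_def)
      qed (use * \<omega> in blast)
      show "law_ok n G"
      proof (rule law_ok_lim[where G = U and C = D])
        show "\<omega> \<in> space M \<Longrightarrow> (\<lambda>i. U i (\<omega>, y)) \<longlonglongrightarrow> G (\<omega>, y)" for \<omega> y by (rule lim)
        show "law_ok n (U i)" for i
          by (rule mp[OF seq.IH[of i D]]) (intro ballI allI le)
        show "\<bar>U i (\<omega>, y)\<bar> \<le> D" if "\<omega> \<in> space M" for i \<omega> y
          using le[OF that, of i y] seq.hyps(2)[of i "(\<omega>, y)"] by simp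
      qed
    qed
  qed
  from mp[OF this[of C]] show ?thesis using assms(3) by blast
qed

text \<open>The bound is known on \<open>Xs\<close> only, so \<open>G\<close> is clamped between
  \<open>- C\<close> and \<open>C\<close>, which neither side notices because the chain stays in
  \<open>Xs\<close>, and then shifted by \<open>C\<close> to become nonnegative.\<close>

lemma law_fun:
  assumes G: "G \<in> borel_measurable (F n \<Otimes>\<^sub>M K)" "\<And>\<omega> x. \<omega> \<in> space M \<Longrightarrow> x \<in> Xs \<Longrightarrow> \<bar>G (\<omega>, x)\<bar> \<le> C"
  shows "(\<integral>\<omega>. G (\<omega>, X (Suc n) \<omega>) \<partial>M) = (\<integral>\<omega>. Pop (psi n \<omega>) (\<lambda>y. G (\<omega>, y)) (X n \<omega>) \<partial>M)"
proof -
  define H where "H p = max (- C) (min C (G p))" for p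
  obtain \<omega>0 where \<omega>0: "\<omega>0 \<in> space M" using not_empty by blast
  have C0: "0 \<le> C" using G(2)[OF \<omega>0 x0] by linarith
  have eq: "H (\<omega>, x) = G (\<omega>, x)" if "\<omega> \<in> space M" "x \<in> Xs" for \<omega> x
    using G(2)[OF that] unfolding H_def by linarith
  have "law_ok n (\<lambda>p. H p + C)"
  proof (rule law_ok_nonneg)
    show "(\<lambda>p. H p + C) \<in> borel_measurable (F n \<Otimes>\<^sub>M K)" unfolding H_def using G(1) by measurable
    show "0 \<le> H p + C" for p unfolding H_def by linarith
    show "H (\<omega>, y) + C \<le> 2 * C" for \<omega> y unfolding H_def using C0 by linarith
  qed
  from law_ok_diff[OF this law_ok_const[of n C]] have "law_ok n H" by simp
  then have "(\<integral>\<omega>. H (\<omega>, X (Suc n) \<omega>) \<partial>M) = (\<integral>\<omega>. Pop (psi n \<omega>) (\<lambda>y. H (\<omega>, y)) (X n \<omega>) \<partial>M)"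
    unfolding law_ok_def by blast
  moreover have "(\<integral>\<omega>. H (\<omega>, X (Suc n) \<omega>) \<partial>M) = (\<integral>\<omega>. G (\<omega>, X (Suc n) \<omega>) \<partial>M)"
    by (intro Bochner_Integration.integral_cong refl eq X_in)
  moreover have "(\<integral>\<omega>. Pop (psi n \<omega>) (\<lambda>y. H (\<omega>, y)) (X n \<omega>) \<partial>M) = (\<integral>\<omega>. Pop (psi n \<omega>) (\<lambda>y. G (\<omega>, y)) (X n \<omega>) \<partial>M)"
    by (intro Bochner_Integration.integral_cong refl Pop_cong eq X_in)
  ultimately show ?thesis by simp
qed

text \<open>With the Poisson solutions \<open>u n\<close>, each centred term splits into a
  martingale difference \<open>D n\<close>, a telescoping term \<open>c n - c (Suc n)\<close> and
  the effect \<open>e n\<close> of replacing the kernel and function of time \<open>n\<close> by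
  those of time \<open>n + 1\<close>. The weighted sums converge by martingale convergence, by
  summation by parts and by comparison with \<open>L\<close>.\<close>

lemma noise_summable:
  assumes f: "\<And>n. (\<lambda>(\<omega>, x). f n \<omega> x) \<in> borel_measurable (F n \<Otimes>\<^sub>M K)"
      "\<And>n \<omega> x. \<omega> \<in> space M \<Longrightarrow> x \<in> Xs \<Longrightarrow> \<bar>f n \<omega> x\<bar> \<le> C"
    and \<beta>: "\<And>n. \<beta> n \<in> borel_measurable (F n)" "\<And>n \<omega>. \<omega> \<in> space M \<Longrightarrow> 0 \<le> \<beta> n \<omega>"
      "\<And>\<omega>. \<omega> \<in> space M \<Longrightarrow> decseq (\<lambda>n. \<beta> n \<omega>)" "\<And>\<omega>. \<omega> \<in> space M \<Longrightarrow> summable (\<lambda>n. (\<beta> n \<omega>)\<^sup>2)"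
    and L: "\<And>n \<omega> x. \<omega> \<in> space M \<Longrightarrow> x \<in> Xs \<Longrightarrow> \<bar>ln (psi (Suc n) \<omega> x) - ln (psi n \<omega> x)\<bar> \<le> L n \<omega>"
      "\<And>n \<omega> x. \<omega> \<in> space M \<Longrightarrow> x \<in> Xs \<Longrightarrow> \<bar>f (Suc n) \<omega> x - f n \<omega> x\<bar> \<le> E * L n \<omega>"
      "\<And>\<omega>. \<omega> \<in> space M \<Longrightarrow> summable (\<lambda>n. \<beta> n \<omega> * L n \<omega>)"
  shows "AE \<omega> in M. summable (\<lambda>n. \<beta> n \<omega> * (f n \<omega> (X (Suc n) \<omega>) - pim (psi n \<omega>) (f n \<omega>)))"
proof -
  define u where "u n \<omega> = pois (psi n \<omega>) (f n \<omega>) x0" for n \<omega>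
  define D where "D n \<omega> = u n \<omega> (X (Suc n) \<omega>) - Pop (psi n \<omega>) (u n \<omega>) (X n \<omega>)" for n \<omega>
  have um: "(\<lambda>p. u n (fst p) (snd p)) \<in> borel_measurable (F n \<Otimes>\<^sub>M K)" for n
    using measurable_pois_param[OF psi_meas f(1), of n x0] by (simp add: u_def split_beta')
  have fm: "f n \<omega> \<in> borel_measurable K" if "\<omega> \<in> space M" for n \<omega>
    using measurable_section[OF f(1) that, of n] by simp
  have um1: "u n \<omega> \<in> borel_measurable K" if "\<omega> \<in> space M" for n \<omega>
    unfolding u_def by (rule measurable_pois[OF psi_good[OF that] fm[OF that]])
  have ub: "\<bar>u n \<omega> x\<bar> \<le> 2 * C / \<delta>" if "\<omega> \<in> space M" "x \<in> Xs" for n \<omega> x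
    unfolding u_def by (rule pois_abs_le[OF psi_good[OF that(1)] fm[OF that(1)] f(2)[OF that(1)] that(2) x0])
  have Pub: "\<bar>Pop (psi n \<omega>) (u n \<omega>) x\<bar> \<le> 2 * C / \<delta>" if "\<omega> \<in> space M" "x \<in> Xs" for n \<omega> x
    by (rule Pop_abs_le[OF psi_good[OF that(1)] um1[OF that(1)] ub[OF that(1)] that(2)])
  have Db: "\<bar>D n \<omega>\<bar> \<le> 4 * C / \<delta>" if "\<omega> \<in> space M" for n \<omega>
    using ub[OF that X_in[OF that], of n "Suc n"] Pub[OF that X_in[OF that], of n n] unfolding D_def by linarith
  have u1: "(\<lambda>\<omega>. u n \<omega> (X (Suc n) \<omega>)) \<in> borel_measurable (F (Suc n))" for n
    using measurable_eval[OF um, of n "Suc n"] by simp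
  have u2: "(\<lambda>\<omega>. Pop (psi n \<omega>) (u n \<omega>) (X n \<omega>)) \<in> borel_measurable (F n)" for n
    using measurable_Pop_eval[OF um, of n] by simp
  have "mdiff D"
    unfolding mdiff_def
  proof (intro conjI allI impI)
    fix n
    show "D n \<in> borel_measurable (F (Suc n))"
      unfolding D_def using u1[of n] measurable_F_mono[OF u2, of n "Suc n"] by measurable
    show "\<exists>C. \<forall>\<omega>\<in>space M. \<bar>D n \<omega>\<bar> \<le> C" using Db by blast
  next
    fix n and b :: "'w \<Rightarrow> real" and B' assume b: "b \<in> borel_measurable (F n)" "\<forall>\<omega>\<in>space M. \<bar>b \<omega>\<bar> \<le> B'"
    have bound: "\<bar>b \<omega> * t\<bar> \<le> B' * (2 * C / \<delta>)" if "\<omega> \<in> space M" "\<bar>t\<bar> \<le> 2 * C / \<delta>" for \<omega> t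
      unfolding abs_mult using b(2) that by (intro mult_mono) (auto intro: order_trans[OF abs_ge_zero])
    have eq: "(\<integral>\<omega>. b \<omega> * u n \<omega> (X (Suc n) \<omega>) \<partial>M) = (\<integral>\<omega>. b \<omega> * Pop (psi n \<omega>) (u n \<omega>) (X n \<omega>) \<partial>M)"
    proof -
      have "(\<lambda>p. b (fst p) * u n (fst p) (snd p)) \<in> borel_measurable (F n \<Otimes>\<^sub>M K)"
        using um[of n] b(1) by measurable
      from law_fun[OF this, of "B' * (2 * C / \<delta>)"] bound ub show ?thesis by (simp add: Pop_mult)
    qed
    have i1: "integrable M (\<lambda>\<omega>. b \<omega> * u n \<omega> (X (Suc n) \<omega>))"
    proof (rule integrable_bounded[OF _ bound])
      show "(\<lambda>\<omega>. b \<omega> * u n \<omega> (X (Suc n) \<omega>)) \<in> borel_measurable M"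
        using measurable_F[OF b(1)] measurable_F[OF u1] by measurable
    qed (auto intro: ub X_in)
    have i2: "integrable M (\<lambda>\<omega>. b \<omega> * Pop (psi n \<omega>) (u n \<omega>) (X n \<omega>))"
    proof (rule integrable_bounded[OF _ bound])
      show "(\<lambda>\<omega>. b \<omega> * Pop (psi n \<omega>) (u n \<omega>) (X n \<omega>)) \<in> borel_measurable M"
        using measurable_F[OF b(1)] measurable_F[OF u2] by measurable
    qed (auto intro: Pub X_in)
    show "(\<integral>\<omega>. b \<omega> * D n \<omega> \<partial>M) = 0"
      unfolding D_def right_diff_distrib using i1 i2 eq by simp
  qed
  then have "AE \<omega> in M. summable (\<lambda>n. \<beta> n \<omega> * D n \<omega>)"
    by (rule mdiff_weighted_convergent[OF _ Db \<beta>(1,4)])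
  then show ?thesis
  proof (rule AE_mp, intro AE_I2 impI)
    fix \<omega> assume \<omega>: "\<omega> \<in> space M" and D: "summable (\<lambda>n. \<beta> n \<omega> * D n \<omega>)"
    define c where "c n = Pop (psi n \<omega>) (u n \<omega>) (X n \<omega>)" for n
    define e where "e n = c (Suc n) - Pop (psi n \<omega>) (u n \<omega>) (X (Suc n) \<omega>)" for n
    have C0: "0 \<le> C" using f(2)[OF \<omega> x0] by (rule order_trans[OF abs_ge_zero])
    have "f n \<omega> (X (Suc n) \<omega>) - pim (psi n \<omega>) (f n \<omega>) = D n \<omega> + (c n - c (Suc n)) + e n" for n
      using Pop_pois[OF psi_good[OF \<omega>] fm[OF \<omega>] f(2)[OF \<omega>] X_in[OF \<omega>] x0, of n n "Suc n"]
      unfolding D_def c_def e_def u_def by linarith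
    then have eq: "\<beta> n \<omega> * (f n \<omega> (X (Suc n) \<omega>) - pim (psi n \<omega>) (f n \<omega>))
        = \<beta> n \<omega> * D n \<omega> + \<beta> n \<omega> * (c n - c (Suc n)) + \<beta> n \<omega> * e n" for n
      by (simp only: distrib_left)
    have s2: "summable (\<lambda>n. \<beta> n \<omega> * (c n - c (Suc n)))"
    proof (rule summable_abel[OF \<beta>(3)[OF \<omega>] \<beta>(2)[OF \<omega>]])
      have "(\<lambda>n. sqrt ((\<beta> n \<omega>)\<^sup>2)) \<longlonglongrightarrow> sqrt 0"
        by (intro tendsto_real_sqrt summable_LIMSEQ_zero \<beta>(4) \<omega>)
      then show "(\<lambda>n. \<beta> n \<omega>) \<longlonglongrightarrow> 0" using \<beta>(2)[OF \<omega>] by simp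
      show "\<bar>c n\<bar> \<le> 2 * C / \<delta>" for n unfolding c_def by (rule Pub[OF \<omega> X_in[OF \<omega>]])
    qed
    have s3: "summable (\<lambda>n. \<beta> n \<omega> * e n)"
    proof (rule summable_comparison_test')
      show "summable (\<lambda>n. (2 * E + 12 * C / \<delta>) / \<delta> * (\<beta> n \<omega> * L n \<omega>))" by (intro summable_mult L(3) \<omega>)
      fix n
      have "\<bar>e n\<bar> \<le> (2 * (E * L n \<omega>) + 12 * L n \<omega> * C / \<delta>) / \<delta>"
        unfolding e_def c_def u_def
        by (rule pois_lipschitz[OF psi_good[OF \<omega>] psi_good[OF \<omega>] L(1)[OF \<omega>] fm[OF \<omega>] f(2)[OF \<omega>]
              fm[OF \<omega>] f(2)[OF \<omega>] L(2)[OF \<omega>] x0 X_in[OF \<omega>]])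
      also have "\<dots> = (2 * E + 12 * C / \<delta>) / \<delta> * L n \<omega>"
        by (simp add: add_divide_distrib distrib_left mult.commute mult.left_commute)
      finally have "\<beta> n \<omega> * \<bar>e n\<bar> \<le> \<beta> n \<omega> * ((2 * E + 12 * C / \<delta>) / \<delta> * L n \<omega>)"
        by (intro mult_left_mono \<beta>(2) \<omega>)
      then show "norm (\<beta> n \<omega> * e n) \<le> (2 * E + 12 * C / \<delta>) / \<delta> * (\<beta> n \<omega> * L n \<omega>)"
        using \<beta>(2)[OF \<omega>, of n] by (simp only: real_norm_def abs_mult abs_of_nonneg mult.left_commute)
    qed
    show "summable (\<lambda>n. \<beta> n \<omega> * (f n \<omega> (X (Suc n) \<omega>) - pim (psi n \<omega>) (f n \<omega>)))"
      unfolding eq by (intro summable_add D s2 s3)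
  qed
qed

text \<open>Fixing the limiting kernel and iterating it \<open>k\<close> times costs nothing in the limit of \<open>n\<close>,
  and leaves a function that is nearly constant.\<close>
lemma expectation_limit:
  assumes w: "good w" and f: "f \<in> borel_measurable K" "\<And>x. x \<in> Xs \<Longrightarrow> \<bar>f x\<bar> \<le> C"
    and L: "\<And>n \<omega> x. \<omega> \<in> space M \<Longrightarrow> x \<in> Xs \<Longrightarrow> \<bar>ln (psi n \<omega> x) - ln (w x)\<bar> \<le> L n \<omega>"
      "AE \<omega> in M. (\<lambda>n. L n \<omega>) \<longlonglongrightarrow> 0"
  shows "(\<lambda>n. \<integral>\<omega>. f (X n \<omega>) \<partial>M) \<longlonglongrightarrow> pim w f"
proof -
  define e where "e k n = (\<integral>\<omega>. iter w f k (X n \<omega>) \<partial>M)" for k n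
  have im: "iter w f k \<in> borel_measurable K" for k by (rule measurable_iter[OF w f(1)])
  have ib: "\<bar>iter w f k x\<bar> \<le> C" if "x \<in> Xs" for k x by (rule iter_abs_le[OF w f that])
  have eval: "(\<lambda>\<omega>. h (X n \<omega>)) \<in> borel_measurable M" if "h \<in> borel_measurable K" for h :: "'x \<Rightarrow> real" and n
    by (rule measurable_compose[OF measurable_F[OF X_meas] that])
  have iterm: "(\<lambda>p. iter w f k (snd p)) \<in> borel_measurable (F n \<Otimes>\<^sub>M K)" for k n
    by (rule measurable_compose[OF measurable_snd im])
  have Pm: "(\<lambda>\<omega>. Pop (psi n \<omega>) (iter w f k) (X n \<omega>)) \<in> borel_measurable M" for k n
    using measurable_F[OF measurable_Pop_eval[OF iterm]] by simp
  have Pb: "\<bar>Pop (psi n \<omega>) (iter w f k) (X n \<omega>)\<bar> \<le> C" if "\<omega> \<in> space M" for n k \<omega>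
    by (rule Pop_abs_le[OF psi_good[OF that] im ib X_in[OF that]])
  \<comment> \<open>One time step of the chain is exchanged for one application of the limiting
    kernel. By the transition rule the error is the mean of
    \<open>Pop (psi n \<omega>) h - Pop w h\<close> at \<open>X n\<close>, where \<open>h\<close> is
    the \<open>k\<close>-th iterate, and the kernels converge.\<close>
  have step: "(\<lambda>n. e k (Suc n) - e (Suc k) n) \<longlonglongrightarrow> 0" for k
  proof -
    have eq: "e k (Suc n) - e (Suc k) n = (\<integral>\<omega>. Pop (psi n \<omega>) (iter w f k) (X n \<omega>) - Pop w (iter w f k) (X n \<omega>) \<partial>M)" for n
    proof -
      have "e k (Suc n) = (\<integral>\<omega>. Pop (psi n \<omega>) (iter w f k) (X n \<omega>) \<partial>M)"
        unfolding e_def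
      proof (rule law_fun[where G = "\<lambda>p. iter w f k (snd p)" and C = C, unfolded snd_conv])
        show "\<bar>iter w f k x\<bar> \<le> C" if "x \<in> Xs" for x by (rule ib[OF that])
      qed (rule iterm)
      moreover have "integrable M (\<lambda>\<omega>. Pop (psi n \<omega>) (iter w f k) (X n \<omega>))"
        by (rule integrable_bounded[OF Pm Pb])
      moreover have "integrable M (\<lambda>\<omega>. Pop w (iter w f k) (X n \<omega>))"
        unfolding iter_Suc[symmetric] by (rule integrable_bounded[OF eval[OF im] ib[OF X_in]])
      ultimately show ?thesis
        unfolding e_def[of "Suc k"] iter_Suc by (subst Bochner_Integration.integral_diff) simp_all
    qed
    have "(\<lambda>n. \<integral>\<omega>. Pop (psi n \<omega>) (iter w f k) (X n \<omega>) - Pop w (iter w f k) (X n \<omega>) \<partial>M)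
        \<longlonglongrightarrow> (\<integral>\<omega>. 0 \<partial>M)"
    proof (rule integral_dominated_convergence[where w = "\<lambda>_. 2 * C"])
      show "(\<lambda>\<omega>. Pop (psi n \<omega>) (iter w f k) (X n \<omega>) - Pop w (iter w f k) (X n \<omega>)) \<in> borel_measurable M" for n
        by (rule borel_measurable_diff[OF Pm eval[OF im[of "Suc k", unfolded iter_Suc]]])
      show "AE \<omega> in M. (\<lambda>n. Pop (psi n \<omega>) (iter w f k) (X n \<omega>) - Pop w (iter w f k) (X n \<omega>)) \<longlonglongrightarrow> 0"
        using L(2)
      proof (rule AE_mp, intro AE_I2 impI)
        fix \<omega> assume \<omega>: "\<omega> \<in> space M" and lim: "(\<lambda>n. L n \<omega>) \<longlonglongrightarrow> 0"
        have osc: "\<bar>iter w f k y - iter w f k z\<bar> \<le> 2 * C" if "y \<in> Xs" "z \<in> Xs" for y z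
          using ib[OF that(1), of k] ib[OF that(2), of k] by linarith
        have le: "\<bar>Pop (psi n \<omega>) (iter w f k) (X n \<omega>) - Pop w (iter w f k) (X n \<omega>)\<bar> \<le> 2 * L n \<omega> * (2 * C)" for n
          by (rule Pop_lipschitz[OF w psi_good[OF \<omega>] L(1)[OF \<omega>] im[of k] ib[of _ k] osc X_in[OF \<omega>]])
        have "(\<lambda>n. 2 * L n \<omega> * (2 * C)) \<longlonglongrightarrow> 0"
          using tendsto_mult[OF tendsto_mult[OF tendsto_const[of 2] lim] tendsto_const[of "2 * C"]] by simp
        then show "(\<lambda>n. Pop (psi n \<omega>) (iter w f k) (X n \<omega>) - Pop w (iter w f k) (X n \<omega>)) \<longlonglongrightarrow> 0"
          by (rule Lim_null_comparison[OF always_eventually, rotated]) (simp only: real_norm_def le simp_thms)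
      qed
      show "AE \<omega> in M. norm (Pop (psi n \<omega>) (iter w f k) (X n \<omega>) - Pop w (iter w f k) (X n \<omega>)) \<le> 2 * C" for n
      proof (rule AE_I2)
        fix \<omega> assume \<omega>: "\<omega> \<in> space M"
        show "norm (Pop (psi n \<omega>) (iter w f k) (X n \<omega>) - Pop w (iter w f k) (X n \<omega>)) \<le> 2 * C"
          using Pb[OF \<omega>, of n k] ib[OF X_in[OF \<omega>, of n], of "Suc k"] unfolding iter_Suc real_norm_def by linarith
      qed
    qed simp_all
    then show ?thesis by (simp only: eq integral_zero)
  qed
  have shift: "(\<lambda>n. e 0 (n + k) - e k n) \<longlonglongrightarrow> 0" for k
  proof (induction k)
    case (Suc k)
    have "(\<lambda>n. (e 0 (Suc n + k) - e k (Suc n)) + (e k (Suc n) - e (Suc k) n)) \<longlonglongrightarrow> 0 + 0"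
      by (intro tendsto_add step LIMSEQ_Suc[OF Suc])
    then show ?case by simp
  qed simp
  have near: "\<bar>e k n - pim w f\<bar> \<le> (1 - \<delta>) ^ k * (2 * C)" for k n
  proof -
    have i: "integrable M (\<lambda>\<omega>. iter w f k (X n \<omega>))"
      by (rule integrable_bounded[OF eval[OF im] ib[OF X_in]])
    then have "e k n - pim w f = (\<integral>\<omega>. iter w f k (X n \<omega>) - pim w f \<partial>M)"
      unfolding e_def by (simp add: prob_space)
    also have "\<bar>\<dots>\<bar> \<le> (\<integral>\<omega>. (1 - \<delta>) ^ k * (2 * C) \<partial>M)"
    proof (rule order_trans[OF integral_abs_bound integral_mono])
      show "\<bar>iter w f k (X n \<omega>) - pim w f\<bar> \<le> (1 - \<delta>) ^ k * (2 * C)" if "\<omega> \<in> space M" for \<omega>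
        by (rule iter_pim[OF w f X_in[OF that]])
    qed (use i in auto)
    finally show ?thesis by (simp add: prob_space)
  qed
  have "(\<lambda>n. e 0 n) \<longlonglongrightarrow> pim w f"
  proof (rule LIMSEQ_I)
    fix r :: real assume r: "0 < r"
    \<comment> \<open>The order of choice matters: \<open>k\<close> comes first, since the mixing
      error is small uniformly in \<open>n\<close>, and \<open>N\<close> afterwards.\<close>
    have "(\<lambda>k. (1 - \<delta>) ^ k * (2 * C)) \<longlonglongrightarrow> 0 * (2 * C)"
      using \<delta> by (intro tendsto_mult tendsto_const LIMSEQ_power_zero) auto
    then have "eventually (\<lambda>k. (1 - \<delta>) ^ k * (2 * C) < r / 2) sequentially"
      using r by (intro order_tendstoD(2)[where a = "r / 2"]) auto
    then obtain k where k: "(1 - \<delta>) ^ k * (2 * C) < r / 2" by (auto simp: eventually_sequentially)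
    obtain N where N: "\<And>n. N \<le> n \<Longrightarrow> \<bar>e 0 (n + k) - e k n\<bar> < r / 2"
      using LIMSEQ_D[OF shift[of k], of "r / 2"] r by auto
    have "\<bar>e 0 n - pim w f\<bar> < r" if "N + k \<le> n" for n
    proof -
      define m where "m = n - k"
      have m: "n = m + k" "N \<le> m" using that by (simp_all add: m_def)
      show ?thesis using N[OF m(2)] near[of k m] k unfolding m(1) by linarith
    qed
    then show "\<exists>no. \<forall>n\<ge>no. norm (e 0 n - pim w f) < r" by auto
  qed
  then show ?thesis by (simp add: e_def)
qed

end

section \<open>The SHUS algorithm\<close>

locale shus = rho_function rho Rb c5 + prob_space M
  for rho :: "real \<Rightarrow> real" and Rb c5 :: real and M :: "'w measure" +
  fixes lam :: "'x::euclidean_space measure" and Xs :: "'x set" and dens :: "'x \<Rightarrow> real"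
    and d :: nat and Xi :: "nat \<Rightarrow> 'x set" and q :: "'x \<Rightarrow> 'x \<Rightarrow> real"
    and \<alpha> \<gamma> \<mu> B qmin :: real
    and \<theta>t :: "nat \<Rightarrow> 'w \<Rightarrow> nat \<Rightarrow> real" and X :: "nat \<Rightarrow> 'w \<Rightarrow> 'x"
  assumes lam_sets: "sets lam = sets borel"
    and Xs_meas: "Xs \<in> sets lam"
    and d_ge: "2 \<le> d"
    and Xi_meas: "\<And>i. i < d \<Longrightarrow> Xi i \<in> sets lam"
    and Xi_disj: "disjoint_family_on Xi {..<d}"
    and Xi_cover: "(\<Union>i<d. Xi i) = Xs"
    and pi_meas: "dens \<in> borel_measurable lam"
    and pi_nonneg: "\<And>x. x \<in> Xs \<Longrightarrow> 0 \<le> dens x"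
    and pi_int: "set_integrable lam Xs dens"
    and pi_prob: "(LINT x:Xs|lam. dens x) = 1"
    and B_pos: "0 < B" and pi_le: "\<And>x. x \<in> Xs \<Longrightarrow> dens x \<le> B"
    and A1_pos: "\<And>i. i < d \<Longrightarrow> 0 < theta_star lam dens Xi i"
    and q_meas: "(\<lambda>(x, y). q x y) \<in> borel_measurable (lam \<Otimes>\<^sub>M lam)"
    and q_prob: "\<And>x. x \<in> Xs \<Longrightarrow> set_integrable lam Xs (q x)" "\<And>x. x \<in> Xs \<Longrightarrow> (LINT y:Xs|lam. q x y) = 1"
    and q_sym: "\<And>x y. x \<in> Xs \<Longrightarrow> y \<in> Xs \<Longrightarrow> q x y = q y x"
    and qmin_pos: "0 < qmin" and q_ge: "\<And>x y. x \<in> Xs \<Longrightarrow> y \<in> Xs \<Longrightarrow> qmin \<le> q x y"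
    and rho_meas: "set_borel_measurable borel {0<..<1} rho"
    and \<alpha>: "1/2 < \<alpha>" "\<alpha> \<le> 1" and \<gamma>: "0 < \<gamma>" and \<mu>: "0 < \<mu>"
    and init_meas: "\<And>i. i < d \<Longrightarrow> (\<lambda>\<omega>. \<theta>t 0 \<omega> i) \<in> borel_measurable M"
    and init_pos: "\<And>\<omega> i. \<omega> \<in> space M \<Longrightarrow> i < d \<Longrightarrow> 0 < \<theta>t 0 \<omega> i"
    and X_meas: "\<And>n. X n \<in> borel_measurable M"
    and X_in: "\<And>n \<omega>. \<omega> \<in> space M \<Longrightarrow> X n \<omega> \<in> Xs"
    and X_law: "\<And>n A H. A \<in> sets lam \<Longrightarrow> H \<in> hist_sigma M d \<theta>t X n \<Longrightarrow>
                  measure M ({\<omega>\<in>space M. X (Suc n) \<omega> \<in> A} \<inter> H)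
                  = (\<integral>\<omega>. indicator H \<omega> *
                       P_rho lam Xs q dens Xi d rho (normalize_theta d (\<theta>t n \<omega>)) (X n \<omega>) A \<partial>M)"
    and update: "\<And>n \<omega> i. \<omega> \<in> space M \<Longrightarrow> i < d \<Longrightarrow>
                  \<theta>t (Suc n) \<omega> i = \<theta>t n \<omega> i
                    + \<gamma> / g_fun \<alpha> \<mu> (S_of d (\<theta>t n \<omega>)) * S_of d (\<theta>t n \<omega>)
                      * rho (normalize_theta d (\<theta>t n \<omega>) i) * indicator (Xi i) (X (Suc n) \<omega>)"
begin

abbreviation "ts \<equiv> theta_star lam dens Xi"

text \<open>The hypotheses control \<open>dens\<close> and \<open>q\<close> on \<open>Xs\<close>
  alone, so the reference measure is restricted to \<open>Xs\<close> and both functions are cut off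
  outside.\<close>

definition K :: "'x measure" where "K = density lam (\<lambda>x. ennreal (indicator Xs x))"
definition dens' :: "'x \<Rightarrow> real" where "dens' x = indicator Xs x * dens x"
definition q' :: "'x \<Rightarrow> 'x \<Rightarrow> real" where "q' x y = indicator Xs x * indicator Xs y * q x y"
definition tmin :: real where "tmin = Min (ts ` {..<d})"
text \<open>The common minorization mass. The stratum of least weight contributes at least
  \<open>tmin\<close>, the proposal and the density bound give \<open>qmin / B\<close>, and the
  minimum with 1 keeps the contraction factor \<open>1 - dl\<close> nonnegative.\<close>

definition dl :: real where "dl = min 1 (qmin * tmin / B)"
definition x0 :: 'x where "x0 = (SOME x. x \<in> Xs)"
definition idx :: "'x \<Rightarrow> nat" where "idx x = (SOME i. i < d \<and> x \<in> Xi i)"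
text \<open>The last summand keeps the weight positive outside \<open>Xs\<close>, where no stratum
  contributes: \<open>good\<close> asks for positivity everywhere.\<close>

definition wt :: "(nat \<Rightarrow> real) \<Rightarrow> 'x \<Rightarrow> real" where
  "wt r x = (\<Sum>i<d. r i * indicator (Xi i) x) + indicator (- Xs) x"

section \<open>Restriction to the state space and its strata\<close>

lemma sets_K: "sets K = sets lam" "sets K = sets borel"
  by (simp_all add: K_def lam_sets)

lemma space_lam: "space lam = UNIV" and space_K: "space K = UNIV"
  using sets_eq_imp_space_eq[OF lam_sets] sets_eq_imp_space_eq[OF sets_K(2)] by simp_all

lemma measurable_K: "f \<in> borel_measurable lam \<longleftrightarrow> f \<in> borel_measurable K"
  by (intro iffI; simp add: measurable_cong_sets[OF sets_K(1) refl])

lemma integral_K: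
  fixes f :: "'x \<Rightarrow> real"
  assumes "f \<in> borel_measurable lam"
  shows "(\<integral>x. f x \<partial>K) = (LINT x:Xs|lam. f x)"
  unfolding K_def set_lebesgue_integral_def
  using assms Xs_meas by (subst integral_density) auto

lemma integrable_K:
  fixes f :: "'x \<Rightarrow> real"
  assumes "f \<in> borel_measurable lam"
  shows "integrable K f \<longleftrightarrow> set_integrable lam Xs f"
  unfolding K_def set_integrable_def
  using assms Xs_meas by (subst integrable_density) auto

lemma idx: assumes "x \<in> Xs" shows "idx x < d" "x \<in> Xi (idx x)"
proof -
  have "\<exists>i. i < d \<and> x \<in> Xi i" using assms unfolding Xi_cover[symmetric] by auto
  then have "idx x < d \<and> x \<in> Xi (idx x)" unfolding idx_def by (rule someI_ex)
  then show "idx x < d" "x \<in> Xi (idx x)" by simp_all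
qed

lemma idx_unique: assumes "x \<in> Xi i" "i < d" shows "i = idx x"
proof (rule ccontr)
  have x: "x \<in> Xs" using assms unfolding Xi_cover[symmetric] by auto
  assume ne: "i \<noteq> idx x"
  have "Xi i \<inter> Xi (idx x) = {}"
    by (rule disjoint_family_onD[OF Xi_disj _ _ ne]) (simp_all add: assms idx(1)[OF x])
  with assms(1) idx(2)[OF x] show False by blast
qed

lemma indicator_Xi: "x \<in> Xs \<Longrightarrow> i < d \<Longrightarrow> indicator (Xi i) x = (if i = idx x then 1 else 0 :: real)"
proof (cases "i = idx x")
  case True
  assume "x \<in> Xs"
  then show ?thesis using idx(2)[of x] True by simp
next
  case False
  assume "i < d"
  then have "x \<notin> Xi i" using idx_unique[of x i] False by blast
  then show ?thesis using False by simp
qed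

lemma sum_strata: "x \<in> Xs \<Longrightarrow> (\<Sum>i<d. r i * indicator (Xi i) x) = (r (idx x) :: real)"
proof -
  assume x: "x \<in> Xs"
  have "(\<Sum>i<d. r i * indicator (Xi i) x) = (\<Sum>i<d. if i = idx x then r i else 0)"
    by (intro sum.cong) (simp_all add: indicator_Xi[OF x] del: mult_eq_0_iff)
  then show ?thesis using idx(1)[OF x] by simp
qed

lemma wt_eq: "x \<in> Xs \<Longrightarrow> wt r x = r (idx x)"
  unfolding wt_def using sum_strata[of x r] by simp

lemma wt_pos: assumes "\<And>i. i < d \<Longrightarrow> 0 < r i" shows "0 < wt r x"
proof (cases "x \<in> Xs")
  case True
  then show ?thesis using assms idx by (simp add: wt_eq)
next
  case False
  have "0 \<le> (\<Sum>i<d. r i * indicator (Xi i) x)" using assms by (intro sum_nonneg) (simp add: less_imp_le)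
  then show ?thesis using False by (simp add: wt_def)
qed

lemma Xi_sets: "i < d \<Longrightarrow> Xi i \<in> sets K" and Xs_sets: "Xs \<in> sets K"
  using Xi_meas Xs_meas by (simp_all add: sets_K(1))

lemma wt_meas: "wt r \<in> borel_measurable K"
proof -
  have "- Xs \<in> sets K"
    using sets.compl_sets[OF Xs_sets] by (simp only: space_K Compl_eq_Diff_UNIV)
  then show ?thesis
    unfolding wt_def
    by (intro borel_measurable_add borel_measurable_sum borel_measurable_times borel_measurable_const
        borel_measurable_indicator) (simp_all add: Xi_sets)
qed

lemma Xs_ne: "Xs \<noteq> {}"
  using pi_prob by (auto simp: set_lebesgue_integral_def)

lemma x0: "x0 \<in> Xs"
  unfolding x0_def some_in_eq by (rule Xs_ne)

lemma dens'_meas: "dens' \<in> borel_measurable K"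
  unfolding dens'_def using pi_meas Xs_sets by (simp add: measurable_K)

lemma dens'_integral: "h \<in> borel_measurable K \<Longrightarrow> (\<integral>x. dens' x * h x \<partial>K) = (LINT x:Xs|lam. h x * dens x)"
proof -
  assume h: "h \<in> borel_measurable K"
  have "(\<integral>x. dens' x * h x \<partial>K) = (LINT x:Xs|lam. dens' x * h x)"
    using dens'_meas h by (intro integral_K) (simp add: measurable_K)
  also have "\<dots> = (LINT x:Xs|lam. h x * dens x)"
    unfolding set_lebesgue_integral_def
    by (intro Bochner_Integration.integral_cong) (auto simp: dens'_def indicator_def)
  finally show ?thesis .
qed

text \<open>\<open>q x0\<close> integrates to 1 over \<open>Xs\<close> and is at least
  \<open>qmin\<close> there, so \<open>Xs\<close> has finite measure.\<close>

lemma finite_K: "finite_measure K"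
proof
  have "integrable lam (\<lambda>y. qmin * indicator Xs y)"
  proof (rule Bochner_Integration.integrable_bound)
    show "integrable lam (\<lambda>y. indicator Xs y *\<^sub>R q x0 y)"
      using q_prob(1)[OF x0] by (simp add: set_integrable_def)
    show "(\<lambda>y. qmin * indicator Xs y) \<in> borel_measurable lam" using Xs_meas by measurable
    show "AE y in lam. norm (qmin * indicator Xs y) \<le> norm (indicator Xs y *\<^sub>R q x0 y)"
    proof (rule AE_I2)
      fix y show "norm (qmin * indicator Xs y) \<le> norm (indicator Xs y *\<^sub>R q x0 y)"
        using q_ge[OF x0, of y] qmin_pos by (cases "y \<in> Xs") simp_all
    qed
  qed
  then have "integrable lam (\<lambda>y. (1 / qmin) * (qmin * indicator Xs y))" by (rule integrable_mult_right)
  then have "integrable lam (indicator Xs :: 'x \<Rightarrow> real)" using qmin_pos by simp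
  then have "emeasure lam Xs < \<infinity>" using Xs_meas by (simp add: integrable_indicator_iff space_lam)
  moreover have "emeasure K (space K) = emeasure lam Xs"
  proof -
    have "emeasure K (space K) = (\<integral>\<^sup>+x. ennreal (indicator Xs x) * indicator UNIV x \<partial>lam)"
      unfolding K_def
    proof (subst emeasure_density)
      show "(\<lambda>x. ennreal (indicator Xs x)) \<in> borel_measurable lam" using Xs_meas by measurable
    qed (simp_all add: space_lam lam_sets)
    also have "\<dots> = (\<integral>\<^sup>+x. indicator Xs x \<partial>lam)"
      by (intro nn_integral_cong) (simp add: ennreal_indicator)
    finally show ?thesis using Xs_meas by simp
  qed
  ultimately show "emeasure K (space K) \<noteq> \<infinity>" by auto
qed

lemma tmin_pos: "0 < tmin" and tmin_le: "i < d \<Longrightarrow> tmin \<le> ts i"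
proof -
  have "{..<d} \<noteq> {}" using d_ge by (auto simp: lessThan_empty_iff)
  then show "0 < tmin" unfolding tmin_def using A1_pos by (subst Min_gr_iff) auto
qed (auto simp: tmin_def)

lemma dl: "0 < dl" "dl \<le> 1" "dl * B \<le> qmin * tmin"
proof -
  have p: "0 < qmin * tmin / B" using qmin_pos tmin_pos B_pos by simp
  then show "0 < dl" "dl \<le> 1" by (simp_all add: dl_def)
  have "dl * B \<le> qmin * tmin / B * B" using B_pos by (intro mult_right_mono) (simp_all add: dl_def)
  then show "dl * B \<le> qmin * tmin" using B_pos by simp
qed

lemma q'_meas: "(\<lambda>(x, y). q' x y) \<in> borel_measurable (K \<Otimes>\<^sub>M K)"
proof -
  have "sets (K \<Otimes>\<^sub>M K) = sets (lam \<Otimes>\<^sub>M lam)" by (intro sets_pair_measure_cong sets_K)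
  then have [measurable]: "(\<lambda>p. q (fst p) (snd p)) \<in> borel_measurable (K \<Otimes>\<^sub>M K)"
    using q_meas measurable_cong_sets[OF _ refl, of "K \<Otimes>\<^sub>M K" "lam \<Otimes>\<^sub>M lam" borel]
    unfolding split_beta' by blast
  note [measurable] = Xs_sets
  show ?thesis unfolding q'_def split_beta' by measurable
qed

lemma q'_section: "q' x \<in> borel_measurable K"
  using measurable_Pair2[OF q'_meas, of x] by (simp add: space_K)

lemma q'_integral:
  assumes "x \<in> Xs"
  shows "integrable K (q' x)" "(\<integral>y. q' x y \<partial>K) = 1"
proof -
  have eq: "indicator Xs y *\<^sub>R q' x y = indicator Xs y *\<^sub>R q x y" for y
    using assms by (simp add: q'_def indicator_def)
  have m: "q' x \<in> borel_measurable lam" using q'_section by (simp add: measurable_K)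
  show "integrable K (q' x)"
    using q_prob(1)[OF assms] unfolding integrable_K[OF m] set_integrable_def eq .
  show "(\<integral>y. q' x y \<partial>K) = 1"
    using q_prob(2)[OF assms] unfolding integral_K[OF m] set_lebesgue_integral_def eq .
qed

sublocale mh: mh_space K Xs dens' q' B qmin dl
proof (rule mh_space.intro[OF finite_K], unfold_locales)
  show "0 \<le> dens' x" for x using pi_nonneg[of x] by (simp add: dens'_def indicator_def)
  show "dens' x \<le> B" for x using pi_le[of x] B_pos by (simp add: dens'_def indicator_def)
  show "(\<integral>x. dens' x \<partial>K) = 1" using dens'_integral[of "\<lambda>_. 1"] pi_prob by simp
  show "0 \<le> q' x y" for x y using q_ge[of x y] qmin_pos by (cases "x \<in> Xs \<and> y \<in> Xs") (auto simp: q'_def)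
  show "q' x y = q' y x" for x y using q_sym[of x y] by (simp add: q'_def indicator_def)
  show "qmin \<le> q' x y" if "x \<in> Xs" "y \<in> Xs" for x y using q_ge[OF that] that by (simp add: q'_def)
  show "q' x y = 0" if "x \<notin> Xs \<or> y \<notin> Xs" for x y using that by (auto simp: q'_def)
qed (simp_all add: space_K Xs_sets dens'_meas q'_meas qmin_pos q'_integral dl dens'_def[of x for x])

section \<open>Integrals against the target, stratum by stratum\<close>

lemma dens'_strata: "x \<in> Xs \<Longrightarrow> dens' x / wt r x * h x = (\<Sum>i<d. 1 / r i * (dens' x * (h x * indicator (Xi i) x)))"
  using sum_strata[of x "\<lambda>i. 1 / r i * (dens' x * h x)"] by (simp add: wt_eq mult.assoc)

definition Aint :: "('x \<Rightarrow> real) \<Rightarrow> nat \<Rightarrow> real" where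
  "Aint h i = (\<integral>x. dens' x * (h x * indicator (Xi i) x) \<partial>K)"

lemma integrable_Aint:
  assumes "h \<in> borel_measurable K" "\<And>x. x \<in> Xs \<Longrightarrow> \<bar>h x\<bar> \<le> C"  "i < d"
  shows "integrable K (\<lambda>x. dens' x * (h x * indicator (Xi i) x))"
proof (rule Bochner_Integration.integrable_bound)
  show "integrable K (\<lambda>x. dens' x * C)" using mh.integrable_dens by simp
  show "(\<lambda>x. dens' x * (h x * indicator (Xi i) x)) \<in> borel_measurable K"
    using assms(1) dens'_meas Xi_sets[OF assms(3)] by measurable
  have "\<bar>dens' x * (h x * indicator (Xi i) x)\<bar> \<le> \<bar>dens' x * C\<bar>" for x
  proof (cases "x \<in> Xs")
    case True
    have "\<bar>h x * indicator (Xi i) x\<bar> \<le> \<bar>C\<bar>" using assms(2)[OF True] by (cases "x \<in> Xi i") auto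
    then show ?thesis unfolding abs_mult[of "dens' x"] by (intro mult_left_mono) auto
  qed (simp add: dens'_def)
  then show "AE x in K. norm (dens' x * (h x * indicator (Xi i) x)) \<le> norm (dens' x * C)" by simp
qed

lemma integral_dens'_wt:
  assumes h: "h \<in> borel_measurable K" "\<And>x. x \<in> Xs \<Longrightarrow> \<bar>h x\<bar> \<le> C"
  shows "(\<integral>x. dens' x / wt r x * h x \<partial>K) = (\<Sum>i<d. Aint h i / r i)"
proof -
  have "dens' x / wt r x * h x = (\<Sum>i<d. 1 / r i * (dens' x * (h x * indicator (Xi i) x)))" for x
    using dens'_strata[of x r h] by (cases "x \<in> Xs") (simp_all add: dens'_def)
  then have "(\<integral>x. dens' x / wt r x * h x \<partial>K) = (\<integral>x. (\<Sum>i<d. 1 / r i * (dens' x * (h x * indicator (Xi i) x))) \<partial>K)"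
    by (simp only:)
  also have "\<dots> = (\<Sum>i<d. 1 / r i * Aint h i)"
    unfolding Aint_def using integrable_Aint[OF h] by (subst Bochner_Integration.integral_sum) auto
  finally show ?thesis by simp
qed

lemma Aint_1: "i < d \<Longrightarrow> Aint (\<lambda>_. 1) i = ts i"
proof -
  assume i: "i < d"
  have "Aint (\<lambda>_. 1) i = (LINT x:Xs|lam. indicator (Xi i) x * dens x)"
    unfolding Aint_def using dens'_integral[OF borel_measurable_indicator[OF Xi_sets[OF i]]] by simp
  also have "\<dots> = ts i"
    unfolding theta_star_def set_lebesgue_integral_def using i Xi_cover
    by (intro Bochner_Integration.integral_cong) (auto simp: indicator_def)
  finally show ?thesis .
qed

lemma sum_Aint:
  assumes h: "h \<in> borel_measurable K" "\<And>x. x \<in> Xs \<Longrightarrow> \<bar>h x\<bar> \<le> C"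
  shows "(\<Sum>i<d. Aint h i) = (LINT x:Xs|lam. h x * dens x)"
proof -
  have "(\<Sum>i<d. Aint h i) = (\<integral>x. dens' x / wt (\<lambda>_. 1) x * h x \<partial>K)"
    using integral_dens'_wt[OF h, of "\<lambda>_. 1"] by (simp only: div_by_1)
  also have "\<dots> = (\<integral>x. dens' x * h x \<partial>K)"
    by (intro Bochner_Integration.integral_cong) (auto simp: dens'_def wt_eq indicator_def)
  finally show ?thesis by (simp add: dens'_integral[OF h(1)])
qed

lemma sum_ts: "(\<Sum>i<d. ts i) = 1"
  using sum_Aint[of "\<lambda>_. 1" 1] Aint_1 pi_prob by simp

lemma norml_wt: "mh.norml (wt r) = (\<Sum>i<d. ts i / r i)"
  unfolding mh.norml_def using integral_dens'_wt[of "\<lambda>_. 1" 1 r] Aint_1 by simp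

lemma pim_wt:
  assumes h: "h \<in> borel_measurable K" "\<And>x. x \<in> Xs \<Longrightarrow> \<bar>h x\<bar> \<le> C"
  shows "mh.pim (wt r) h = (\<Sum>i<d. Aint h i / r i) / (\<Sum>i<d. ts i / r i)"
  using integral_dens'_wt[OF h, of r] norml_wt[of r] by (simp only: mh.pim_def)

text \<open>Take for \<open>m\<close> the least value of \<open>r\<close>, attained at
  \<open>j\<close>. In \<open>m * (\<Sum>i<d. ts i / r i)\<close> the term of \<open>j\<close> alone
  is \<open>ts j \<ge> tmin\<close>, so \<open>dl\<close> does not depend on \<open>r\<close>. This
  is the uniformity in \<open>\<theta>\<close> of the minorization.\<close>

lemma good_wt:
  assumes r: "\<And>i. i < d \<Longrightarrow> 0 < r i"
  shows "mh.good (wt r)"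
  unfolding mh.good_def
proof (intro conjI allI)
  define m where "m = Min (r ` {..<d})"
  have ne: "{..<d} \<noteq> {}" using d_ge by (auto simp: lessThan_empty_iff)
  have m: "0 < m" "\<And>i. i < d \<Longrightarrow> m \<le> r i" unfolding m_def using r ne by (auto simp: Min_gr_iff)
  have "m \<in> r ` {..<d}" unfolding m_def using ne by (intro Min_in) auto
  then obtain j where j: "j < d" "m = r j" by auto
  have sum: "(\<integral>y. dens' y * m / wt r y \<partial>K) = m * (\<Sum>i<d. ts i / r i)"
  proof -
    have "(\<integral>y. dens' y * m / wt r y \<partial>K) = (\<integral>y. m * (dens' y / wt r y) \<partial>K)"
      by (intro Bochner_Integration.integral_cong) auto
    also have "\<dots> = m * mh.norml (wt r)" unfolding mh.norml_def by (rule integral_mult_right_zero)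
    finally show ?thesis by (simp only: norml_wt)
  qed
  have "ts j / r j \<le> (\<Sum>i<d. ts i / r i)"
    using j r A1_pos by (intro member_le_sum) (auto simp: less_imp_le)
  then have "m * (ts j / r j) \<le> m * (\<Sum>i<d. ts i / r i)" using m(1) by (intro mult_left_mono) auto
  then have "tmin \<le> m * (\<Sum>i<d. ts i / r i)" using tmin_le[OF j(1)] j m(1) by simp
  then have "qmin * tmin \<le> qmin * (m * (\<Sum>i<d. ts i / r i))" using qmin_pos by simp
  then have "dl * B \<le> qmin * (\<integral>y. dens' y * m / wt r y \<partial>K)" unfolding sum using dl(3) by linarith
  moreover have "\<forall>x\<in>Xs. m \<le> wt r x" using m(2) idx(1) by (simp add: wt_eq)
  ultimately show "\<exists>m>0. (\<forall>x\<in>Xs. m \<le> wt r x) \<and> dl * B \<le> qmin * (\<integral>y. dens' y * m / wt r y \<partial>K)"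
    using m(1) by blast
qed (simp_all add: wt_meas wt_pos r)

lemma Z_pos:
  assumes r: "\<And>i. i < d \<Longrightarrow> 0 < r i"
  shows "0 < (\<Sum>i<d. ts i / r i)"
  using mh.norml_pos[OF good_wt[OF r]] by (simp add: norml_wt)

lemma pi_rho_eq:
  assumes "x \<in> Xs"
  shows "pi_rho lam dens Xi d rho \<theta> x = dens x / rho (\<theta> (idx x)) / (\<Sum>i<d. ts i / rho (\<theta> i))"
  using sum_strata[OF assms, of "\<lambda>i. dens x / rho (\<theta> i)"] by (simp add: pi_rho_def Z_rho_def)

text \<open>\<open>Z_rho\<close> cancels in the acceptance ratio, which leaves that of
  \<open>dens / w\<close>; \<open>mh_kernel\<close> is then the accept-reject form of
  \<open>Pop\<close> given by \<open>mh.Pop_eq\<close>.\<close>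

lemma P_rho_eq:
  assumes r: "\<And>i. i < d \<Longrightarrow> 0 < rho (\<theta> i)" and x: "x \<in> Xs" and A: "A \<in> sets lam"
  shows "P_rho lam Xs q dens Xi d rho \<theta> x A = mh.Pop (wt (\<lambda>i. rho (\<theta> i))) (indicator A) x"
proof -
  define p where "p = pi_rho lam dens Xi d rho \<theta>"
  define w where "w = wt (\<lambda>i. rho (\<theta> i))"
  have w: "mh.good w" unfolding w_def by (rule good_wt[OF r])
  have Z: "0 < (\<Sum>i<d. ts i / rho (\<theta> i))" by (rule Z_pos[OF r])
  have p: "p y = dens y / w y / (\<Sum>i<d. ts i / rho (\<theta> i))" if "y \<in> Xs" for y
    unfolding p_def w_def using pi_rho_eq[OF that] that by (simp add: wt_eq)
  have acc: "mh_acc p x y = mh.acc w x y" if y: "y \<in> Xs" for y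
  proof -
    have pos: "0 < w x" "0 < w y" using mh.good_pos[OF w] by auto
    have "p x = 0 \<longleftrightarrow> dens x = 0" using p[OF x] pos Z by simp
    moreover have "p y / p x = dens y / dens x * (w x / w y)"
      using p[OF x] p[OF y] pos Z by simp
    ultimately show ?thesis using x y by (simp add: mh_acc_def mh.acc_def dens'_def)
  qed
  have jump: "mh.jump w x \<in> borel_measurable K" by (rule mh.jump_measurable1[OF mh.good_meas[OF w]])
  have Am: "(indicator A :: 'x \<Rightarrow> real) \<in> borel_measurable K" using A by (intro borel_measurable_indicator) (simp only: sets_K(1))
  have int: "(LINT y:(A' \<inter> Xs)|lam. q x y * mh_acc p x y) = (\<integral>y. mh.jump w x y * indicator A' y \<partial>K)"
    if "(indicator A' :: 'x \<Rightarrow> real) \<in> borel_measurable K" for A'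
  proof -
    have "(\<integral>y. mh.jump w x y * indicator A' y \<partial>K) = (LINT y:Xs|lam. mh.jump w x y * indicator A' y)"
      using jump that by (intro integral_K) (simp add: measurable_K)
    also have "\<dots> = (LINT y:(A' \<inter> Xs)|lam. q x y * mh_acc p x y)"
      unfolding set_lebesgue_integral_def using x acc
      by (intro Bochner_Integration.integral_cong) (auto simp: mh.jump_def q'_def indicator_def)
    finally show ?thesis by simp
  qed
  have "P_rho lam Xs q dens Xi d rho \<theta> x A
      = (\<integral>y. mh.jump w x y * indicator A y \<partial>K) + (1 - (\<integral>y. mh.jump w x y \<partial>K)) * indicator A x"
    using int[OF Am] int[of UNIV] by (simp add: P_rho_def mh_kernel_def p_def)
  also have "\<dots> = mh.Pop w (indicator A) x"
    by (rule mh.Pop_eq[OF w Am, of 1, symmetric]) (simp_all add: x indicator_le_1)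
  finally show ?thesis by (simp only: w_def)
qed

lemma pim_pi_rho:
  assumes r: "\<And>i. i < d \<Longrightarrow> 0 < rho (\<theta> i)" and h: "h \<in> borel_measurable K" "\<And>x. x \<in> Xs \<Longrightarrow> \<bar>h x\<bar> \<le> C"
  shows "(LINT x:Xs|lam. h x * pi_rho lam dens Xi d rho \<theta> x) = mh.pim (wt (\<lambda>i. rho (\<theta> i))) h"
proof -
  define w where "w = wt (\<lambda>i. rho (\<theta> i))"
  have w: "mh.good w" unfolding w_def by (rule good_wt[OF r])
  have "mh.pim w h = (\<integral>x. dens' x / w x * h x / mh.norml w \<partial>K)"
    unfolding mh.pim_def by (rule integral_divide_zero[symmetric])
  also have "\<dots> = (LINT x:Xs|lam. dens' x / w x * h x / mh.norml w)"
    using dens'_meas mh.good_meas[OF w] h(1) by (intro integral_K) (simp add: measurable_K)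
  also have "\<dots> = (LINT x:Xs|lam. h x * pi_rho lam dens Xi d rho \<theta> x)"
    unfolding set_lebesgue_integral_def
    by (intro Bochner_Integration.integral_cong) (auto simp: pi_rho_eq w_def wt_eq norml_wt dens'_def indicator_def)
  finally show ?thesis by (simp add: w_def)
qed

end

section \<open>The algorithm as an adaptive Metropolis-Hastings chain\<close>

context shus
begin

definition r :: "nat \<Rightarrow> 'w \<Rightarrow> nat \<Rightarrow> real" where
  "r n \<omega> i = rho (normalize_theta d (\<theta>t n \<omega>) i)"

definition psi :: "nat \<Rightarrow> 'w \<Rightarrow> 'x \<Rightarrow> real" where "psi n \<omega> = wt (r n \<omega>)"

definition gens :: "nat \<Rightarrow> 'w set set" where
  "gens n = {{\<omega> \<in> space M. \<theta>t 0 \<omega> i \<in> A} | i A. i < d \<and> A \<in> sets (borel :: real measure)}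
      \<union> {{\<omega> \<in> space M. X k \<omega> \<in> A} | k A. k \<le> n \<and> A \<in> sets (borel :: 'x measure)}"

definition F :: "nat \<Rightarrow> 'w measure" where "F n = sigma (space M) (gens n)"

definition stp :: "nat \<Rightarrow> 'w \<Rightarrow> real" where "stp n \<omega> = \<gamma> / g_fun \<alpha> \<mu> (S_of d (\<theta>t n \<omega>))"

definition lv :: "nat \<Rightarrow> 'w \<Rightarrow> real" where "lv n \<omega> = (\<Sum>i<d. \<bar>ln (r (Suc n) \<omega> i) - ln (r n \<omega> i)\<bar>)"

lemma gens_Pow: "gens n \<subseteq> Pow (space M)"
  unfolding gens_def by auto

lemma sets_F: "sets (F n) = sigma_sets (space M) (gens n)" and space_F: "space (F n) = space M"
  unfolding F_def using gens_Pow by (simp_all add: sets_measure_of space_measure_of)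

lemma hist_sigma_eq: "hist_sigma M d \<theta>t X n = sets (F n)"
  unfolding sets_F hist_sigma_def gens_def ..

lemma gens_F: "A \<in> gens n \<Longrightarrow> A \<in> sets (F n)"
  unfolding sets_F by (rule sigma_sets.Basic)

lemma filtered: "filtered_space M F"
proof (rule filtered_space.intro[OF prob_space_axioms], unfold_locales)
  fix n
  have "gens n \<subseteq> sets M"
  proof
    fix A assume "A \<in> gens n"
    then consider (theta) i C where "i < d" "C \<in> sets borel" "A = {\<omega> \<in> space M. \<theta>t 0 \<omega> i \<in> C}"
      | (chain) k C where "C \<in> sets borel" "A = {\<omega> \<in> space M. X k \<omega> \<in> C}"
      unfolding gens_def by blast
    then show "A \<in> sets M"
    proof cases
      case theta
      then show ?thesis using measurable_sets[OF init_meas[OF theta(1)] theta(2)]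
        by (simp add: vimage_def Int_def conj_commute)
    next
      case chain
      then show ?thesis using measurable_sets[OF X_meas chain(1)]
        by (simp add: vimage_def Int_def conj_commute)
    qed
  qed
  then show "subalgebra M (F n)"
    unfolding subalgebra_def sets_F space_F by (simp add: sets.sigma_sets_subset)
  have "gens n \<subseteq> gens (Suc n)" unfolding gens_def by (intro Un_mono) (auto intro: le_SucI)
  then show "subalgebra (F (Suc n)) (F n)"
    unfolding subalgebra_def sets_F space_F by (simp add: sigma_sets_subseteq)
qed

sublocale fs: filtered_space M F by (rule filtered)

lemma X_F: "X n \<in> measurable (F n) K"
proof (rule measurableI)
  fix A assume "A \<in> sets K"
  then have "{\<omega> \<in> space M. X n \<omega> \<in> A} \<in> gens n" unfolding gens_def sets_K(2) by blast
  then show "X n -` A \<inter> space (F n) \<in> sets (F n)"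
    using gens_F by (simp add: space_F vimage_def Int_def conj_commute)
qed (simp add: space_K)

lemma path:
  assumes \<omega>: "\<omega> \<in> space M"
  shows "shus_path rho Rb c5 \<alpha> \<gamma> \<mu> d (\<lambda>n. \<theta>t n \<omega>) (\<lambda>n. idx (X (Suc n) \<omega>))"
proof (intro shus_path.intro rho_function_axioms shus_path_axioms.intro)
  show "\<theta>t (Suc n) \<omega> i = \<theta>t n \<omega> i + \<gamma> / g_fun \<alpha> \<mu> (S_of d (\<theta>t n \<omega>)) * S_of d (\<theta>t n \<omega>)
      * rho (normalize_theta d (\<theta>t n \<omega>) i) * (if i = idx (X (Suc n) \<omega>) then 1 else 0)" if "i < d" for n i
    using update[OF \<omega> that, of n] indicator_Xi[OF X_in[OF \<omega>] that, of "Suc n"] by (simp only:)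
qed (use \<alpha> \<gamma> \<mu> d_ge init_pos[OF \<omega>] idx(1)[OF X_in[OF \<omega>]] in auto)

lemma th_bounds:
  assumes "\<omega> \<in> space M" "i < d"
  shows "0 < normalize_theta d (\<theta>t n \<omega>) i" "normalize_theta d (\<theta>t n \<omega>) i < 1"
  using shus_path.th_pos[OF path[OF assms(1)] assms(2)] shus_path.th_less[OF path[OF assms(1)] assms(2)] by auto

lemma r_bounds:
  assumes "\<omega> \<in> space M" "i < d"
  shows "0 < r n \<omega> i" "r n \<omega> i \<le> Rb"
  unfolding r_def using th_bounds[OF assms] rho_pos rho_le by auto

lemma measurable_rho: "(\<lambda>t. indicator {0<..<1} t * rho t) \<in> borel_measurable borel"
  using rho_meas by (simp add: set_borel_measurable_def)

text \<open>Measurability of \<open>\<theta>t n\<close> is a hypothesis here because the lemma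
  serves inside the induction that proves it. Measurability of \<open>rho\<close> is given on the
  unit interval only, hence the detour through its product with an indicator.\<close>

lemma r_meas_aux:
  assumes i: "i < d" and m: "\<And>i. i < d \<Longrightarrow> (\<lambda>\<omega>. \<theta>t n \<omega> i) \<in> borel_measurable (F n)"
  shows "(\<lambda>\<omega>. S_of d (\<theta>t n \<omega>)) \<in> borel_measurable (F n)"
    "(\<lambda>\<omega>. normalize_theta d (\<theta>t n \<omega>) i) \<in> borel_measurable (F n)"
    "(\<lambda>\<omega>. r n \<omega> i) \<in> borel_measurable (F n)"
proof -
  show S: "(\<lambda>\<omega>. S_of d (\<theta>t n \<omega>)) \<in> borel_measurable (F n)"
    unfolding S_of_def using m by (intro borel_measurable_sum) auto
  show th: "(\<lambda>\<omega>. normalize_theta d (\<theta>t n \<omega>) i) \<in> borel_measurable (F n)"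
    unfolding normalize_theta_def by (intro borel_measurable_divide m i S)
  have "(\<lambda>\<omega>. r n \<omega> i) \<in> borel_measurable (F n) \<longleftrightarrow>
      (\<lambda>\<omega>. indicator {0<..<1} (normalize_theta d (\<theta>t n \<omega>) i) * rho (normalize_theta d (\<theta>t n \<omega>) i)) \<in> borel_measurable (F n)"
    by (intro measurable_cong) (simp add: r_def space_F th_bounds i)
  then show "(\<lambda>\<omega>. r n \<omega> i) \<in> borel_measurable (F n)"
    using measurable_compose[OF th measurable_rho] by simp
qed

text \<open>The history records the initial weights and the chain; later weights are recovered from
  these by the update rule.\<close>

lemma theta_meas: "i < d \<Longrightarrow> (\<lambda>\<omega>. \<theta>t n \<omega> i) \<in> borel_measurable (F n)"
proof (induction n arbitrary: i)
  case 0
  show ?case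
  proof (rule measurableI)
    fix A :: "real set" assume "A \<in> sets borel"
    then have "{\<omega> \<in> space M. \<theta>t 0 \<omega> i \<in> A} \<in> gens 0" unfolding gens_def using 0 by blast
    then show "(\<lambda>\<omega>. \<theta>t 0 \<omega> i) -` A \<inter> space (F 0) \<in> sets (F 0)"
      using gens_F by (simp add: space_F vimage_def Int_def conj_commute)
  qed simp
next
  case (Suc n)
  note aux = r_meas_aux[OF Suc.prems Suc.IH]
  note [measurable] = fs.measurable_F_mono[OF aux(1), of "Suc n"] fs.measurable_F_mono[OF aux(3), of "Suc n"]
    fs.measurable_F_mono[OF Suc.IH[OF Suc.prems], of "Suc n"]
    measurable_compose[OF X_F[of "Suc n"] borel_measurable_indicator[OF Xi_sets[OF Suc.prems]]]
  have "(\<lambda>\<omega>. \<theta>t n \<omega> i + \<gamma> / g_fun \<alpha> \<mu> (S_of d (\<theta>t n \<omega>)) * S_of d (\<theta>t n \<omega>)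
                      * r n \<omega> i * indicator (Xi i) (X (Suc n) \<omega>)) \<in> borel_measurable (F (Suc n))"
    by measurable
  then show ?case
    by (rule measurable_cong[THEN iffD1, rotated]) (simp add: space_F update Suc.prems r_def)
qed

lemmas r_meas = r_meas_aux(3)[OF _ theta_meas] and th_meas = r_meas_aux(2)[OF _ theta_meas]

lemma S_meas: "(\<lambda>\<omega>. S_of d (\<theta>t n \<omega>)) \<in> borel_measurable (F n)"
  using r_meas_aux(1)[of 0 n] theta_meas d_ge by simp

lemma psi_meas: "(\<lambda>(\<omega>, x). psi n \<omega> x) \<in> borel_measurable (F n \<Otimes>\<^sub>M K)"
proof -
  have C: "- Xs \<in> sets K"
    using sets.compl_sets[OF Xs_sets] by (simp only: space_K Compl_eq_Diff_UNIV)
  show ?thesis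
    unfolding psi_def wt_def split_beta'
    by (intro borel_measurable_add borel_measurable_sum borel_measurable_times
        measurable_compose[OF measurable_fst r_meas] measurable_compose[OF measurable_snd borel_measurable_indicator] C Xi_sets)
       simp_all
qed

lemma psi_good: "\<omega> \<in> space M \<Longrightarrow> mh.good (psi n \<omega>)"
  unfolding psi_def by (intro good_wt r_bounds(1))

sublocale ad: adaptive_mh K Xs dens' q' B qmin dl M F X psi x0
proof unfold_locales
  show "prob ({\<omega> \<in> space M. X (Suc n) \<omega> \<in> A} \<inter> H)
      = (\<integral>\<omega>. indicator H \<omega> * mh.Pop (psi n \<omega>) (indicator A) (X n \<omega>) \<partial>M)"
    if A: "A \<in> sets K" and H: "H \<in> sets (F n)" for n A H
  proof -
    have A': "A \<in> sets lam" using A by (simp only: sets_K(1))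
    have H': "H \<in> hist_sigma M d \<theta>t X n" using H by (simp only: hist_sigma_eq)
    show ?thesis
      unfolding X_law[OF A' H']
    proof (intro Bochner_Integration.integral_cong refl arg_cong2[where f = "(*)"])
      fix \<omega> assume \<omega>: "\<omega> \<in> space M"
      show "P_rho lam Xs q dens Xi d rho (normalize_theta d (\<theta>t n \<omega>)) (X n \<omega>) A = mh.Pop (psi n \<omega>) (indicator A) (X n \<omega>)"
        unfolding psi_def r_def
        by (rule P_rho_eq[OF _ X_in[OF \<omega>] A']) (use r_bounds(1)[OF \<omega>] in \<open>simp add: r_def\<close>)
    qed
  qed
qed (simp_all add: X_F X_in psi_meas psi_good x0)

lemma psi_eq: "x \<in> Xs \<Longrightarrow> psi n \<omega> x = r n \<omega> (idx x)"
  by (simp add: psi_def wt_eq)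

lemma psi_lv: "x \<in> Xs \<Longrightarrow> \<bar>ln (psi (Suc n) \<omega> x) - ln (psi n \<omega> x)\<bar> \<le> lv n \<omega>"
  unfolding psi_eq lv_def using idx(1)[of x]
  by (intro member_le_sum[of "idx x" "{..<d}" "\<lambda>i. \<bar>ln (r (Suc n) \<omega> i) - ln (r n \<omega> i)\<bar>"]) auto

lemma summable_lv:
  assumes "\<omega> \<in> space M" "decseq \<beta>" "\<And>n. 0 \<le> \<beta> n" "summable (\<lambda>n. (\<beta> n)\<^sup>2)"
  shows "summable (\<lambda>n. \<beta> n * lv n \<omega>)"
  using shus_path.summable_lvar[OF path[OF assms(1)] assms(2-4)]
  unfolding shus_path.lvar_def[OF path[OF assms(1)]] lv_def r_def .

lemma stp_props:
  assumes "\<omega> \<in> space M"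
  shows "0 < stp n \<omega>" "decseq (\<lambda>n. stp n \<omega>)" "summable (\<lambda>n. (stp n \<omega>)\<^sup>2)"
  using shus_path.stp_pos[OF path[OF assms], of n] shus_path.decseq_stp[OF path[OF assms]]
    shus_path.summable_stp2[OF path[OF assms]]
  unfolding shus_path.stp_def[OF path[OF assms], abs_def] stp_def by auto

lemma stp_meas: "stp n \<in> borel_measurable (F n)"
  unfolding stp_def[abs_def] using S_meas[of n] by measurable

text \<open>The factor \<open>w i\<close> cancels against the density \<open>dens / w\<close>, so
  the mean is proportional to \<open>ts i\<close>, with a constant common to all strata.\<close>

lemma pim_indicator:
  assumes r: "\<And>i. i < d \<Longrightarrow> 0 < w i" and i: "i < d"
  shows "mh.pim (wt w) (\<lambda>x. w i * indicator (Xi i) x) = ts i / (\<Sum>j<d. ts j / w j)"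
proof -
  have m: "(\<lambda>x. w i * indicator (Xi i) x) \<in> borel_measurable K"
    using Xi_sets[OF i] by (intro borel_measurable_times borel_measurable_const borel_measurable_indicator)
  have b: "\<bar>w i * indicator (Xi i) x\<bar> \<le> w i" for x using r[OF i] by (simp add: indicator_def)
  have "Aint (\<lambda>x. w i * indicator (Xi i) x) j = (if j = i then w i * ts i else 0)" if j: "j < d" for j
  proof -
    have "dens' x * (w i * indicator (Xi i) x * indicator (Xi j) x)
        = (if j = i then w i else 0) * (dens' x * (1 * indicator (Xi i) x))" for x
    proof (cases "x \<in> Xs")
      case True
      then show ?thesis using indicator_Xi[OF True i] indicator_Xi[OF True j] by simp
    qed (simp add: dens'_def)
    then have "Aint (\<lambda>x. w i * indicator (Xi i) x) j
        = (\<integral>x. (if j = i then w i else 0) * (dens' x * (1 * indicator (Xi i) x)) \<partial>K)"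
      unfolding Aint_def by (simp only:)
    also have "\<dots> = (if j = i then w i else 0) * Aint (\<lambda>_. 1) i"
      unfolding Aint_def by (rule integral_mult_right_zero)
    finally have "Aint (\<lambda>x. w i * indicator (Xi i) x) j = (if j = i then w i else 0) * Aint (\<lambda>_. 1) i" .
    then show ?thesis by (simp add: Aint_1[OF i])
  qed
  then have "(\<Sum>j<d. Aint (\<lambda>x. w i * indicator (Xi i) x) j / w j) = (\<Sum>j<d. if j = i then ts i else 0)"
    using r[OF i] by (intro sum.cong) auto
  also have "\<dots> = ts i" using i by simp
  finally show ?thesis using pim_wt[OF m b, of w] by simp
qed

text \<open>The series \<open>y i\<close> centres stratum \<open>i\<close> by its mean
  \<open>ts i / Z\<close>. In \<open>y i n - ts i * (\<Sum>j<d. y j n)\<close> these means cancel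
  whatever the value of \<open>Z\<close>, as the stratum masses sum to 1, and the driving term of
  \<open>th_tendsto\<close> is left.\<close>

lemma theta_converges:
  "AE \<omega> in M. \<forall>i<d. (\<lambda>n. normalize_theta d (\<theta>t n \<omega>) i) \<longlonglongrightarrow> ts i"
proof -
  define y where "y i n \<omega> = stp n \<omega> * (r n \<omega> i * indicator (Xi i) (X (Suc n) \<omega>) - ts i / (\<Sum>j<d. ts j / r n \<omega> j))"
    for i n \<omega>
  have "AE \<omega> in M. summable (\<lambda>n. y i n \<omega>)" if i: "i < d" for i
  proof -
    have "AE \<omega> in M. summable (\<lambda>n. stp n \<omega> * (r n \<omega> i * indicator (Xi i) (X (Suc n) \<omega>)
        - mh.pim (psi n \<omega>) (\<lambda>x. r n \<omega> i * indicator (Xi i) x)))"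
    proof (rule ad.noise_summable[where f = "\<lambda>n \<omega> x. r n \<omega> i * indicator (Xi i) x" and C = Rb and E = Rb and L = lv])
      show "(\<lambda>(\<omega>, x). r n \<omega> i * indicator (Xi i) x) \<in> borel_measurable (F n \<Otimes>\<^sub>M K)" for n
        unfolding split_beta'
        by (intro borel_measurable_times measurable_compose[OF measurable_fst r_meas[OF i]]
            measurable_compose[OF measurable_snd borel_measurable_indicator] Xi_sets i)
      show "\<bar>r n \<omega> i * indicator (Xi i) x\<bar> \<le> Rb" if "\<omega> \<in> space M" for n \<omega> and x :: 'x
        using r_bounds[OF that i, of n] Rb_pos by (simp add: indicator_def)
      show "\<bar>r (Suc n) \<omega> i * indicator (Xi i) x - r n \<omega> i * indicator (Xi i) x\<bar> \<le> Rb * lv n \<omega>"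
        if \<omega>: "\<omega> \<in> space M" for n \<omega> and x :: 'x
      proof -
        \<comment> \<open>\<open>lv\<close> measures changes of logarithms. Numbers in
          \<open>(0, Rb]\<close> differ by at most \<open>Rb\<close> times the difference of their
          logarithms, which is where \<open>E = Rb\<close> comes from.\<close>
        have exp_lip: "\<bar>s - t\<bar> \<le> Rb * \<bar>ln s - ln t\<bar>" if "0 < s" "s \<le> Rb" "0 < t" "t \<le> Rb" for s t :: real
        proof -
          have *: "t - s \<le> Rb * (ln t - ln s)" if "0 < s" "s \<le> t" "t \<le> Rb" for s t :: real
          proof -
            have "ln (s / t) \<le> s / t - 1" using that by (intro ln_le_minus_one) simp
            then have "t * (1 - s / t) \<le> t * (ln t - ln s)" using that by (intro mult_left_mono) (simp_all add: ln_div)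
            also have "\<dots> \<le> Rb * (ln t - ln s)" using that by (intro mult_right_mono) simp_all
            finally show ?thesis using that by (simp add: right_diff_distrib)
          qed
          show ?thesis
          proof (cases "s \<le> t")
            case True
            then have "ln s \<le> ln t" using that by simp
            then show ?thesis using *[of s t] True that by simp
          next
            case False
            then have "ln t \<le> ln s" using that by simp
            then show ?thesis using *[of t s] False that by simp
          qed
        qed
        have "\<bar>r (Suc n) \<omega> i * indicator (Xi i) x - r n \<omega> i * indicator (Xi i) x\<bar> \<le> \<bar>r (Suc n) \<omega> i - r n \<omega> i\<bar>"
          by (simp add: indicator_def)
        also have "\<dots> \<le> Rb * \<bar>ln (r (Suc n) \<omega> i) - ln (r n \<omega> i)\<bar>"
          by (intro exp_lip r_bounds \<omega> i)
        also have "\<dots> \<le> Rb * lv n \<omega>"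
          unfolding lv_def using Rb_pos i
          by (intro mult_left_mono member_le_sum[of i "{..<d}" "\<lambda>i. \<bar>ln (r (Suc n) \<omega> i) - ln (r n \<omega> i)\<bar>"]) auto
        finally show ?thesis .
      qed
      show "summable (\<lambda>n. stp n \<omega> * lv n \<omega>)" if "\<omega> \<in> space M" for \<omega>
        by (intro summable_lv that stp_props less_imp_le)
    qed (use stp_props stp_meas psi_lv in \<open>auto simp: less_imp_le\<close>)
    then show ?thesis
    proof (rule AE_mp, intro AE_I2 impI)
      fix \<omega> assume \<omega>: "\<omega> \<in> space M" and "summable (\<lambda>n. stp n \<omega> * (r n \<omega> i * indicator (Xi i) (X (Suc n) \<omega>)
        - mh.pim (psi n \<omega>) (\<lambda>x. r n \<omega> i * indicator (Xi i) x)))"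
      moreover have "mh.pim (psi n \<omega>) (\<lambda>x. r n \<omega> i * indicator (Xi i) x) = ts i / (\<Sum>j<d. ts j / r n \<omega> j)" for n
        unfolding psi_def by (rule pim_indicator[OF r_bounds(1)[OF \<omega>] i])
      ultimately show "summable (\<lambda>n. y i n \<omega>)"
        unfolding y_def by (simp only:)
    qed
  qed
  then have "AE \<omega> in M. \<forall>i\<in>{..<d}. summable (\<lambda>n. y i n \<omega>)"
    by (subst AE_finite_all) simp_all
  then show ?thesis
  proof (rule AE_mp, intro AE_I2 impI allI)
    fix \<omega> i assume \<omega>: "\<omega> \<in> space M" and y: "\<forall>i\<in>{..<d}. summable (\<lambda>n. y i n \<omega>)" and i: "i < d"
    show "(\<lambda>n. normalize_theta d (\<theta>t n \<omega>) i) \<longlonglongrightarrow> ts i"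
    proof (rule shus_path.th_tendsto[OF path[OF \<omega>] _ i])
      fix i assume i: "i < d"
      have eq: "shus_path.stp \<alpha> \<gamma> \<mu> d (\<lambda>n. \<theta>t n \<omega>) n *
          (rho (normalize_theta d (\<theta>t n \<omega>) i) * (if i = idx (X (Suc n) \<omega>) then 1 else 0) -
           ts i * rho (normalize_theta d (\<theta>t n \<omega>) (idx (X (Suc n) \<omega>))))
        = y i n \<omega> - ts i * (\<Sum>j<d. y j n \<omega>)" for n
      proof -
        define Z where "Z = (\<Sum>j<d. ts j / r n \<omega> j)"
        have "(\<Sum>j<d. y j n \<omega>) = stp n \<omega> * ((\<Sum>j<d. r n \<omega> j * indicator (Xi j) (X (Suc n) \<omega>)) - (\<Sum>j<d. ts j) / Z)"
          unfolding y_def Z_def[symmetric] sum_divide_distrib sum_subtractf[symmetric] sum_distrib_left ..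
        also have "\<dots> = stp n \<omega> * (r n \<omega> (idx (X (Suc n) \<omega>)) - 1 / Z)"
          unfolding sum_strata[OF X_in[OF \<omega>]] sum_ts ..
        finally have "y i n \<omega> - ts i * (\<Sum>j<d. y j n \<omega>)
            = stp n \<omega> * (r n \<omega> i * indicator (Xi i) (X (Suc n) \<omega>) - ts i / Z)
              - ts i * (stp n \<omega> * (r n \<omega> (idx (X (Suc n) \<omega>)) - 1 / Z))"
          unfolding y_def Z_def by (simp only:)
        also have "\<dots> = stp n \<omega> * (r n \<omega> i * indicator (Xi i) (X (Suc n) \<omega>) - ts i * r n \<omega> (idx (X (Suc n) \<omega>)))"
          by (simp add: algebra_simps)
        finally show ?thesis
          unfolding shus_path.stp_def[OF path[OF \<omega>]] stp_def r_def indicator_Xi[OF X_in[OF \<omega>] i] by simp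
      qed
      show "summable (\<lambda>n. shus_path.stp \<alpha> \<gamma> \<mu> d (\<lambda>n. \<theta>t n \<omega>) n *
          (rho (normalize_theta d (\<theta>t n \<omega>) i) * (if i = idx (X (Suc n) \<omega>) then 1 else 0) -
           ts i * rho (normalize_theta d (\<theta>t n \<omega>) (idx (X (Suc n) \<omega>)))))"
        unfolding eq using y i by (intro summable_diff summable_mult summable_sum) auto
    qed
  qed
qed

lemma ts_bounds: assumes "i < d" shows "0 < ts i" "ts i < 1"
proof -
  obtain \<omega> where \<omega>: "\<omega> \<in> space M" using not_empty by blast
  have "S_of d ts = 1" by (simp add: S_of_def sum_ts)
  then show "0 < ts i" "ts i < 1"
    using shus_path.normalize_bounds(4)[OF path[OF \<omega>], of ts i] A1_pos assms by auto
qed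

abbreviation "rs \<equiv> \<lambda>i. rho (ts i)"

lemma rs_pos: "i < d \<Longrightarrow> 0 < rs i"
  using ts_bounds rho_pos by simp

lemma r_converges:
  assumes \<omega>: "\<omega> \<in> space M" and c: "\<forall>i<d. (\<lambda>n. normalize_theta d (\<theta>t n \<omega>) i) \<longlonglongrightarrow> ts i" and i: "i < d"
  shows "(\<lambda>n. r n \<omega> i) \<longlonglongrightarrow> rs i" "(\<lambda>n. ln (r n \<omega> i)) \<longlonglongrightarrow> ln (rs i)"
proof -
  have "(\<lambda>n. normalize_theta d (\<theta>t n \<omega>) i) \<longlonglongrightarrow> ts i" using c i by simp
  from tendsto_rho[OF this ts_bounds[OF i]] th_bounds[OF \<omega> i]
  show "(\<lambda>n. r n \<omega> i) \<longlonglongrightarrow> rs i" "(\<lambda>n. ln (r n \<omega> i)) \<longlonglongrightarrow> ln (rs i)"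
    by (simp_all add: r_def)
qed

lemma pim_converges:
  assumes \<omega>: "\<omega> \<in> space M" and c: "\<forall>i<d. (\<lambda>n. normalize_theta d (\<theta>t n \<omega>) i) \<longlonglongrightarrow> ts i"
    and f: "f \<in> borel_measurable K" "\<And>x. x \<in> Xs \<Longrightarrow> \<bar>f x\<bar> \<le> C"
  shows "(\<lambda>n. mh.pim (psi n \<omega>) f) \<longlonglongrightarrow> mh.pim (wt rs) f"
proof -
  have pim: "mh.pim (wt w) f = (\<Sum>i<d. Aint f i / w i) / (\<Sum>i<d. ts i / w i)" for w by (rule pim_wt[OF f])
  have nz: "rs i \<noteq> 0" if "i < d" for i using rs_pos[OF that] by simp
  have "0 < (\<Sum>i<d. ts i / rs i)" by (rule Z_pos[OF rs_pos])
  then have Z: "(\<Sum>i<d. ts i / rs i) \<noteq> 0" by simp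
  show ?thesis
    unfolding psi_def pim
    by (intro tendsto_divide[OF _ _ Z] tendsto_sum tendsto_divide[OF tendsto_const _ nz] r_converges(1)[OF \<omega> c]) simp_all
qed

text \<open>The weights \<open>1 / (n + 1)\<close> decrease and are square summable, so the noise
  series converges and Kronecker's lemma removes the noise from the averages. The means
  \<open>mh.pim (psi n \<omega>) f\<close> converge together with the weights, hence so do their
  averages.\<close>

lemma average_converges:
  assumes f: "f \<in> borel_measurable K" "\<And>x. x \<in> Xs \<Longrightarrow> \<bar>f x\<bar> \<le> C"
  shows "AE \<omega> in M. (\<lambda>n. (\<Sum>k<n. f (X (Suc k) \<omega>)) / real n) \<longlonglongrightarrow> mh.pim (wt rs) f"
proof -
  define b where "b n = 1 / real (Suc n)" for n
  have b: "decseq b" "\<And>n. 0 \<le> b n" "summable (\<lambda>n. (b n)\<^sup>2)"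
  proof -
    show "decseq b" unfolding b_def by (intro decseq_SucI divide_left_mono) auto
    have "summable (\<lambda>n. inverse (real n ^ 2))" by (rule inverse_power_summable) simp
    then have "summable (\<lambda>n. inverse (real (Suc n) ^ 2))" by (subst summable_Suc_iff)
    then show "summable (\<lambda>n. (b n)\<^sup>2)" unfolding b_def by (simp only: power_one_over inverse_eq_divide)
  qed (simp add: b_def)
  have "AE \<omega> in M. summable (\<lambda>n. b n * (f (X (Suc n) \<omega>) - mh.pim (psi n \<omega>) f))"
  \<comment> \<open>\<open>E = 0\<close> because \<open>f\<close> does not change with
    \<open>n\<close>.\<close>
  proof (rule ad.noise_summable[where f = "\<lambda>n \<omega> x. f x" and \<beta> = "\<lambda>n \<omega>. b n" and C = C and E = 0 and L = lv])
    show "(\<lambda>(\<omega>, x). f x) \<in> borel_measurable (F n \<Otimes>\<^sub>M K)" for n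
      unfolding split_beta' by (rule measurable_compose[OF measurable_snd f(1)])
  qed (use b f psi_lv summable_lv in auto)
  moreover note theta_converges
  moreover have "AE \<omega> in M. \<omega> \<in> space M" by simp
  ultimately show ?thesis
  proof eventually_elim
    case (elim \<omega>)
    define z where "z n = f (X (Suc n) \<omega>) - mh.pim (psi n \<omega>) f" for n
    have "(\<lambda>n. (\<Sum>k<n. real (Suc k) * (b k * z k)) / real (Suc n)) \<longlonglongrightarrow> 0"
      using elim(1) unfolding z_def[symmetric]
      by (intro kronecker_lemma LIMSEQ_Suc filterlim_compose[OF filterlim_real_sequentially filterlim_Suc])
         (auto simp: incseq_def)
    moreover have "real (Suc k) * (b k * z k) = z k" for k by (simp add: b_def)
    ultimately have z0: "(\<lambda>n. (\<Sum>k<n. z k) / real (Suc n)) \<longlonglongrightarrow> 0" by (simp only:)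
    \<comment> \<open>Passes from the denominator \<open>n + 1\<close>, which \<open>b\<close>
      imposes, to \<open>n\<close>.\<close>
    have "(\<lambda>n. real (Suc n) / real n) \<longlonglongrightarrow> 1" by (rule LIMSEQ_Suc_n_over_n)
    from tendsto_mult[OF z0 this] have "(\<lambda>n. (\<Sum>k<n. z k) / real (Suc n) * (real (Suc n) / real n)) \<longlonglongrightarrow> 0" by simp
    moreover have "(\<Sum>k<n. z k) / real (Suc n) * (real (Suc n) / real n) = (\<Sum>k<n. z k) / real n" for n
      by (simp del: of_nat_Suc)
    ultimately have z1: "(\<lambda>n. (\<Sum>k<n. z k) / real n) \<longlonglongrightarrow> 0" by (simp only:)
    have p: "(\<lambda>n. (\<Sum>k<n. mh.pim (psi k \<omega>) f) / real n) \<longlonglongrightarrow> mh.pim (wt rs) f"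
      by (rule cesaro_mean[OF pim_converges[OF elim(3,2) f]])
    have "(\<Sum>k<n. z k) / real n + (\<Sum>k<n. mh.pim (psi k \<omega>) f) / real n = (\<Sum>k<n. f (X (Suc k) \<omega>)) / real n" for n
      unfolding add_divide_distrib[symmetric] sum.distrib[symmetric] by (simp add: z_def)
    then show ?case using tendsto_add[OF z1 p] by (simp only: add_0_left)
  qed
qed

lemma expectation_converges:
  assumes f: "f \<in> borel_measurable K" "\<And>x. x \<in> Xs \<Longrightarrow> \<bar>f x\<bar> \<le> C"
  shows "(\<lambda>n. \<integral>\<omega>. f (X n \<omega>) \<partial>M) \<longlonglongrightarrow> mh.pim (wt rs) f"
proof (rule ad.expectation_limit[OF good_wt[OF rs_pos] f, where L = "\<lambda>n \<omega>. \<Sum>i<d. \<bar>ln (r n \<omega> i) - ln (rs i)\<bar>"])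
  show "\<bar>ln (psi n \<omega> x) - ln (wt rs x)\<bar> \<le> (\<Sum>i<d. \<bar>ln (r n \<omega> i) - ln (rs i)\<bar>)" if "x \<in> Xs" for n \<omega> x
    unfolding psi_eq[OF that] wt_eq[OF that] using idx(1)[OF that]
    by (intro member_le_sum[of "idx x" "{..<d}" "\<lambda>i. \<bar>ln (r n \<omega> i) - ln (rs i)\<bar>"]) auto
  show "AE \<omega> in M. (\<lambda>n. \<Sum>i<d. \<bar>ln (r n \<omega> i) - ln (rs i)\<bar>) \<longlonglongrightarrow> 0"
    using theta_converges
  proof (rule AE_mp, intro AE_I2 impI)
    fix \<omega> assume \<omega>: "\<omega> \<in> space M" and c: "\<forall>i<d. (\<lambda>n. normalize_theta d (\<theta>t n \<omega>) i) \<longlonglongrightarrow> ts i"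
    have "(\<lambda>n. \<Sum>i<d. \<bar>ln (r n \<omega> i) - ln (rs i)\<bar>) \<longlonglongrightarrow> (\<Sum>i<d. 0)"
      by (intro tendsto_sum tendsto_rabs_zero LIM_zero r_converges(2)[OF \<omega> c]) simp
    then show "(\<lambda>n. \<Sum>i<d. \<bar>ln (r n \<omega> i) - ln (rs i)\<bar>) \<longlonglongrightarrow> 0" by simp
  qed
qed

section \<open>Reweighted observables\<close>

definition Cw :: "nat \<Rightarrow> 'w \<Rightarrow> real" where "Cw n \<omega> = (\<Sum>i<d. normalize_theta d (\<theta>t n \<omega>) i / r n \<omega> i)"

definition G :: "('x \<Rightarrow> real) \<Rightarrow> nat \<Rightarrow> 'w \<Rightarrow> real" where
  "G f n \<omega> = Cw n \<omega> * (\<Sum>j<d. r n \<omega> j * f (X (Suc n) \<omega>) * indicator (Xi j) (X (Suc n) \<omega>))"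

text \<open>The reweighted observable with the weights frozen at their limit. The factor
  \<open>rs j\<close> undoes the tilting of stratum \<open>j\<close> in the limiting law, and the
  sum in front restores the normalization.\<close>

definition G0 :: "('x \<Rightarrow> real) \<Rightarrow> 'x \<Rightarrow> real" where
  "G0 f x = (\<Sum>i<d. ts i / rs i) * (\<Sum>j<d. rs j * (f x * indicator (Xi j) x))"

text \<open>Since \<open>c5 * t \<le> rho t\<close>, each ratio is at most \<open>1 / c5\<close>
  however small the weight is. This gives the domination for the limit of expectations.\<close>

lemma Cw_bounds:
  assumes "\<omega> \<in> space M"
  shows "0 \<le> Cw n \<omega>" "Cw n \<omega> \<le> real d / c5"
proof -
  have "0 \<le> normalize_theta d (\<theta>t n \<omega>) i / r n \<omega> i \<and> normalize_theta d (\<theta>t n \<omega>) i / r n \<omega> i \<le> 1 / c5"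
    if "i < d" for i
    using th_bounds[OF assms that, of n] r_bounds[OF assms that, of n] c5_pos
      rho_ge[OF th_bounds[OF assms that, of n]] unfolding r_def by (simp add: field_simps)
  then have "0 \<le> Cw n \<omega>" "Cw n \<omega> \<le> (\<Sum>i<d. 1 / c5)"
    unfolding Cw_def by (intro sum_nonneg sum_mono; simp)+
  then show "0 \<le> Cw n \<omega>" "Cw n \<omega> \<le> real d / c5" by simp_all
qed

lemma G_eq: "\<omega> \<in> space M \<Longrightarrow> G f n \<omega> = Cw n \<omega> * r n \<omega> (idx (X (Suc n) \<omega>)) * f (X (Suc n) \<omega>)"
  unfolding G_def using sum_strata[OF X_in, of \<omega> "\<lambda>j. r n \<omega> j * f (X (Suc n) \<omega>)" "Suc n"] by simp

lemma G0_eq: "x \<in> Xs \<Longrightarrow> G0 f x = (\<Sum>i<d. ts i / rs i) * rs (idx x) * f x"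
  unfolding G0_def using sum_strata[of x "\<lambda>j. rs j * f x"] by (simp add: mult.assoc)

lemma G_bound:
  assumes \<omega>: "\<omega> \<in> space M" and f: "\<And>x. x \<in> Xs \<Longrightarrow> \<bar>f x\<bar> \<le> C"
  shows "\<bar>G f n \<omega>\<bar> \<le> real d / c5 * Rb * C"
  unfolding G_eq[OF \<omega>] abs_mult
  using Cw_bounds[OF \<omega>, of n] r_bounds[OF \<omega> idx(1)[OF X_in[OF \<omega>]], of n "Suc n"] f[OF X_in[OF \<omega>]] c5_pos
  by (intro mult_mono mult_nonneg_nonneg) (auto simp: Rb_pos less_imp_le)

lemma G0_bound:
  assumes f: "\<And>x. x \<in> Xs \<Longrightarrow> \<bar>f x\<bar> \<le> C" and x: "x \<in> Xs"
  shows "\<bar>G0 f x\<bar> \<le> (\<Sum>i<d. ts i / rs i) * Rb * C"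
  unfolding G0_eq[OF x] abs_mult
  using Z_pos[OF rs_pos] rs_pos[OF idx(1)[OF x]] rho_le[OF ts_bounds[OF idx(1)[OF x]]] f[OF x]
  by (intro mult_mono mult_nonneg_nonneg) (auto simp: Rb_pos less_imp_le)

lemma G0_meas: "f \<in> borel_measurable K \<Longrightarrow> G0 f \<in> borel_measurable K"
  unfolding G0_def
  by (intro borel_measurable_times borel_measurable_const borel_measurable_sum borel_measurable_indicator Xi_sets) auto

lemma pim_G0:
  assumes f: "f \<in> borel_measurable K" "\<And>x. x \<in> Xs \<Longrightarrow> \<bar>f x\<bar> \<le> C"
  shows "mh.pim (wt rs) (G0 f) = (LINT x:Xs|lam. f x * dens x)"
proof -
  define Z where "Z = (\<Sum>i<d. ts i / rs i)"
  have Z: "0 < Z" unfolding Z_def by (rule Z_pos[OF rs_pos])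
  have A: "Aint (G0 f) i / rs i = Z * Aint f i" if i: "i < d" for i
  proof -
    have "dens' x * (G0 f x * indicator (Xi i) x) = Z * rs i * (dens' x * (f x * indicator (Xi i) x))" for x
    proof (cases "x \<in> Xs")
      case True
      then show ?thesis using indicator_Xi[OF True i] G0_eq[OF True, of f] by (simp add: Z_def)
    qed (simp add: dens'_def)
    then have "Aint (G0 f) i = (\<integral>x. Z * rs i * (dens' x * (f x * indicator (Xi i) x)) \<partial>K)"
      unfolding Aint_def by (simp only:)
    also have "\<dots> = Z * rs i * Aint f i" unfolding Aint_def by (rule integral_mult_right_zero)
    finally show ?thesis using rs_pos[OF i] by simp
  qed
  have "mh.pim (wt rs) (G0 f) = (\<Sum>i<d. Aint (G0 f) i / rs i) / Z"
    unfolding Z_def by (rule pim_wt[OF G0_meas[OF f(1)] G0_bound[OF f(2)]])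
  also have "\<dots> = (\<Sum>i<d. Aint f i)" using A Z by (simp add: sum_distrib_left[symmetric])
  also have "\<dots> = (LINT x:Xs|lam. f x * dens x)" by (rule sum_Aint[OF f])
  finally show ?thesis .
qed

text \<open>The coefficients of \<open>f\<close> in \<open>G\<close> and \<open>G0\<close> differ by
  an amount that depends on the chain through the stratum of \<open>X (Suc n)\<close> alone. There
  are finitely many strata, so the sum over all of them dominates wherever the chain is.\<close>

lemma G_diff:
  assumes \<omega>: "\<omega> \<in> space M" and c: "\<forall>i<d. (\<lambda>n. normalize_theta d (\<theta>t n \<omega>) i) \<longlonglongrightarrow> ts i"
    and f: "\<And>x. x \<in> Xs \<Longrightarrow> \<bar>f x\<bar> \<le> C"
  shows "(\<lambda>n. G f n \<omega> - G0 f (X (Suc n) \<omega>)) \<longlonglongrightarrow> 0"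
proof -
  define Z where "Z = (\<Sum>i<d. ts i / rs i)"
  have nz: "rs i \<noteq> 0" if "i < d" for i using rs_pos[OF that] by simp
  have Cw: "(\<lambda>n. Cw n \<omega>) \<longlonglongrightarrow> Z"
    unfolding Cw_def Z_def
    by (intro tendsto_sum tendsto_divide r_converges(1)[OF \<omega> c] nz) (use c in auto)
  have "(\<lambda>n. (\<Sum>j<d. \<bar>Cw n \<omega> * r n \<omega> j - Z * rs j\<bar>) * C) \<longlonglongrightarrow> (\<Sum>j<d. 0) * C"
    by (intro tendsto_mult[OF _ tendsto_const] tendsto_sum tendsto_rabs_zero LIM_zero tendsto_mult[OF Cw] r_converges(1)[OF \<omega> c]) simp
  then have lim: "(\<lambda>n. (\<Sum>j<d. \<bar>Cw n \<omega> * r n \<omega> j - Z * rs j\<bar>) * C) \<longlonglongrightarrow> 0" by simp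
  show ?thesis
  proof (rule Lim_null_comparison[OF always_eventually lim], rule allI)
    fix n
    define j where "j = idx (X (Suc n) \<omega>)"
    have j: "j < d" unfolding j_def by (rule idx(1)[OF X_in[OF \<omega>]])
    have "G f n \<omega> - G0 f (X (Suc n) \<omega>) = (Cw n \<omega> * r n \<omega> j - Z * rs j) * f (X (Suc n) \<omega>)"
      unfolding G_eq[OF \<omega>] G0_eq[OF X_in[OF \<omega>]] j_def Z_def by (simp only: left_diff_distrib)
    then have "norm (G f n \<omega> - G0 f (X (Suc n) \<omega>)) = \<bar>Cw n \<omega> * r n \<omega> j - Z * rs j\<bar> * \<bar>f (X (Suc n) \<omega>)\<bar>"
      by (simp only: real_norm_def abs_mult)
    also have "\<dots> \<le> (\<Sum>j<d. \<bar>Cw n \<omega> * r n \<omega> j - Z * rs j\<bar>) * C"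
    proof (rule mult_mono)
      show "\<bar>Cw n \<omega> * r n \<omega> j - Z * rs j\<bar> \<le> (\<Sum>j<d. \<bar>Cw n \<omega> * r n \<omega> j - Z * rs j\<bar>)"
        using j by (intro member_le_sum[of j "{..<d}" "\<lambda>j. \<bar>Cw n \<omega> * r n \<omega> j - Z * rs j\<bar>"]) auto
    qed (auto intro: f X_in[OF \<omega>] sum_nonneg)
    finally show "norm (G f n \<omega> - G0 f (X (Suc n) \<omega>)) \<le> (\<Sum>j<d. \<bar>Cw n \<omega> * r n \<omega> j - Z * rs j\<bar>) * C" .
  qed
qed

lemma G_average:
  assumes f: "f \<in> borel_measurable K" "\<And>x. x \<in> Xs \<Longrightarrow> \<bar>f x\<bar> \<le> C"
  shows "AE \<omega> in M. (\<lambda>n. (\<Sum>k<n. G f k \<omega>) / real n) \<longlonglongrightarrow> (LINT x:Xs|lam. f x * dens x)"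
proof -
  have pim: "mh.pim (wt rs) (G0 f) = (LINT x:Xs|lam. f x * dens x)" by (rule pim_G0[OF f])
  have "AE \<omega> in M. (\<lambda>n. (\<Sum>k<n. G0 f (X (Suc k) \<omega>)) / real n) \<longlonglongrightarrow> mh.pim (wt rs) (G0 f)"
    by (rule average_converges[OF G0_meas[OF f(1)] G0_bound[OF f(2)]])
  moreover note theta_converges
  moreover have "AE \<omega> in M. \<omega> \<in> space M" by simp
  ultimately show ?thesis
  proof eventually_elim
    case (elim \<omega>)
    have "(\<lambda>n. (\<Sum>k<n. G f k \<omega> - G0 f (X (Suc k) \<omega>)) / real n) \<longlonglongrightarrow> 0"
      by (rule cesaro_mean[OF G_diff[OF elim(3,2) f(2)]])
    from tendsto_add[OF this elim(1)]
    have "(\<lambda>n. (\<Sum>k<n. G f k \<omega> - G0 f (X (Suc k) \<omega>)) / real n + (\<Sum>k<n. G0 f (X (Suc k) \<omega>)) / real n)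
        \<longlonglongrightarrow> mh.pim (wt rs) (G0 f)" by simp
    then show ?case
      unfolding add_divide_distrib[symmetric] sum.distrib[symmetric] pim diff_add_cancel .
  qed
qed

text \<open>\<open>G\<close> minus \<open>G0\<close> is bounded and tends to 0 almost surely, so its
  mean tends to 0. \<open>G0\<close> is a fixed function of the chain, to which the convergence of
  means applies.\<close>

lemma G_expectation:
  assumes f: "f \<in> borel_measurable K" "\<And>x. x \<in> Xs \<Longrightarrow> \<bar>f x\<bar> \<le> C"
  shows "(\<lambda>n. \<integral>\<omega>. G f n \<omega> \<partial>M) \<longlonglongrightarrow> (LINT x:Xs|lam. f x * dens x)"
proof -
  have X_comp: "(\<lambda>\<omega>. h (X n \<omega>)) \<in> borel_measurable M" if "h \<in> borel_measurable K" for h :: "'x \<Rightarrow> real" and n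
    by (rule measurable_compose[OF fs.measurable_F[OF X_F] that])
  have Gm: "G f n \<in> borel_measurable M" for n
    unfolding G_def Cw_def
    by (intro borel_measurable_times borel_measurable_sum borel_measurable_divide fs.measurable_F[OF th_meas]
        fs.measurable_F[OF r_meas] X_comp[OF f(1)] X_comp borel_measurable_indicator Xi_sets) simp_all
  have G0m: "(\<lambda>\<omega>. G0 f (X (Suc n) \<omega>)) \<in> borel_measurable M" for n
    by (rule X_comp[OF G0_meas[OF f(1)]])
  have Gi: "integrable M (G f n)" for n
    by (rule fs.integrable_bounded[OF Gm G_bound[OF _ f(2)]])
  have G0b: "\<bar>G0 f (X (Suc n) \<omega>)\<bar> \<le> (\<Sum>i<d. ts i / rs i) * Rb * C" if "\<omega> \<in> space M" for n \<omega>
    by (rule G0_bound[OF f(2) X_in[OF that]])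
  have G0i: "integrable M (\<lambda>\<omega>. G0 f (X (Suc n) \<omega>))" for n
    by (rule fs.integrable_bounded[OF G0m G0b])
  have "(\<lambda>n. \<integral>\<omega>. G f n \<omega> - G0 f (X (Suc n) \<omega>) \<partial>M) \<longlonglongrightarrow> (\<integral>\<omega>. 0 \<partial>M)"
  proof (rule integral_dominated_convergence[where w = "\<lambda>_. real d / c5 * Rb * C + (\<Sum>i<d. ts i / rs i) * Rb * C"])
    show "(\<lambda>\<omega>. G f n \<omega> - G0 f (X (Suc n) \<omega>)) \<in> borel_measurable M" for n
      by (intro borel_measurable_diff Gm G0m)
    show "AE \<omega> in M. (\<lambda>n. G f n \<omega> - G0 f (X (Suc n) \<omega>)) \<longlonglongrightarrow> 0"
      using theta_converges by (rule AE_mp) (intro AE_I2 impI G_diff[OF _ _ f(2)])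
    show "AE \<omega> in M. norm (G f n \<omega> - G0 f (X (Suc n) \<omega>)) \<le> real d / c5 * Rb * C + (\<Sum>i<d. ts i / rs i) * Rb * C" for n
    proof (rule AE_I2)
      fix \<omega> assume \<omega>: "\<omega> \<in> space M"
      show "norm (G f n \<omega> - G0 f (X (Suc n) \<omega>)) \<le> real d / c5 * Rb * C + (\<Sum>i<d. ts i / rs i) * Rb * C"
        unfolding real_norm_def
        by (rule order_trans[OF abs_triangle_ineq4 add_mono[OF G_bound[OF \<omega> f(2)] G0b[OF \<omega>]]])
    qed
  qed simp_all
  then have "(\<lambda>n. (\<integral>\<omega>. G f n \<omega> \<partial>M) - (\<integral>\<omega>. G0 f (X (Suc n) \<omega>) \<partial>M)) \<longlonglongrightarrow> 0"
    using Gi G0i by simp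
  moreover have "(\<lambda>n. \<integral>\<omega>. G0 f (X (Suc n) \<omega>) \<partial>M) \<longlonglongrightarrow> mh.pim (wt rs) (G0 f)"
    by (rule LIMSEQ_Suc[OF expectation_converges[OF G0_meas[OF f(1)] G0_bound[OF f(2)]]])
  ultimately have "(\<lambda>n. (\<integral>\<omega>. G f n \<omega> \<partial>M) - (\<integral>\<omega>. G0 f (X (Suc n) \<omega>) \<partial>M) + (\<integral>\<omega>. G0 f (X (Suc n) \<omega>) \<partial>M))
      \<longlonglongrightarrow> 0 + mh.pim (wt rs) (G0 f)"
    by (rule tendsto_add)
  moreover have "mh.pim (wt rs) (G0 f) = (LINT x:Xs|lam. f x * dens x)" by (rule pim_G0[OF f])
  ultimately show ?thesis by (simp only: diff_add_cancel add_0_left)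
qed

lemma pim_rs:
  assumes f: "f \<in> borel_measurable K" "\<And>x. x \<in> Xs \<Longrightarrow> \<bar>f x\<bar> \<le> C"
  shows "mh.pim (wt rs) f = (LINT x:Xs|lam. f x * pi_rho lam dens Xi d rho ts x)"
  by (rule pim_pi_rho[OF rs_pos f, symmetric])

end

section \<open>Convergence under the original hypotheses\<close>

theorem theorem3p1:
  fixes lam :: "'x::euclidean_space measure"
    and Xs :: "'x set" and dens :: "'x \<Rightarrow> real"
    and d :: nat and Xi :: "nat \<Rightarrow> 'x set"
    and q :: "'x \<Rightarrow> 'x \<Rightarrow> real" and rho :: "real \<Rightarrow> real"
    and \<alpha> \<gamma> \<mu> :: real
    and M :: "'w measure"
    and \<theta>t :: "nat \<Rightarrow> 'w \<Rightarrow> nat \<Rightarrow> real"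
    and X :: "nat \<Rightarrow> 'w \<Rightarrow> 'x"
  assumes lam_sets: "sets lam = sets borel"
    and Xs_meas: "Xs \<in> sets lam"
    and d_ge: "d \<ge> 2"
    and Xi_meas: "\<forall>i<d. Xi i \<in> sets lam"
    and Xi_disj: "disjoint_family_on Xi {..<d}"
    and Xi_cover: "(\<Union>i<d. Xi i) = Xs"
    and pi_meas: "dens \<in> borel_measurable lam"
    and pi_nonneg: "\<forall>x\<in>Xs. 0 \<le> dens x"
    and pi_int: "set_integrable lam Xs dens"
    and pi_prob: "(LINT x:Xs|lam. dens x) = 1"
    \<comment> \<open>A1\<close>
    and A1_bdd: "\<exists>B. \<forall>x\<in>Xs. dens x \<le> B"
    and A1_pos: "\<forall>i<d. 0 < theta_star lam dens Xi i"
    \<comment> \<open>A2: proposal q(x,y) lam(dy), a Markov kernel on Xs, symmetric, inf q > 0\<close>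
    and q_meas: "(\<lambda>(x, y). q x y) \<in> borel_measurable (lam \<Otimes>\<^sub>M lam)"
    and q_prob: "\<forall>x\<in>Xs. set_integrable lam Xs (q x) \<and> (LINT y:Xs|lam. q x y) = 1"
    and q_sym: "\<forall>x\<in>Xs. \<forall>y\<in>Xs. q x y = q y x"
    and q_inf: "\<exists>c>0. \<forall>x\<in>Xs. \<forall>y\<in>Xs. c \<le> q x y"
    \<comment> \<open>rho : (0,1) -> (0,infinity) measurable\<close>
    and rho_meas: "set_borel_measurable borel {0<..<1} rho"
    and rho_pos: "\<forall>t\<in>{0<..<1}. 0 < rho t"
    \<comment> \<open>R1\<close>
    and R1: "\<forall>K. compact K \<and> K \<subseteq> {0<..<1} \<longrightarrow>
               (\<exists>C. \<forall>t\<in>K. \<forall>t'\<in>{0<..<1}. \<bar>1 - rho t' / rho t\<bar> \<le> C * \<bar>t' - t\<bar>)"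
    \<comment> \<open>R2\<close>
    and R2: "bdd_above (rho ` {0<..<1})"
    \<comment> \<open>R3\<close>
    and R3_mono: "mono_on {0<..<1} rho"
    and R3: "\<exists>R>1. \<exists>c>0. \<forall>t\<in>{0<..<1/R}. c \<le> rho t / rho (R * t)"
    \<comment> \<open>R4\<close>
    and R4_anti: "\<forall>s t. 0 < s \<and> s \<le> t \<and> t < 1 \<longrightarrow> rho t / t \<le> rho s / s"
    and R4_lim: "filterlim (\<lambda>t. rho t / t) at_top (at_right 0)"
    \<comment> \<open>R5\<close>
    and R5: "\<exists>c>0. \<forall>t\<in>{0<..<1}. c \<le> rho t / t"
    \<comment> \<open>parameters\<close>
    and \<alpha>_range: "1/2 < \<alpha> \<and> \<alpha> \<le> 1"
    and \<gamma>_pos: "0 < \<gamma>"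
    and \<mu>_pos: "0 < \<mu>"
    and cases: "(\<alpha> < 1) \<or> (\<alpha> = 1 \<and> 1 \<le> \<mu>)
                \<or> (\<alpha> = 1 \<and> \<mu> < 1 \<and> (\<exists>a. 0 \<le> a \<and> a < 1 \<and> (\<forall>t\<in>{0<..<1}. rho t = t powr a)))"
    \<comment> \<open>the SHUS algorithm on the probability space M\<close>
    and M_prob: "prob_space M"
    and init_meas: "\<forall>i<d. (\<lambda>\<omega>. \<theta>t 0 \<omega> i) \<in> borel_measurable M"
    and init_pos: "\<forall>\<omega>\<in>space M. \<forall>i<d. 0 < \<theta>t 0 \<omega> i"
    and X_meas: "\<forall>n. X n \<in> borel_measurable M"
    and X_in: "\<forall>n. \<forall>\<omega>\<in>space M. X n \<omega> \<in> Xs"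
    and X_law: "\<forall>n. \<forall>A\<in>sets lam. \<forall>B\<in>hist_sigma M d \<theta>t X n.
                  measure M ({\<omega>\<in>space M. X (Suc n) \<omega> \<in> A} \<inter> B)
                  = (\<integral>\<omega>. indicator B \<omega> *
                       P_rho lam Xs q dens Xi d rho (normalize_theta d (\<theta>t n \<omega>)) (X n \<omega>) A \<partial>M)"
    and update: "\<forall>n. \<forall>\<omega>\<in>space M. \<forall>i<d.
                  \<theta>t (Suc n) \<omega> i = \<theta>t n \<omega> i
                    + \<gamma> / g_fun \<alpha> \<mu> (S_of d (\<theta>t n \<omega>)) * S_of d (\<theta>t n \<omega>)
                      * rho (normalize_theta d (\<theta>t n \<omega>) i) * indicator (Xi i) (X (Suc n) \<omega>)"
  shows
    \<comment> \<open>(i)\<close>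
    "(AE \<omega> in M. \<forall>i<d. (\<lambda>n. normalize_theta d (\<theta>t n \<omega>) i) \<longlonglongrightarrow> theta_star lam dens Xi i)
     \<and>
    \<comment> \<open>(ii)\<close>
     (\<forall>f::'x \<Rightarrow> real. f \<in> borel_measurable lam \<and> (\<exists>B. \<forall>x\<in>Xs. \<bar>f x\<bar> \<le> B) \<longrightarrow>
        (\<lambda>n. \<integral>\<omega>. f (X n \<omega>) \<partial>M)
          \<longlonglongrightarrow> (LINT x:Xs|lam. f x * pi_rho lam dens Xi d rho (theta_star lam dens Xi) x)
        \<and> (AE \<omega> in M. (\<lambda>n. (\<Sum>k=1..n. f (X k \<omega>)) / real n)
          \<longlonglongrightarrow> (LINT x:Xs|lam. f x * pi_rho lam dens Xi d rho (theta_star lam dens Xi) x)))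
     \<and>
    \<comment> \<open>(iii), with the index n shifted by one: the n-th term uses theta_n and X_(n+1)\<close>
     (\<forall>f::'x \<Rightarrow> real. f \<in> borel_measurable lam \<and> (\<exists>B. \<forall>x\<in>Xs. \<bar>f x\<bar> \<le> B) \<longrightarrow>
        (\<lambda>n. \<integral>\<omega>. (\<Sum>i<d. normalize_theta d (\<theta>t n \<omega>) i / rho (normalize_theta d (\<theta>t n \<omega>) i))
                  * (\<Sum>j<d. rho (normalize_theta d (\<theta>t n \<omega>) j) * f (X (Suc n) \<omega>)
                              * indicator (Xi j) (X (Suc n) \<omega>)) \<partial>M)
          \<longlonglongrightarrow> (LINT x:Xs|lam. f x * dens x)
        \<and> (AE \<omega> in M. (\<lambda>n. (\<Sum>k<n. (\<Sum>i<d. normalize_theta d (\<theta>t k \<omega>) i / rho (normalize_theta d (\<theta>t k \<omega>) i))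
                  * (\<Sum>j<d. rho (normalize_theta d (\<theta>t k \<omega>) j) * f (X (Suc k) \<omega>)
                              * indicator (Xi j) (X (Suc k) \<omega>))) / real n)
          \<longlonglongrightarrow> (LINT x:Xs|lam. f x * dens x)))"
proof -
  obtain B0 where B0: "\<And>x. x \<in> Xs \<Longrightarrow> dens x \<le> B0" using A1_bdd by blast
  \<comment> \<open>The maximum with 1 makes the bound positive, as the quotient in
    \<open>dl\<close> requires.\<close>
  define B where "B = max 1 B0"
  have B: "0 < B" "\<And>x. x \<in> Xs \<Longrightarrow> dens x \<le> B"
    using B0 by (auto simp: B_def le_max_iff_disj)
  obtain qmin where qmin: "0 < qmin" "\<And>x y. x \<in> Xs \<Longrightarrow> y \<in> Xs \<Longrightarrow> qmin \<le> q x y"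
    using q_inf by blast
  obtain Rb where Rb: "\<And>t. t \<in> {0<..<1} \<Longrightarrow> rho t \<le> Rb"
    using R2 unfolding bdd_above_def by blast
  obtain c5 where c5: "0 < c5" "\<And>t. t \<in> {0<..<1} \<Longrightarrow> c5 \<le> rho t / t"
    using R5 by blast
  have rho: "rho_function rho Rb c5"
  proof
    show "rho s \<le> rho t" if "0 < s" "s \<le> t" "t < 1" for s t
      using that by (intro mono_onD[OF R3_mono]) auto
    show "c5 * t \<le> rho t" if "0 < t" "t < 1" for t
      using c5(2)[of t] that by (simp add: pos_le_divide_eq)
  qed (use rho_pos Rb c5(1) R4_anti in auto)
  interpret shus rho Rb c5 M lam Xs dens d Xi q \<alpha> \<gamma> \<mu> B qmin \<theta>t X
  proof (intro shus.intro rho M_prob shus_axioms.intro)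
    show "theta_star lam dens Xi i > 0" if "i < d" for i using A1_pos that by blast
    show "\<theta>t (Suc n) \<omega> i = \<theta>t n \<omega> i
        + \<gamma> / g_fun \<alpha> \<mu> (S_of d (\<theta>t n \<omega>)) * S_of d (\<theta>t n \<omega>)
          * rho (normalize_theta d (\<theta>t n \<omega>) i) * indicator (Xi i) (X (Suc n) \<omega>)"
      if "\<omega> \<in> space M" "i < d" for n \<omega> i
      using update that by blast
    show "measure M ({\<omega> \<in> space M. X (Suc n) \<omega> \<in> A} \<inter> H)
        = (\<integral>\<omega>. indicator H \<omega> * P_rho lam Xs q dens Xi d rho (normalize_theta d (\<theta>t n \<omega>)) (X n \<omega>) A \<partial>M)"
      if "A \<in> sets lam" "H \<in> hist_sigma M d \<theta>t X n" for n A H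
      using X_law that by blast
  qed (rule lam_sets Xs_meas d_ge Xi_disj Xi_cover pi_meas pi_int pi_prob B qmin q_meas rho_meas \<gamma>_pos \<mu>_pos
        \<alpha>_range[THEN conjunct1] \<alpha>_range[THEN conjunct2] Xi_meas[rule_format] pi_nonneg[rule_format]
        q_prob[rule_format, THEN conjunct1] q_prob[rule_format, THEN conjunct2] q_sym[rule_format]
        init_meas[rule_format] init_pos[rule_format] X_meas[rule_format] X_in[rule_format]; assumption)+
  show ?thesis
  proof (intro conjI allI impI)
    show "AE \<omega> in M. \<forall>i<d. (\<lambda>n. normalize_theta d (\<theta>t n \<omega>) i) \<longlonglongrightarrow> theta_star lam dens Xi i"
      by (rule theta_converges)
  next
    fix f :: "'x \<Rightarrow> real"
    assume "f \<in> borel_measurable lam \<and> (\<exists>B. \<forall>x\<in>Xs. \<bar>f x\<bar> \<le> B)"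
    then obtain C where f: "f \<in> borel_measurable K" "\<And>x. x \<in> Xs \<Longrightarrow> \<bar>f x\<bar> \<le> C"
      unfolding measurable_K by blast
    have pim: "mh.pim (wt rs) f = (LINT x:Xs|lam. f x * pi_rho lam dens Xi d rho (theta_star lam dens Xi) x)"
      by (rule pim_rs[OF f])
    have G: "(\<Sum>i<d. normalize_theta d (\<theta>t n \<omega>) i / rho (normalize_theta d (\<theta>t n \<omega>) i))
        * (\<Sum>j<d. rho (normalize_theta d (\<theta>t n \<omega>) j) * f (X (Suc n) \<omega>) * indicator (Xi j) (X (Suc n) \<omega>)) = G f n \<omega>"
      for n \<omega>
      unfolding G_def Cw_def r_def ..
    show "(\<lambda>n. \<integral>\<omega>. f (X n \<omega>) \<partial>M)
        \<longlonglongrightarrow> (LINT x:Xs|lam. f x * pi_rho lam dens Xi d rho (theta_star lam dens Xi) x)"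
      unfolding pim[symmetric] by (rule expectation_converges[OF f])
    \<comment> \<open>The sum from 1 to \<open>n\<close> is re-indexed as a sum over
      \<open>k < n\<close> of the values at time \<open>k + 1\<close>.\<close>
    show "AE \<omega> in M. (\<lambda>n. (\<Sum>k=1..n. f (X k \<omega>)) / real n)
        \<longlonglongrightarrow> (LINT x:Xs|lam. f x * pi_rho lam dens Xi d rho (theta_star lam dens Xi) x)"
      unfolding pim[symmetric] One_nat_def sum.atLeast1_atMost_eq by (rule average_converges[OF f])
    show "(\<lambda>n. \<integral>\<omega>. (\<Sum>i<d. normalize_theta d (\<theta>t n \<omega>) i / rho (normalize_theta d (\<theta>t n \<omega>) i))
        * (\<Sum>j<d. rho (normalize_theta d (\<theta>t n \<omega>) j) * f (X (Suc n) \<omega>) * indicator (Xi j) (X (Suc n) \<omega>)) \<partial>M)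
        \<longlonglongrightarrow> (LINT x:Xs|lam. f x * dens x)"
      unfolding G by (rule G_expectation[OF f])
    show "AE \<omega> in M. (\<lambda>n. (\<Sum>k<n. (\<Sum>i<d. normalize_theta d (\<theta>t k \<omega>) i / rho (normalize_theta d (\<theta>t k \<omega>) i))
        * (\<Sum>j<d. rho (normalize_theta d (\<theta>t k \<omega>) j) * f (X (Suc k) \<omega>) * indicator (Xi j) (X (Suc k) \<omega>))) / real n)
        \<longlonglongrightarrow> (LINT x:Xs|lam. f x * dens x)"
      unfolding G by (rule G_average[OF f])
  qed
qed

end
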